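(* Let $(V,\rho)$ be a seminormed $\mathbb{R}$-vector space and let $d\ge1$ be an integer. The relation $L(f)=\int_{V^*}\hat f\,d\mu$ for all $f\in S(V)$ defines a one-to-one correspondence $L\leftrightarrow\mu$ between the $\overline{\rho}$-continuous linear functionals $L:S(V)\to\mathbb{R}$ satisfying $L(\sum S(V)^{2d})\subseteq[0,\infty)$ and the nonnegative Radon measures $\mu$ on $V^*$ supported by $\overline{B}_1(\rho')$. Moreover, for any $2d$-power module $M$ of $S(V)$, if $L\leftrightarrow\mu$ under this correspondence, then $L(M)\subseteq[0,\infty)$ if and only if $\mu$ is supported by $$X_M\cap\overline{B}_1(\rho'):=\{v^*\in\overline{B}_1(\rho'):\hat g(v^* )\ge0\ \ \forall g\in M\}.$$
   Context: $S(V)=\bigoplus_{k\ge0}S(V)_k$ is the symmetric algebra of $V$ (a commutative unital graded $\mathbb{R}$-algebra with $S(V)_0=\mathbb{R}$, $S(V)_1=V$). Seminorms take values in $[0,\infty)$. For the seminorm $\rho$ on $V$, set $\overline{\rho}_0:=|\cdot|$ on $\mathbb{R}$, and for $k\ge1$, $f\in S(V)_k$, $$\overline{\rho}_k(f):=\inf\Big\{\sum_{i=1}^n\rho(f_{i1})\cdots\rho(f_{ik}):f=\sum_{i=1}^nf_{i1}\cdots f_{ik},\ f_{ij}\in V,\ n\ge1\Big\}.$$ The projective extension $\overline{\rho}$ is the (submultiplicative) seminorm on $S(V)$ given by $\overline{\rho}(f):=\sum_k\overline{\rho}_k(f_k)$ for $f=\sum_kf_k$, $f_k\in S(V)_k$.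 $\sum S(V)^{2d}$ is the set of finite sums of $2d$-th powers of elements of $S(V)$. A $2d$-power module of $S(V)$ is a subset $M$ with $1\in M$, $M+M\subseteq M$, $a^{2d}M\subseteq M$ for all $a\in S(V)$. $V^*=\operatorname{Hom}(V,\mathbb{R})$ is the algebraic dual, with the coarsest topology making $v^*\mapsto v^*(f)$ continuous for every $f\in V$. Each $v^*\in V^*$ extends uniquely to a unital $\mathbb{R}$-algebra homomorphism $\overline{v^*}:S(V)\to\mathbb{R}$; $\hat f(v^* ):=\overline{v^*}(f)$ for $f\in S(V)$. $\rho'(v^* ):=\inf\{C\in[0,\infty):|v^*(w)|\le C\rho(w)\ \forall w\in V\}$ (with $\inf\emptyset=\infty$), and $\overline{B}_1(\rho'):=\{v^*\in V^*:\rho'(v^* )\le1\}$. A measure $\mu$ on $V^*$ is supported by a Borel set $Y$ if $\mu(V^*\setminus Y)=0$. *)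

theory Defs
  imports "HOL-Analysis.Analysis" "HOL-Library.Multiset" "HOL-Library.Poly_Mapping"
begin

section \<open>The symmetric algebra of a real vector space\<close>

text \<open>
  \<open>S(V)\<close> is the polynomial ring over the reals with one variable \<open>X v\<close> for every vector \<open>v\<close>,
  modulo the ideal generated by \<open>X (v + w) - X v - X w\<close> and \<open>X (c v) - c (X v)\<close>. Monomials are
  finite multisets of vectors.
\<close>

type_synonym 'v vpoly = "'v multiset \<Rightarrow>\<^sub>0 real"

definition vvar :: "'v \<Rightarrow> 'v vpoly"
  where "vvar v = Poly_Mapping.single {#v#} 1"

definition sym_relations :: "'v::real_vector vpoly set"
  where "sym_relations =
    {vvar (v + w) - vvar v - vvar w | v w. True} \<union>
    {vvar (c *\<^sub>R v) - Poly_Mapping.single 0 c * vvar v | c v. True}"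

text \<open>A span over the ring acting on itself by multiplication is a generated ideal.\<close>

definition sym_ideal :: "'v::real_vector vpoly set"
  where "sym_ideal = module.span (*) sym_relations"

lemma module_mult: "module ((*) :: 'a::comm_ring_1 \<Rightarrow> 'a \<Rightarrow> 'a)"
  by unfold_locales (auto simp: algebra_simps)

lemma sym_ideal_add: "p \<in> sym_ideal \<Longrightarrow> q \<in> sym_ideal \<Longrightarrow> p + q \<in> sym_ideal"
  and sym_ideal_diff: "p \<in> sym_ideal \<Longrightarrow> q \<in> sym_ideal \<Longrightarrow> p - q \<in> sym_ideal"
  and sym_ideal_zero: "0 \<in> sym_ideal"
  and sym_ideal_mult: "q \<in> sym_ideal \<Longrightarrow> p * q \<in> sym_ideal"
  and sym_ideal_base: "p \<in> sym_relations \<Longrightarrow> p \<in> sym_ideal"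
  unfolding sym_ideal_def
  by (auto intro: module.span_add[OF module_mult] module.span_diff[OF module_mult]
      module.span_zero[OF module_mult] module.span_scale[OF module_mult]
      module.span_base[OF module_mult])

lemma sym_ideal_induct [consumes 1, case_names zero step]:
  assumes "p \<in> sym_ideal" "P 0"
    and "\<And>c g q. g \<in> sym_relations \<Longrightarrow> P q \<Longrightarrow> P (c * g + q)"
  shows "P p"
  using assms(1) unfolding sym_ideal_def
  by (rule module.span_induct_alt[OF module_mult]) (use assms in auto)

definition sym_rel :: "'v::real_vector vpoly \<Rightarrow> 'v vpoly \<Rightarrow> bool"
  where "sym_rel p q \<longleftrightarrow> p - q \<in> sym_ideal"

lemma sym_rel_refl: "sym_rel p p"
  by (simp add: sym_rel_def sym_ideal_zero)

lemma equivp_sym_rel: "equivp sym_rel"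
proof (rule equivpI)
  show "reflp sym_rel" by (simp add: reflp_def sym_rel_refl)
  show "symp sym_rel"
    unfolding symp_def sym_rel_def using sym_ideal_diff[OF sym_ideal_zero] by fastforce
  show "transp sym_rel"
    unfolding transp_def sym_rel_def using sym_ideal_add by fastforce
qed

quotient_type (overloaded) 'v symalg = "'v::real_vector vpoly" / sym_rel
  by (rule equivp_sym_rel)

text \<open>Evaluation of formal polynomials, needed to see that the quotient is not the zero ring.\<close>

definition vpoly_eval :: "('v \<Rightarrow> 'b::{comm_ring_1,real_algebra_1}) \<Rightarrow> 'v vpoly \<Rightarrow> 'b"
  where "vpoly_eval g p = (\<Sum>m\<in>Poly_Mapping.keys p. Poly_Mapping.lookup p m *\<^sub>R (\<Prod>v\<in>#m. g v))"

lemma vpoly_eval_superset: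
  assumes "finite A" "Poly_Mapping.keys p \<subseteq> A"
  shows "vpoly_eval g p = (\<Sum>m\<in>A. Poly_Mapping.lookup p m *\<^sub>R (\<Prod>v\<in>#m. g v))"
  unfolding vpoly_eval_def
  by (rule sum.mono_neutral_left) (use assms in \<open>auto simp: in_keys_iff\<close>)

lemma vpoly_eval_zero [simp]: "vpoly_eval g 0 = 0"
  by (simp add: vpoly_eval_def)

lemma vpoly_eval_single: "vpoly_eval g (Poly_Mapping.single m c) = c *\<^sub>R (\<Prod>v\<in>#m. g v)"
  by (subst vpoly_eval_superset[of "{m}"]) auto

lemma vpoly_eval_add: "vpoly_eval g (p + q) = vpoly_eval g p + vpoly_eval g q"
proof -
  let ?A = "Poly_Mapping.keys p \<union> Poly_Mapping.keys q"
  have "Poly_Mapping.keys (p + q) \<subseteq> ?A" by (rule Poly_Mapping.keys_add)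
  then show ?thesis
    by (simp add: vpoly_eval_superset[of ?A] lookup_add scaleR_add_left sum.distrib)
qed

lemma vpoly_eval_uminus: "vpoly_eval g (- p) = - vpoly_eval g p"
  using vpoly_eval_add[of g p "- p"] by (simp add: eq_neg_iff_add_eq_0 add.commute)

lemma vpoly_eval_diff: "vpoly_eval g (p - q) = vpoly_eval g p - vpoly_eval g q"
  using vpoly_eval_add[of g p "- q"] by (simp add: vpoly_eval_uminus)

lemma vpoly_induct [case_names zero add]:
  fixes p :: "'v vpoly"
  assumes "P 0" "\<And>m c q. P q \<Longrightarrow> P (Poly_Mapping.single m c + q)"
  shows "P p"
proof (induction p rule: Poly_Mapping.update_induct)
  case const
  then show ?case using assms(1) by simp
next
  case (update q m c)
  have "Poly_Mapping.update m c q = Poly_Mapping.single m c + q"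
    using update
    by (intro poly_mapping_eqI)
      (auto simp: lookup_update lookup_add lookup_single when_def in_keys_iff)
  then show ?case using assms(2) update by simp
qed

lemma vpoly_eval_mult: "vpoly_eval g (p * q) = vpoly_eval g p * vpoly_eval g q"
proof (induction p rule: vpoly_induct)
  case zero
  then show ?case by simp
next
  case (add m c p)
  have "vpoly_eval g (Poly_Mapping.single m c * q) = vpoly_eval g (Poly_Mapping.single m c) * vpoly_eval g q"
    by (induction q rule: vpoly_induct)
      (simp_all add: vpoly_eval_add vpoly_eval_single distrib_left mult_single)
  then show ?case using add by (simp add: vpoly_eval_add distrib_right)
qed

lemma vpoly_eval_sym_ideal:
  assumes "linear g" "p \<in> sym_ideal"
  shows "vpoly_eval g p = 0"
  using assms(2)
proof (induction rule: sym_ideal_induct)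
  case zero
  then show ?case by simp
next
  case (step c r q)
  have "vpoly_eval g r = 0"
    using step(1) linear_add[OF assms(1)] linear_cmul[OF assms(1)]
    by (auto simp: sym_relations_def vvar_def vpoly_eval_diff vpoly_eval_mult vpoly_eval_single)
  then show ?case using step by (simp add: vpoly_eval_add vpoly_eval_mult)
qed

lemma one_notin_sym_ideal: "1 \<notin> sym_ideal"
proof
  assume "(1 :: 'v::real_vector vpoly) \<in> sym_ideal"
  then have "vpoly_eval (\<lambda>_::'v. 0::real) 1 = 0"
    by (rule vpoly_eval_sym_ideal[rotated]) (rule linear_zero)
  then show False using vpoly_eval_single[of "\<lambda>_::'v. 0::real" 0 1] by simp
qed

lemma sym_rel_mult:
  assumes "sym_rel p p'" "sym_rel q q'"
  shows "sym_rel (p * q) (p' * q')"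
proof -
  have "p * q - p' * q' = p * (q - q') + q' * (p - p')" by (simp add: algebra_simps)
  then show ?thesis using assms by (simp add: sym_rel_def sym_ideal_add sym_ideal_mult)
qed

instantiation symalg :: (real_vector) comm_ring_1
begin

lift_definition zero_symalg :: "'a symalg" is 0 .
lift_definition one_symalg :: "'a symalg" is 1 .
lift_definition plus_symalg :: "'a symalg \<Rightarrow> 'a symalg \<Rightarrow> 'a symalg" is "(+)"
  unfolding sym_rel_def by (metis sym_ideal_add add_diff_add)
lift_definition uminus_symalg :: "'a symalg \<Rightarrow> 'a symalg" is uminus
  unfolding sym_rel_def using sym_ideal_diff[OF sym_ideal_zero] by fastforce
lift_definition minus_symalg :: "'a symalg \<Rightarrow> 'a symalg \<Rightarrow> 'a symalg" is "(-)"
proof -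
  fix p p' q q' :: "'a vpoly"
  assume "sym_rel p p'" "sym_rel q q'"
  moreover have "p - q - (p' - q') = (p - p') - (q - q')" by simp
  ultimately show "sym_rel (p - q) (p' - q')" unfolding sym_rel_def using sym_ideal_diff by metis
qed
lift_definition times_symalg :: "'a symalg \<Rightarrow> 'a symalg \<Rightarrow> 'a symalg" is "(*)"
  by (rule sym_rel_mult)

instance
proof
  show "(0::'a symalg) \<noteq> 1"
    by transfer (use one_notin_sym_ideal sym_ideal_mult[of "- 1" "- 1"] in \<open>auto simp: sym_rel_def\<close>)
qed (transfer; simp add: algebra_simps sym_rel_refl)+

end

instantiation symalg :: (real_vector) real_algebra_1
begin

lift_definition scaleR_symalg :: "real \<Rightarrow> 'a symalg \<Rightarrow> 'a symalg"
  is "\<lambda>c p. Poly_Mapping.single 0 c * p"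
  by (simp add: sym_rel_mult sym_rel_refl)

instance
  by standard
    (transfer; simp add: algebra_simps sym_rel_refl single_add mult_single flip: mult.assoc)+

end

text \<open>The canonical map from \<open>V\<close> onto the degree one part of \<open>S(V)\<close>.\<close>

lift_definition sym_embed :: "'v::real_vector \<Rightarrow> 'v symalg" is vvar .

lemma linear_sym_embed: "linear (sym_embed :: 'v::real_vector \<Rightarrow> _)"
proof
  fix v w :: 'v and c :: real
  have "vvar (v + w) - (vvar v + vvar w) = vvar (v + w) - vvar v - vvar w"
    by (simp add: algebra_simps)
  moreover have "vvar (v + w) - vvar v - vvar w \<in> sym_ideal"
    by (rule sym_ideal_base) (auto simp: sym_relations_def)
  ultimately have "sym_rel (vvar (v + w)) (vvar v + vvar w)" by (simp only: sym_rel_def)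
  then show "sym_embed (v + w) = sym_embed v + sym_embed w"
    by (simp add: sym_embed.abs_eq plus_symalg.abs_eq symalg.abs_eq_iff)
  have "sym_rel (vvar (c *\<^sub>R v)) (Poly_Mapping.single 0 c * vvar v)"
    unfolding sym_rel_def by (rule sym_ideal_base) (auto simp: sym_relations_def)
  then show "sym_embed (c *\<^sub>R v) = c *\<^sub>R sym_embed v"
    by (simp add: sym_embed.abs_eq scaleR_symalg.abs_eq symalg.abs_eq_iff)
qed

definition real_algebra_hom :: "('a::real_algebra_1 \<Rightarrow> 'b::real_algebra_1) \<Rightarrow> bool"
  where "real_algebra_hom h \<longleftrightarrow> linear h \<and> h 1 = 1 \<and> (\<forall>x y. h (x * y) = h x * h y)"

lift_definition sym_monom :: "'v::real_vector multiset \<Rightarrow> real \<Rightarrow> 'v symalg" is Poly_Mapping.single .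

lemma sym_monom_eq: "sym_monom m c = c *\<^sub>R (\<Prod>v\<in>#m. sym_embed v)"
proof (induction m)
  case empty
  show ?case by simp (transfer, simp add: sym_rel_refl)
next
  case (add v m)
  have "sym_monom (add_mset v m) c = sym_embed v * sym_monom m c"
    by transfer (simp add: vvar_def mult_single sym_rel_refl)
  then show ?case using add by simp
qed

lemma symalg_induct [case_names zero add]:
  assumes "P 0" "\<And>m c f. P f \<Longrightarrow> P (c *\<^sub>R (\<Prod>v\<in>#m. sym_embed v) + f)"
  shows "P f"
proof -
  have *: "P (abs_symalg p)" for p
  proof (induction p rule: vpoly_induct)
    case zero
    show ?case using assms(1) by (simp add: zero_symalg_def)
  next
    case (add m c q)
    have "abs_symalg (Poly_Mapping.single m c + q) = sym_monom m c + abs_symalg q"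
      by (simp add: sym_monom.abs_eq plus_symalg.abs_eq)
    then show ?case using add assms(2) by (simp add: sym_monom_eq)
  qed
  show ?thesis using *[of "rep_symalg f"] by (simp add: Quotient3_abs_rep[OF Quotient3_symalg])
qed

lemma real_algebra_hom_monom:
  fixes h :: "'v::real_vector symalg \<Rightarrow> 'b::{comm_ring_1,real_algebra_1}"
  assumes "real_algebra_hom h"
  shows "h (c *\<^sub>R (\<Prod>v\<in>#m. sym_embed v)) = c *\<^sub>R (\<Prod>v\<in>#m. h (sym_embed v))"
proof -
  have "h (\<Prod>v\<in>#m. sym_embed v) = (\<Prod>v\<in>#m. h (sym_embed v))"
    using assms by (induction m) (auto simp: real_algebra_hom_def)
  then show ?thesis using assms by (simp add: real_algebra_hom_def linear_cmul)
qed

text \<open>The universal property, which determines \<open>S(V)\<close>.\<close>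

lemma symalg_universal:
  fixes g :: "'v::real_vector \<Rightarrow> 'b::{comm_ring_1,real_algebra_1}"
  assumes "linear g"
  shows "\<exists>!h. real_algebra_hom h \<and> (\<forall>v. h (sym_embed v) = g v)"
proof (rule ex_ex1I)
  define h where "h f = vpoly_eval g (rep_symalg f)" for f
  have abs: "h (abs_symalg p) = vpoly_eval g p" for p
  proof -
    have "sym_rel (rep_symalg (abs_symalg p)) p"
      using Quotient3_rep_abs[OF Quotient3_symalg] sym_rel_refl by blast
    then show ?thesis
      unfolding h_def sym_rel_def using vpoly_eval_sym_ideal[OF assms]
      by (metis vpoly_eval_diff eq_iff_diff_eq_0)
  qed
  have ex: "\<exists>p. f = abs_symalg p" for f :: "'v symalg"
    by (metis Quotient3_abs_rep[OF Quotient3_symalg])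
  have "h (x + y) = h x + h y" "h (x * y) = h x * h y" "h (c *\<^sub>R x) = c *\<^sub>R h x" for x y c
  proof -
    obtain p q where "x = abs_symalg p" "y = abs_symalg q" using ex by meson
    then show "h (x + y) = h x + h y" "h (x * y) = h x * h y" "h (c *\<^sub>R x) = c *\<^sub>R h x"
      by (simp_all add: plus_symalg.abs_eq times_symalg.abs_eq scaleR_symalg.abs_eq abs
          vpoly_eval_add vpoly_eval_mult vpoly_eval_single)
  qed
  moreover have "h 1 = 1"
    using vpoly_eval_single[of g 0 1] by (simp add: one_symalg_def abs)
  moreover have "h (sym_embed v) = g v" for v
    by (simp add: sym_embed.abs_eq abs vvar_def vpoly_eval_single)
  ultimately show "\<exists>h. real_algebra_hom h \<and> (\<forall>v. h (sym_embed v) = g v)"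
    by (auto simp: real_algebra_hom_def intro!: linearI exI[of _ h])
next
  fix h k
  assume h: "real_algebra_hom h \<and> (\<forall>v. h (sym_embed v) = g v)"
    and k: "real_algebra_hom k \<and> (\<forall>v. k (sym_embed v) = g v)"
  have "h f = k f" for f
  proof (induction f rule: symalg_induct)
    case zero
    then show ?case using h k by (simp add: real_algebra_hom_def linear_0)
  next
    case (add m c f)
    let ?x = "c *\<^sub>R (\<Prod>v\<in>#m. sym_embed v)"
    have "h (?x + f) = h ?x + h f" "k (?x + f) = k ?x + k f"
      using h k by (simp_all only: real_algebra_hom_def linear_add)
    moreover have "h ?x = k ?x"
      using h k by (simp add: real_algebra_hom_monom)
    ultimately show ?case using add by simp
  qed
  then show "h = k" by blast
qed


subsection \<open>Grading\<close>

definition sym_homogeneous :: "nat \<Rightarrow> 'v::real_vector symalg set"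
  where "sym_homogeneous k = span {\<Prod>j<k. sym_embed (v j) | v. True}"

lift_definition vpoly_part :: "nat \<Rightarrow> 'v vpoly \<Rightarrow> 'v vpoly"
  is "\<lambda>k p m. if size m = k then p m else 0"
  by (erule rev_finite_subset) auto

lemma vpoly_part_add: "vpoly_part k (p + q) = vpoly_part k p + vpoly_part k q"
  by transfer auto

lemma vpoly_part_diff: "vpoly_part k (p - q) = vpoly_part k p - vpoly_part k q"
  by transfer auto

lemma vpoly_part_zero [simp]: "vpoly_part k 0 = 0"
  by transfer auto

lemma vpoly_part_single:
  "vpoly_part k (Poly_Mapping.single m c) = (if size m = k then Poly_Mapping.single m c else 0)"
  by transfer (auto simp: when_def)

lemma vpoly_part_sym_ideal:
  assumes "p \<in> sym_ideal"
  shows "vpoly_part k p \<in> sym_ideal"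
  using assms
proof (induction rule: sym_ideal_induct)
  case zero
  then show ?case by (simp add: sym_ideal_zero)
next
  case (step c g q)
  have "vpoly_part k (c * g) \<in> sym_ideal"
  proof (induction c rule: vpoly_induct)
    case zero
    then show ?case by (simp add: sym_ideal_zero)
  next
    case (add m a c)
    have "vpoly_part k (Poly_Mapping.single m a * g) =
        (if Suc (size m) = k then Poly_Mapping.single m a * g else 0)"
      using step(1)
      by (auto simp: sym_relations_def vvar_def right_diff_distrib mult_single
          vpoly_part_diff vpoly_part_single)
    then have "vpoly_part k (Poly_Mapping.single m a * g) \<in> sym_ideal"
      using step(1) by (simp add: sym_ideal_zero sym_ideal_mult sym_ideal_base)
    then show ?case using add by (simp add: distrib_right vpoly_part_add sym_ideal_add)
  qed
  then show ?case using step by (simp add: vpoly_part_add sym_ideal_add)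
qed

lemma sym_homogeneous_0: "sym_homogeneous 0 = range of_real"
  by (simp add: sym_homogeneous_def span_singleton of_real_def full_SetCompr_eq)

lemma sym_homogeneous_1: "sym_homogeneous 1 = range (sym_embed :: 'v::real_vector \<Rightarrow> _)"
proof -
  have "{\<Prod>j<1::nat. sym_embed (v j) | v. True} = range (sym_embed :: 'v \<Rightarrow> _)"
    by (auto intro: exI[of _ "\<lambda>_. v" for v])
  then show ?thesis
    unfolding sym_homogeneous_def
    by (simp only:) (use linear_span_image[OF linear_sym_embed, of UNIV] in simp)
qed

lemma inj_sym_embed: "inj (sym_embed :: 'v::real_vector \<Rightarrow> 'v symalg)"
proof (rule linear_inj_on_iff_eq_0[OF linear_sym_embed, of UNIV, simplified, THEN iffD2], intro allI impI)
  fix v :: 'v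
  assume 0: "sym_embed v = 0"
  show "v = 0"
  proof (rule ccontr)
    assume "v \<noteq> 0"
    then obtain g :: "'v \<Rightarrow> real" where g: "linear g" "g v = 1"
      using linear_independent_extend[of "{v}" "\<lambda>_. 1 :: real"] by auto
    obtain h where h: "real_algebra_hom h" "h (sym_embed v) = g v"
      using symalg_universal[OF g(1)] by blast
    then have "h 0 = 1" using 0 g(2) by simp
    then show False using h(1) by (simp add: real_algebra_hom_def linear_0)
  qed
qed

text \<open>
  \<open>sym_part k f\<close> is the homogeneous component \<open>f\<^sub>k\<close> of \<open>f\<close>; the next lemmas show that \<open>S(V)\<close> is
  the direct sum of the \<open>sym_homogeneous k\<close> and that these are the components of that decomposition.
\<close>

lift_definition sym_part :: "nat \<Rightarrow> 'v::real_vector symalg \<Rightarrow> 'v symalg" is vpoly_part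
  unfolding sym_rel_def by (metis vpoly_part_diff vpoly_part_sym_ideal)

lemma linear_sym_part: "linear (sym_part k :: 'v::real_vector symalg \<Rightarrow> _)"
proof
  fix f g :: "'v symalg" and c :: real
  show "sym_part k (f + g) = sym_part k f + sym_part k g"
    by transfer (simp add: vpoly_part_add sym_rel_refl)
  have "vpoly_part k (Poly_Mapping.single 0 c * p) = Poly_Mapping.single 0 c * vpoly_part k p"
    for p :: "'v vpoly"
    by (induction p rule: vpoly_induct)
      (auto simp: distrib_left vpoly_part_add mult_single vpoly_part_single)
  then show "sym_part k (c *\<^sub>R f) = c *\<^sub>R sym_part k f"
    by (induction f rule: symalg.abs_induct) (simp only: sym_part.abs_eq scaleR_symalg.abs_eq)
qed

lemma sym_part_monom:
  "sym_part k (c *\<^sub>R (\<Prod>v\<in>#m. sym_embed v)) = (if size m = k then c *\<^sub>R (\<Prod>v\<in>#m. sym_embed v) else 0)"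
proof -
  have "sym_part k (sym_monom m c) = (if size m = k then sym_monom m c else 0)"
    by (auto simp: sym_monom.abs_eq sym_part.abs_eq vpoly_part_single zero_symalg_def)
  then show ?thesis by (simp add: sym_monom_eq)
qed

lemma sym_monom_homogeneous: "c *\<^sub>R (\<Prod>v\<in>#m. sym_embed v) \<in> sym_homogeneous (size m)"
proof -
  obtain xs where xs: "m = mset xs" by (metis ex_mset)
  have "(\<Prod>v\<in>#m. sym_embed v) = (\<Prod>j<size m. sym_embed (xs ! j))"
    unfolding xs by (induction xs) (simp_all add: prod.lessThan_Suc_shift del: prod.lessThan_Suc)
  then have "(\<Prod>v\<in>#m. sym_embed v) \<in> {\<Prod>j<size m. sym_embed (v j) | v. True}" by blast
  then show ?thesis
    unfolding sym_homogeneous_def by (intro span_scale span_base)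
qed

lemma sym_part_in_homogeneous: "sym_part k f \<in> sym_homogeneous k"
proof (induction f rule: symalg_induct)
  case zero
  then show ?case by (simp add: linear_0[OF linear_sym_part] sym_homogeneous_def span_zero)
next
  case (add m c f)
  have "sym_part k (c *\<^sub>R (\<Prod>v\<in>#m. sym_embed v)) \<in> sym_homogeneous k"
    using sym_monom_homogeneous[of c m] by (auto simp: sym_part_monom sym_homogeneous_def span_zero)
  then show ?case
    using add by (simp add: linear_add[OF linear_sym_part] sym_homogeneous_def span_add)
qed

lemma sym_part_homogeneous:
  assumes "f \<in> sym_homogeneous k"
  shows "sym_part j f = (if j = k then f else 0)"
  using assms unfolding sym_homogeneous_def
proof (induction rule: span_induct_alt)
  case base
  then show ?case by (simp add: linear_0[OF linear_sym_part])
next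
  case (step c x y)
  then obtain v where "x = (\<Prod>j<k. sym_embed (v j))" by blast
  moreover have "(\<Prod>j<k. sym_embed (v j)) = (\<Prod>v\<in>#image_mset v (mset_set {..<k}). sym_embed v)"
    by (simp add: prod_unfold_prod_mset image_mset.compositionality comp_def)
  ultimately have "sym_part j (c *\<^sub>R x) = (if j = k then c *\<^sub>R x else 0)"
    by (simp only: sym_part_monom size_image_mset size_mset_set card_lessThan eq_commute[of k])
  then show ?case using step by (simp add: linear_add[OF linear_sym_part])
qed

lemma finite_sym_part: "finite {k. sym_part k f \<noteq> 0}"
proof (induction f rule: symalg_induct)
  case zero
  then show ?case by (simp add: linear_0[OF linear_sym_part])
next
  case (add m c f)
  show ?case
    by (rule finite_subset[of _ "insert (size m) {k. sym_part k f \<noteq> 0}"])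
      (use add in \<open>auto simp: linear_add[OF linear_sym_part] sym_part_monom split: if_splits\<close>)
qed

lemma sum_sym_part: "(\<Sum>k | sym_part k f \<noteq> 0. sym_part k f) = f"
proof -
  have *: "(\<Sum>k\<in>A. sym_part k f) = (\<Sum>k | sym_part k f \<noteq> 0. sym_part k f)"
    if "finite A" "{k. sym_part k f \<noteq> 0} \<subseteq> A" for A and f :: "'a symalg"
    by (rule sum.mono_neutral_right) (use that in auto)
  show ?thesis
  proof (induction f rule: symalg_induct)
    case zero
    then show ?case by (simp add: linear_0[OF linear_sym_part])
  next
    case (add m c f)
    let ?x = "c *\<^sub>R (\<Prod>v\<in>#m. sym_embed v)"
    let ?A = "insert (size m) ({k. sym_part k f \<noteq> 0} \<union> {k. sym_part k (?x + f) \<noteq> 0})"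
    have fin: "finite ?A" using finite_sym_part by blast
    have "(\<Sum>k | sym_part k (?x + f) \<noteq> 0. sym_part k (?x + f)) = (\<Sum>k\<in>?A. sym_part k (?x + f))"
      by (rule *[symmetric, OF fin]) auto
    also have "\<dots> = (\<Sum>k\<in>?A. sym_part k ?x) + (\<Sum>k\<in>?A. sym_part k f)"
      by (simp only: linear_add[OF linear_sym_part] sum.distrib)
    also have "(\<Sum>k\<in>?A. sym_part k f) = f"
      by (subst *[OF fin]) (use add in auto)
    also have "(\<Sum>k\<in>?A. sym_part k ?x) = ?x"
      unfolding sym_part_monom using fin by (subst sum.delta'[OF fin]) simp
    finally show ?case .
  qed
qed


section \<open>Seminorms and the projective extension\<close>

definition seminorm :: "('a::real_vector \<Rightarrow> real) \<Rightarrow> bool"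
  where "seminorm p \<longleftrightarrow>
    (\<forall>x. 0 \<le> p x) \<and> (\<forall>x y. p (x + y) \<le> p x + p y) \<and> (\<forall>c x. p (c *\<^sub>R x) = \<bar>c\<bar> * p x)"

text \<open>The topology induced by a seminorm, generated by the open balls.\<close>

definition seminorm_topology :: "('a::real_vector \<Rightarrow> real) \<Rightarrow> 'a topology"
  where "seminorm_topology p = topology_generated_by {{y. p (y - x) < r} | x r. True}"

text \<open>
  The value is meaningful only for \<open>f\<close> in \<open>sym_homogeneous k\<close>. In degree 0, \<open>of_real\<close> is the
  identification of the reals with the constants of \<open>S(V)\<close>.
\<close>

definition proj_ext_part :: "('v::real_vector \<Rightarrow> real) \<Rightarrow> nat \<Rightarrow> 'v symalg \<Rightarrow> real"
  where "proj_ext_part \<rho> k f =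
    (if k = 0 then \<bar>THE r. f = of_real r\<bar>
     else Inf {(\<Sum>i<n. \<Prod>j<k. \<rho> (F i j)) | (n::nat) F.
       1 \<le> n \<and> f = (\<Sum>i<n. \<Prod>j<k. sym_embed (F i j))})"

definition proj_ext :: "('v::real_vector \<Rightarrow> real) \<Rightarrow> 'v symalg \<Rightarrow> real"
  where "proj_ext \<rho> f = (\<Sum>k | sym_part k f \<noteq> 0. proj_ext_part \<rho> k (sym_part k f))"


section \<open>Power modules\<close>

definition sums_of_powers :: "nat \<Rightarrow> 'a::comm_ring_1 set"
  where "sums_of_powers n = {(\<Sum>i<k. a i ^ n) | (k::nat) a. True}"

definition power_module :: "nat \<Rightarrow> 'a::comm_ring_1 set \<Rightarrow> bool"
  where "power_module n M \<longleftrightarrow>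
    1 \<in> M \<and> (\<forall>x\<in>M. \<forall>y\<in>M. x + y \<in> M) \<and> (\<forall>a. \<forall>x\<in>M. a ^ n * x \<in> M)"


section \<open>The algebraic dual with the weak topology\<close>

typedef (overloaded) 'v dual = "{\<phi> :: 'v::real_vector \<Rightarrow> real. linear \<phi>}"
  morphisms dual_apply Abs_dual
  using linear_zero by blast

instantiation dual :: (real_vector) topological_space
begin

definition open_dual :: "'a dual set \<Rightarrow> bool"
  where "open_dual = generate_topology {{\<phi>. dual_apply \<phi> v \<in> T} | v T. open T}"

instance
  by standard (auto simp: open_dual_def intro: generate_topology.intros)

end

definition dual_ext :: "'v::real_vector dual \<Rightarrow> 'v symalg \<Rightarrow> real"
  where "dual_ext \<phi> =
    (THE h. real_algebra_hom h \<and> (\<forall>v. h (sym_embed v) = dual_apply \<phi> v))"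

definition sym_hat :: "'v::real_vector symalg \<Rightarrow> 'v dual \<Rightarrow> real"
  where "sym_hat f \<phi> = dual_ext \<phi> f"

definition dual_seminorm :: "('v::real_vector \<Rightarrow> real) \<Rightarrow> 'v dual \<Rightarrow> ennreal"
  where "dual_seminorm \<rho> \<phi> =
    Inf {ennreal C | C. 0 \<le> C \<and> (\<forall>w. \<bar>dual_apply \<phi> w\<bar> \<le> C * \<rho> w)}"

definition dual_unit_ball :: "('v::real_vector \<Rightarrow> real) \<Rightarrow> 'v dual set"
  where "dual_unit_ball \<rho> = {\<phi>. dual_seminorm \<rho> \<phi> \<le> 1}"

definition nonneg_set :: "'v::real_vector symalg set \<Rightarrow> 'v dual set"
  where "nonneg_set M = {\<phi>. \<forall>g\<in>M. 0 \<le> sym_hat g \<phi>}"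


section \<open>Radon measures and the correspondence\<close>

definition radon_measure :: "'a::topological_space measure \<Rightarrow> bool"
  where "radon_measure \<mu> \<longleftrightarrow>
    sets \<mu> = sets borel \<and>
    (\<forall>x. \<exists>U. open U \<and> x \<in> U \<and> emeasure \<mu> U < \<infinity>) \<and>
    (\<forall>B\<in>sets borel. emeasure \<mu> B = (SUP K\<in>{K. compact K \<and> K \<subseteq> B}. emeasure \<mu> K))"

text \<open>Membership in \<open>null_sets\<close> includes measurability, so \<open>Y\<close> has to be a measurable set.\<close>

definition supported_by :: "'a measure \<Rightarrow> 'a set \<Rightarrow> bool"
  where "supported_by \<mu> Y \<longleftrightarrow> space \<mu> - Y \<in> null_sets \<mu>"

definition nonneg_functionals :: "('v::real_vector \<Rightarrow> real) \<Rightarrow> nat \<Rightarrow> ('v symalg \<Rightarrow> real) set"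
  where "nonneg_functionals \<rho> d =
    {L. linear L \<and> continuous_map (seminorm_topology (proj_ext \<rho>)) euclidean L \<and>
        (\<forall>f\<in>sums_of_powers (2 * d). 0 \<le> L f)}"

definition ball_measures :: "('v::real_vector \<Rightarrow> real) \<Rightarrow> 'v dual measure set"
  where "ball_measures \<rho> = {\<mu>. radon_measure \<mu> \<and> supported_by \<mu> (dual_unit_ball \<rho>)}"

definition represents :: "'v::real_vector dual measure \<Rightarrow> ('v symalg \<Rightarrow> real) \<Rightarrow> bool"
  where "represents \<mu> L \<longleftrightarrow>
    (\<forall>f. integrable \<mu> (sym_hat f) \<and> L f = (\<integral>\<phi>. sym_hat f \<phi> \<partial>\<mu>))"

end

theory Submission
  imports Defs
begin

text \<open>
  Let \<open>p\<close> be a submultiplicative seminorm on a commutative real algebra. If \<open>p a\<close> is small then \<open>1 + a\<close> is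
  a limit of \<open>n\<close>-th powers, so a \<open>p\<close>-continuous \<open>L\<close> that is nonnegative on \<open>n\<close>-th powers stays so after
  multiplication by \<open>1 \<plusminus> a\<close>. Hence an extreme point \<open>e\<close> of the compact set of normalized such functionals
  coincides with each \<open>x \<mapsto> e ((1 \<plusminus> a) * x) / e (1 \<plusminus> a)\<close>, that is, \<open>e\<close> is multiplicative. Since extreme points
  minimize evaluation at a given \<open>f\<close>, the functional \<open>L\<close> is nonnegative at every \<open>f\<close> on which all
  \<open>p\<close>-bounded characters are nonnegative.

  For \<open>S(V)\<close> these characters form the compact dual unit ball, where the functions \<open>sym_hat f\<close> are dense
  by Stone and Weierstrass; so \<open>L\<close> extends to a positive functional on the continuous functions, and
  the Riesz construction yields \<open>\<mu>\<close>. Density also gives uniqueness.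
\<close>

section \<open>Functionals that are nonnegative on powers\<close>

text \<open>Positivity on \<open>n\<close>-th powers gives no Cauchy-Schwarz inequality at the
  outset, so the fact about \<open>1 + a\<close> must supply the bounds too: applied to small
  multiples of \<open>x\<close> and \<open>- x\<close>, it bounds \<open>L x\<close> by a constant
  times \<open>L 1 * p x\<close>, with one constant for all \<open>L\<close>. This uniformity makes
  the normalized functionals compact. The constant survives in the bound on an extreme point, but
  comparing k-th powers of a multiplicative functional removes it.

  The dual of \<open>V\<close> need not be locally compact, and the measures live on all of it,
  while density is available on the unit ball only. Hence the measure theory concerns a compact set
  \<open>K\<close> inside a Hausdorff space: functions are continuous on \<open>K\<close>,
  integrands carry the indicator of \<open>K\<close>, and uniqueness uses inner regularity in place
  of outer regularity.\<close>

locale submult_seminorm =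
  fixes p :: "'a::{comm_ring_1,real_algebra_1} \<Rightarrow> real"
  assumes seminorm: "seminorm p"
    and mult_le: "p (x * y) \<le> p x * p y"
    and one_le: "p 1 \<le> 1"
begin

lemma nonneg [simp]: "0 \<le> p x"
  and triangle: "p (x + y) \<le> p x + p y"
  and scale: "p (c *\<^sub>R x) = \<bar>c\<bar> * p x"
  using seminorm by (auto simp: seminorm_def)

lemma zero [simp]: "p 0 = 0"
  using scale[of 0 0] by simp

lemma minus [simp]: "p (- x) = p x"
  using scale[of "-1" x] by simp

lemma diff_commute: "p (x - y) = p (y - x)"
  using minus[of "x - y"] by simp

lemma power_le: "p (x ^ n) \<le> p x ^ n"
proof (induction n)
  case 0
  then show ?case using one_le by simp
next
  case (Suc n)
  have "p (x ^ Suc n) \<le> p x * p (x ^ n)" using mult_le[of x "x ^ n"] by simp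
  also have "\<dots> \<le> p x * p x ^ n" using Suc by (intro mult_left_mono) auto
  finally show ?case by simp
qed

section \<open>Approximate roots of \<open>1 + a\<close>\<close>

definition binom_rem :: "nat \<Rightarrow> 'a \<Rightarrow> 'a"
  where "binom_rem n y = (1 + y) ^ n - 1 - of_nat n * y"

lemma binom_rem_zero [simp]: "binom_rem n 0 = 0"
  by (simp add: binom_rem_def)

lemma binom_rem_Suc: "binom_rem (Suc n) y = binom_rem n y * (1 + y) + of_nat n * (y * y)"
  by (simp add: binom_rem_def algebra_simps)

text \<open>Only terms of order at least two in \<open>y\<close> occur in
  \<open>binom_rem n y\<close>, so its Lipschitz constant on a ball about 0 tends to 0 with the
  radius. In the induction the three terms of \<open>eq\<close> receive the shares
  \<open>e / 2\<close>, \<open>e / 4\<close> and \<open>e / 4\<close>.\<close>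

lemma binom_rem_lipschitz:
  assumes "0 < e"
  shows "\<exists>\<delta>>0. \<forall>y z. p y \<le> \<delta> \<longrightarrow> p z \<le> \<delta> \<longrightarrow> p (binom_rem n y - binom_rem n z) \<le> e * p (y - z)"
  using assms
proof (induction n arbitrary: e)
  case 0
  then show ?case by (intro exI[of _ 1]) (auto simp: binom_rem_def)
next
  case (Suc n)
  obtain \<delta> where \<delta>: "\<delta> > 0"
    "\<And>y z. p y \<le> \<delta> \<Longrightarrow> p z \<le> \<delta> \<Longrightarrow> p (binom_rem n y - binom_rem n z) \<le> e / 4 * p (y - z)"
    using Suc.IH[of "e / 4"] Suc.prems by auto
  \<comment> \<open>Radius at most 1 gives \<open>p (1 + y) \<le> 2\<close> and
    \<open>p z \<le> 1\<close>; the factor \<open>8 * (real n + 1)\<close> gives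
    \<open>real n * (2 * \<eta>) \<le> e / 4\<close>.\<close>
  define \<eta> where "\<eta> = min \<delta> (min 1 (e / (8 * (real n + 1))))"
  have \<eta>: "0 < \<eta>" "\<eta> \<le> \<delta>" "\<eta> \<le> 1" "\<eta> * (8 * (real n + 1)) \<le> e"
    using \<delta>(1) Suc.prems by (auto simp: \<eta>_def min_le_iff_disj simp flip: pos_le_divide_eq)
  have "p (binom_rem (Suc n) y - binom_rem (Suc n) z) \<le> e * p (y - z)"
    if y: "p y \<le> \<eta>" and z: "p z \<le> \<eta>" for y z
  proof -
    have eq: "binom_rem (Suc n) y - binom_rem (Suc n) z =
       (binom_rem n y - binom_rem n z) * (1 + y) + (binom_rem n z * (y - z) + real n *\<^sub>R ((y + z) * (y - z)))"
      by (simp add: binom_rem_Suc scaleR_conv_of_real algebra_simps)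
    have lip: "p (binom_rem n y - binom_rem n z) \<le> e / 4 * p (y - z)"
      using \<delta>(2)[of y z] y z \<eta> by auto
    have "p ((binom_rem n y - binom_rem n z) * (1 + y)) \<le> (e / 4 * p (y - z)) * 2"
      by (rule order.trans[OF mult_le], rule mult_mono[OF lip])
        (use triangle[of 1 y] one_le y \<eta> Suc.prems in auto)
    moreover have "p (binom_rem n z) \<le> e / 4 * 1"
    proof -
      have "p (binom_rem n z) \<le> e / 4 * p z"
        using \<delta>(2)[of z 0] z \<delta>(1) \<eta> by auto
      also have "\<dots> \<le> e / 4 * 1" by (rule mult_left_mono) (use z \<eta> Suc.prems in auto)
      finally show ?thesis .
    qed
    then have "p (binom_rem n z * (y - z)) \<le> (e / 4) * p (y - z)"
      using mult_le[of "binom_rem n z" "y - z"] mult_right_mono[OF _ nonneg, of _ "e / 4" "y - z"]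
      by (smt (verit, best))
    moreover have "p (real n *\<^sub>R ((y + z) * (y - z))) \<le> e / 4 * p (y - z)"
    proof -
      have "p (real n *\<^sub>R ((y + z) * (y - z))) \<le> real n * (p (y + z) * p (y - z))"
        using mult_le[of "y + z" "y - z"] by (simp add: scale mult_left_mono)
      also have "\<dots> = (real n * p (y + z)) * p (y - z)" by simp
      also have "\<dots> \<le> (real n * (2 * \<eta>)) * p (y - z)"
        by (intro mult_right_mono mult_left_mono) (use triangle[of y z] y z in auto)
      also have "\<dots> \<le> e / 4 * p (y - z)"
        by (rule mult_right_mono) (use \<eta> in \<open>auto simp: algebra_simps\<close>)
      finally show ?thesis .
    qed
    ultimately show ?thesis
      unfolding eq
      using triangle[of "(binom_rem n y - binom_rem n z) * (1 + y)"
          "binom_rem n z * (y - z) + real n *\<^sub>R ((y + z) * (y - z))"]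
        triangle[of "binom_rem n z * (y - z)" "real n *\<^sub>R ((y + z) * (y - z))"]
      by argo
  qed
  then show ?case using \<eta>(1) by blast
qed

text \<open>
  An approximate \<open>n\<close>-th root \<open>1 + b\<close> of \<open>1 + a\<close> solves \<open>n b + binom_rem n b = a\<close>, so \<open>b\<close> is found by
  iterating the contraction \<open>b \<mapsto> (a - binom_rem n b) / n\<close>; no completeness is needed.
\<close>

lemma approx_root:
  assumes n: "1 \<le> n"
  shows "\<exists>\<delta>>0. \<forall>a. p a \<le> \<delta> \<longrightarrow> (\<forall>e>0. \<exists>b. p ((1 + b) ^ n - (1 + a)) < e)"
proof -
  \<comment> \<open>The Lipschitz constant \<open>real n / 2\<close> makes the map \<open>T\<close>
    below a contraction with factor 1/2.\<close>
  obtain \<delta> where \<delta>: "\<delta> > 0" "\<And>y z. p y \<le> \<delta> \<Longrightarrow> p z \<le> \<delta> \<Longrightarrow>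
      p (binom_rem n y - binom_rem n z) \<le> real n / 2 * p (y - z)"
    using binom_rem_lipschitz[of "real n / 2" n] n by auto
  have "\<exists>b. p ((1 + b) ^ n - (1 + a)) < e" if a: "p a \<le> \<delta> / 2" and e: "e > 0" for a e
  proof -
    define T where "T y = (1 / real n) *\<^sub>R (a - binom_rem n y)" for y
    define y where "y k = (T ^^ k) 0" for k
    have y_Suc: "y (Suc k) = T (y k)" for k by (simp add: y_def)
    have T: "p (T u - T v) \<le> p (u - v) / 2" if "p u \<le> \<delta>" "p v \<le> \<delta>" for u v
    proof -
      have "T u - T v = (1 / real n) *\<^sub>R (binom_rem n v - binom_rem n u)"
        by (simp add: T_def flip: scaleR_diff_right)
      then have "p (T u - T v) = (1 / real n) * p (binom_rem n v - binom_rem n u)"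
        by (simp only: scale) simp
      also have "\<dots> \<le> (1 / real n) * (real n / 2 * p (v - u))"
        by (rule mult_left_mono[OF \<delta>(2)[OF that(2,1)]]) simp
      finally show ?thesis using n by (simp add: diff_commute[of u])
    qed
    have T0: "p (T 0) \<le> \<delta> / 2"
    proof -
      have "p (T 0) = p a / real n" by (simp add: T_def scale)
      also have "\<dots> \<le> p a" using n mult_right_mono[of 1 "real n" "p a"] by (simp add: field_simps)
      finally show ?thesis using a by linarith
    qed
    \<comment> \<open>\<open>T (y k)\<close> is within \<delta>/2 of \<open>T 0\<close>, and
      \<open>p (T 0)\<close> is at most \<delta>/2, so the iterates stay in the ball where
      \<open>T\<close> contracts.\<close>
    have y_le: "p (y k) \<le> \<delta>" for k
    proof (induction k)
      case 0
      then show ?case using \<delta>(1) by (simp add: y_def)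
    next
      case (Suc k)
      then show ?case
        using T[of "y k" 0] T0 \<delta>(1) triangle[of "T (y k) - T 0" "T 0"] by (simp add: y_Suc)
    qed
    have step: "p (y k - y (Suc k)) \<le> (1 / 2) ^ k * \<delta>" for k
    proof (induction k)
      case 0
      then show ?case using y_le[of 1] by (simp add: y_def)
    next
      case (Suc k)
      then show ?case using T[OF y_le y_le, of k "Suc k"] by (simp add: y_Suc)
    qed
    have "n *\<^sub>R y (Suc k) = a - binom_rem n (y k)" for k
      using n by (simp add: y_Suc T_def)
    \<comment> \<open>The defect of the k-th iterate as a root is \<open>n\<close> times the next
      step, so short steps suffice and no limit of the iterates is taken.\<close>
    then have "(1 + y k) ^ n - (1 + a) = real n *\<^sub>R (y k - y (Suc k))" for k
      by (simp add: scaleR_diff_right scaleR_conv_of_real binom_rem_def algebra_simps)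
    then have bound: "p ((1 + y k) ^ n - (1 + a)) \<le> (1 / 2) ^ k * (real n * \<delta>)" for k
      using mult_left_mono[OF step[of k], of "real n"] by (simp add: scale mult_ac)
    have "(\<lambda>k. (1 / 2) ^ k * (real n * \<delta>)) \<longlonglongrightarrow> 0 * (real n * \<delta>)"
      by (intro tendsto_intros) auto
    then have "eventually (\<lambda>k. (1 / 2) ^ k * (real n * \<delta>) < e) sequentially"
      using e by (intro order_tendstoD) auto
    then obtain k where "(1 / 2) ^ k * (real n * \<delta>) < e"
      using eventually_happens trivial_limit_sequentially by blast
    then show ?thesis using bound[of k] by (intro exI[of _ "y k"]) auto
  qed
  then show ?thesis using \<delta>(1) by (intro exI[of _ "\<delta> / 2"]) auto
qed

section \<open>Uniform bounds for functionals\<close>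

definition positive_on_powers :: "nat \<Rightarrow> ('a \<Rightarrow> real) \<Rightarrow> bool"
  where "positive_on_powers n L \<longleftrightarrow> linear L \<and> (\<exists>C. \<forall>x. \<bar>L x\<bar> \<le> C * p x) \<and> (\<forall>x. 0 \<le> L (x ^ n))"

text \<open>\<open>(1 + a) * x ^ n\<close> is a limit of the powers
  \<open>((1 + b) * x) ^ n\<close>. The radius \<delta> is that of \<open>approx_root\<close> and so
  is the same for all \<open>L\<close>.\<close>

lemma positive_on_powers_mult:
  assumes "1 \<le> n"
  shows "\<exists>\<delta>>0. \<forall>L a x. positive_on_powers n L \<longrightarrow> p a \<le> \<delta> \<longrightarrow> 0 \<le> L ((1 + a) * x ^ n)"
proof -
  obtain \<delta> where \<delta>: "\<delta> > 0" "\<And>a e. p a \<le> \<delta> \<Longrightarrow> e > 0 \<Longrightarrow> \<exists>b. p ((1 + b) ^ n - (1 + a)) < e"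
    using approx_root[OF assms] by blast
  have "0 \<le> L ((1 + a) * x ^ n)" if L: "positive_on_powers n L" and a: "p a \<le> \<delta>" for L a x
  proof (rule ccontr)
    assume "\<not> 0 \<le> L ((1 + a) * x ^ n)"
    then have neg: "0 < - L ((1 + a) * x ^ n)" by simp
    obtain C where C: "\<And>x. \<bar>L x\<bar> \<le> C * p x" using L by (auto simp: positive_on_powers_def)
    \<comment> \<open>\<open>C\<close> may be negative when \<open>p\<close> vanishes identically,
      hence the absolute value; adding 1 keeps the divisor positive.\<close>
    define D where "D = \<bar>C\<bar> * p (x ^ n) + 1"
    have D: "D > 0" by (simp add: D_def add_nonneg_pos)
    obtain b where b: "p ((1 + b) ^ n - (1 + a)) < - L ((1 + a) * x ^ n) / D"
      using \<delta>(2)[OF a divide_pos_pos[OF neg D]] by blast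
    define r where "r = (1 + b) ^ n - (1 + a)"
    have "((1 + b) * x) ^ n = (1 + a) * x ^ n + r * x ^ n"
      unfolding r_def power_mult_distrib by (simp add: algebra_simps)
    then have "L (((1 + b) * x) ^ n) = L ((1 + a) * x ^ n) + L (r * x ^ n)"
      using L by (simp add: positive_on_powers_def linear_add)
    moreover have "0 \<le> L (((1 + b) * x) ^ n)" using L by (auto simp: positive_on_powers_def)
    moreover have "L (r * x ^ n) \<le> p r * D"
    proof -
      have "L (r * x ^ n) \<le> \<bar>C\<bar> * p (r * x ^ n)"
        using C[of "r * x ^ n"] mult_right_mono[OF abs_ge_self nonneg, of C "r * x ^ n"] by argo
      also have "\<dots> \<le> \<bar>C\<bar> * (p r * p (x ^ n))" by (intro mult_left_mono mult_le) auto
      also have "\<dots> \<le> p r * D" by (simp add: D_def algebra_simps)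
      finally show ?thesis .
    qed
    moreover have "p r * D < - L ((1 + a) * x ^ n)"
      using b pos_less_divide_eq[OF D] unfolding r_def by blast
    ultimately show False by linarith
  qed
  then show ?thesis using \<delta>(1) by blast
qed

text \<open>Taking 1 for the power and for \<open>a\<close> the multiples of \<open>x\<close> and
  \<open>- x\<close> of size \<delta>, the preceding lemma gives
  \<open>\<delta> / p x * \<bar>L x\<bar> \<le> L 1\<close>. Where \<open>p x = 0\<close>,
  continuity alone forces \<open>L x = 0\<close>.\<close>

lemma positive_on_powers_bound:
  assumes "1 \<le> n"
  shows "\<exists>D>0. \<forall>L x. positive_on_powers n L \<longrightarrow> \<bar>L x\<bar> \<le> D * L 1 * p x"
proof -
  obtain \<delta> where \<delta>: "\<delta> > 0"
    "\<And>L a x. positive_on_powers n L \<Longrightarrow> p a \<le> \<delta> \<Longrightarrow> 0 \<le> L ((1 + a) * x ^ n)"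
    using positive_on_powers_mult[OF assms] by blast
  have "\<bar>L x\<bar> \<le> (1 / \<delta>) * L 1 * p x" if L: "positive_on_powers n L" for L x
  proof (cases "p x = 0")
    case True
    then show ?thesis using L by (auto simp: positive_on_powers_def dest: spec[of _ x])
  next
    case False
    then have px: "p x > 0" using nonneg[of x] by linarith
    have "0 \<le> L ((1 + c *\<^sub>R x) * 1 ^ n)" if "\<bar>c\<bar> = \<delta> / p x" for c
      by (rule \<delta>(2)[OF L]) (use that px in \<open>simp add: scale\<close>)
    then have *: "0 \<le> L 1 + c * L x" if "\<bar>c\<bar> = \<delta> / p x" for c
      using that L by (simp add: positive_on_powers_def linear_add linear_cmul)
    show ?thesis
      using *[of "\<delta> / p x"] *[of "- (\<delta> / p x)"] px \<delta>(1) by (auto simp: field_simps abs_if)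
  qed
  then show ?thesis using \<delta>(1) by (intro exI[of _ "1 / \<delta>"]) auto
qed

end

section \<open>Compact sets of functions and extreme points\<close>

lemma compact_bounded_functions:
  fixes S :: "('a \<Rightarrow> real) set"
  assumes "closed S" "\<And>l x. l \<in> S \<Longrightarrow> \<bar>l x\<bar> \<le> b x"
  shows "compact S"
proof -
  have "compactin (product_topology (\<lambda>_. euclidean) UNIV) (\<Pi>\<^sub>E x\<in>UNIV. {- b x..b x})"
    by (simp add: compactin_PiE)
  then have "compact (\<Pi>\<^sub>E x\<in>UNIV. {- b x..b x})"
    by (simp add: euclidean_product_topology)
  moreover have "S \<subseteq> (\<Pi>\<^sub>E x\<in>UNIV. {- b x..b x})"
    using assms(2) by (fastforce simp: abs_le_iff minus_le_iff)
  ultimately show ?thesis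
    using compact_Int_closed[OF _ assms(1)] by (metis Int_absorb1)
qed

lemma subset_chain_subset: "subset.chain A C \<Longrightarrow> D \<subseteq> C \<Longrightarrow> subset.chain A D"
  unfolding subset_chain_def by (meson order_trans subsetD)

text \<open>The Krein-Milman argument with faces. Within the face where evaluation at
  \<open>f\<close> is least there is a minimal closed face. Every evaluation attains its least value
  on a subface of it, hence is constant on it, so it is a single point, which is extreme.\<close>

lemma exists_extreme_minimizer:
  fixes S :: "('a \<Rightarrow> real) set"
  assumes "compact S" "closed S" "S \<noteq> {}"
  shows "\<exists>e\<in>S. (\<forall>l\<in>S. e f \<le> l f) \<and>
    (\<forall>l1\<in>S. \<forall>l2\<in>S. \<forall>t. 0 < t \<longrightarrow> t < 1 \<longrightarrow> e = (\<lambda>x. t * l1 x + (1 - t) * l2 x) \<longrightarrow> l1 = e)"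
proof -
  define face where "face F \<longleftrightarrow> closed F \<and> F \<subseteq> S \<and> F \<noteq> {} \<and>
    (\<forall>l1\<in>S. \<forall>l2\<in>S. \<forall>t. 0 < t \<longrightarrow> t < 1 \<longrightarrow> (\<lambda>x. t * l1 x + (1 - t) * l2 x) \<in> F \<longrightarrow> l1 \<in> F \<and> l2 \<in> F)" for F
  have faceD: "closed F" "F \<subseteq> S" "F \<noteq> {}" if "face F" for F
    using that unfolding face_def by iprover+
  have face_ext: "l1 \<in> F \<and> l2 \<in> F"
    if "face F" "l1 \<in> S" "l2 \<in> S" "0 < t" "t < 1" "(\<lambda>x. t * l1 x + (1 - t) * l2 x) \<in> F" for F l1 l2 t
    using that unfolding face_def by blast
  have faceI: "face F" if "closed F" "F \<subseteq> S" "F \<noteq> {}"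
    "\<And>l1 l2 t. l1 \<in> S \<Longrightarrow> l2 \<in> S \<Longrightarrow> 0 < t \<Longrightarrow> t < 1 \<Longrightarrow>
      (\<lambda>x. t * l1 x + (1 - t) * l2 x) \<in> F \<Longrightarrow> l1 \<in> F \<and> l2 \<in> F" for F
  proof -
    have "\<forall>l1\<in>S. \<forall>l2\<in>S. \<forall>t. 0 < t \<longrightarrow> t < 1 \<longrightarrow> (\<lambda>x. t * l1 x + (1 - t) * l2 x) \<in> F \<longrightarrow> l1 \<in> F \<and> l2 \<in> F"
      by (intro ballI allI impI) (rule that(4))
    with that(1-3) show ?thesis unfolding face_def by (intro conjI)
  qed
  define argmin where "argmin F x = {l \<in> F. \<forall>k\<in>F. l x \<le> k x}" for F :: "('a \<Rightarrow> real) set" and x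
  have face_argmin: "face (argmin F x)" if F: "face F" for F x
  proof -
    have "compact F" using F assms(1) compact_Int_closed[of S F] by (auto simp: face_def Int_absorb1)
    then obtain m where m: "m \<in> F" "\<And>k. k \<in> F \<Longrightarrow> m x \<le> k x"
      using continuous_attains_inf[of F "\<lambda>l. l x"] F
      by (auto simp: face_def continuous_on_subset[OF continuous_on_product_coordinates])
    then have eq: "argmin F x = F \<inter> {l. l x \<le> m x}" by (fastforce simp: argmin_def)
    have "closed {l :: 'a \<Rightarrow> real. l x \<le> m x}"
      by (intro closed_Collect_le continuous_on_product_coordinates continuous_on_const)
    then have "closed (argmin F x)" using F by (auto simp: eq face_def)
    moreover have "l1 \<in> argmin F x \<and> l2 \<in> argmin F x"
      if l: "l1 \<in> S" "l2 \<in> S" "0 < t" "t < 1" "(\<lambda>x. t * l1 x + (1 - t) * l2 x) \<in> argmin F x" for l1 l2 t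
    proof -
      have "(\<lambda>x. t * l1 x + (1 - t) * l2 x) \<in> F" using l(5) by (simp add: argmin_def)
      then have F12: "l1 \<in> F" "l2 \<in> F" using face_ext[OF F l(1-4)] by blast+
      have "t * (l1 x - m x) + (1 - t) * (l2 x - m x) \<le> 0"
        using l(5) by (simp add: eq algebra_simps)
      moreover have "0 \<le> t * (l1 x - m x)" "0 \<le> (1 - t) * (l2 x - m x)" using l m F12 by auto
      ultimately have "t * (l1 x - m x) \<le> 0" "(1 - t) * (l2 x - m x) \<le> 0" by linarith+
      then show ?thesis using l F12 by (auto simp: eq mult_le_0_iff)
    qed
    moreover have "argmin F x \<subseteq> S" "m \<in> argmin F x" using F m by (auto simp: face_def argmin_def)
    ultimately show ?thesis using F m
      by (intro faceI) auto
  qed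
  have "face S" using assms by (auto simp: face_def)
  \<comment> \<open>Zorn's lemma is used in the form that yields maximal sets, so it is applied to
    complements of faces.\<close>
  let ?A = "uminus ` {F. face F \<and> F \<subseteq> argmin S f}"
  have "\<exists>M\<in>?A. \<forall>X\<in>?A. M \<subseteq> X \<longrightarrow> X = M"
  proof (rule subset_Zorn_nonempty)
    show "?A \<noteq> {}" using face_argmin[OF \<open>face S\<close>] by auto
  next
    fix \<C> assume \<C>: "\<C> \<noteq> {}" "subset.chain ?A \<C>"
    have mem: "face (- X)" "- X \<subseteq> argmin S f" if "X \<in> \<C>" for X
      using \<C>(2) that by (auto simp: subset.chain_def)
    have "face (\<Inter>X\<in>\<C>. - X)"
    proof -
      \<comment> \<open>A finite part of the chain has a largest complement, so the intersection of
        its faces is one of them and nonempty; compactness passes this to the whole chain.\<close>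
      have "S \<inter> \<Inter>(uminus ` \<C>) \<noteq> {}"
      proof (rule compact_imp_fip[OF assms(1)])
        show "closed T" if "T \<in> uminus ` \<C>" for T using that faceD(1)[OF mem(1)] by auto
        fix \<F> assume \<F>: "finite \<F>" "\<F> \<subseteq> uminus ` \<C>"
        show "S \<inter> \<Inter>\<F> \<noteq> {}"
        proof (cases "\<F> = {}")
          case False
          obtain \<D> where \<D>: "\<D> \<subseteq> \<C>" "\<F> = uminus ` \<D>" "finite \<D>"
            using finite_subset_image[OF \<F>] by auto
          have "subset.chain ?A \<D>"
            using subset_chain_subset[OF \<C>(2) \<D>(1)] .
          moreover have "\<D> \<noteq> {}" using \<D>(2) False by simp
          ultimately have "\<Union>\<D> \<in> \<D>"
            by (rule Union_in_chain[OF \<D>(3), rotated])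
          then have "face (- \<Union>\<D>)" using \<D>(1) by (intro mem(1)) (rule subsetD)
          moreover have "- \<Union>\<D> = \<Inter>\<F>" using \<D>(2) by auto
          ultimately have "face (\<Inter>\<F>)" by simp
          then show ?thesis using faceD(2,3) by (metis Int_absorb1)
        qed (use assms(3) in auto)
      qed
      moreover have "(\<Inter>X\<in>\<C>. - X) \<subseteq> S" using faceD(2)[OF mem(1)] \<C>(1) by blast
      ultimately have "(\<Inter>X\<in>\<C>. - X) \<noteq> {}" by auto
      moreover have "closed (\<Inter>X\<in>\<C>. - X)" using faceD(1)[OF mem(1)] by (intro closed_INT) blast
      moreover have "l1 \<in> (\<Inter>X\<in>\<C>. - X) \<and> l2 \<in> (\<Inter>X\<in>\<C>. - X)"
        if l: "l1 \<in> S" "l2 \<in> S" "0 < t" "t < 1"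
          "(\<lambda>x. t * l1 x + (1 - t) * l2 x) \<in> (\<Inter>X\<in>\<C>. - X)" for l1 l2 t
      proof -
        have "l1 \<in> - X \<and> l2 \<in> - X" if "X \<in> \<C>" for X
        proof -
          have "(\<lambda>x. t * l1 x + (1 - t) * l2 x) \<in> - X" using l(5) that by (rule INT_D)
          then show ?thesis using face_ext[OF mem(1)[OF that] l(1-4)] by blast
        qed
        then show ?thesis by simp
      qed
      ultimately show ?thesis
        using \<open>(\<Inter>X\<in>\<C>. - X) \<subseteq> S\<close> by (intro faceI)
    qed
    moreover have "(\<Inter>X\<in>\<C>. - X) \<subseteq> argmin S f" using mem(2) \<C>(1) by blast
    ultimately have "- (\<Inter>X\<in>\<C>. - X) \<in> ?A" by (intro imageI) simp
    moreover have "\<Union>\<C> = - (\<Inter>X\<in>\<C>. - X)" by auto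
    ultimately show "\<Union>\<C> \<in> ?A" by (simp only:)
  qed
  then obtain M where M: "M \<in> ?A" "\<forall>X\<in>?A. M \<subseteq> X \<longrightarrow> X = M"
    by (rule bexE)
  define F where "F = - M"
  have F: "face F" "F \<subseteq> argmin S f" using M(1) by (auto simp: F_def)
  have min: "G = F" if "face G" "G \<subseteq> F" for G
  proof -
    have "- G \<in> ?A" using that F(2) by (intro imageI) simp
    moreover have "M \<subseteq> - G" using that(2) by (auto simp: F_def)
    ultimately have "- G = M" using bspec[OF M(2)] by iprover
    then show ?thesis by (auto simp: F_def)
  qed
  obtain e where e: "e \<in> F" using faceD(3)[OF F(1)] by blast
  have "l = e" if "l \<in> F" for l
  proof
    fix x
    have "argmin F x = F" by (rule min[OF face_argmin[OF F(1)]]) (auto simp: argmin_def)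
    then have "l \<in> argmin F x" "e \<in> argmin F x" using that e by simp_all
    then show "l x = e x" by (auto simp: argmin_def intro: antisym)
  qed
  then have "F = {e}" using e by blast
  then have face_e: "face {e}" and "e \<in> argmin S f" using F e by simp_all
  then have eS: "e \<in> S" "\<forall>l\<in>S. e f \<le> l f" by (simp_all add: argmin_def)
  have "l1 = e" if "l1 \<in> S" "l2 \<in> S" "0 < t" "t < 1" "e = (\<lambda>x. t * l1 x + (1 - t) * l2 x)"
    for l1 l2 t
  proof -
    have "(\<lambda>x. t * l1 x + (1 - t) * l2 x) \<in> {e}" using that by simp
    then have "l1 \<in> {e}" using face_ext[OF face_e that(1-4)] by blast
    then show ?thesis by simp
  qed
  then have "\<forall>l1\<in>S. \<forall>l2\<in>S. \<forall>t. 0 < t \<longrightarrow> t < 1 \<longrightarrow> e = (\<lambda>x. t * l1 x + (1 - t) * l2 x) \<longrightarrow> l1 = e"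
    by (intro ballI allI impI)
  then show ?thesis using eS by (intro bexI[of _ e] conjI)
qed

section \<open>Extreme functionals are characters\<close>

context submult_seminorm
begin

text \<open>The normalized \<open>L\<close> lies in the compact set \<open>S\<close> and is negative
  at \<open>f\<close>, so the extreme minimizer \<open>e\<close> is negative there too.
  Multiplicativity is proved for small first factors and extended by scaling.\<close>

theorem exists_negative_character:
  assumes n: "1 \<le> n" and L: "positive_on_powers n L" and neg: "L f < 0"
  shows "\<exists>\<alpha>. real_algebra_hom \<alpha> \<and> (\<forall>x. \<bar>\<alpha> x\<bar> \<le> p x) \<and> \<alpha> f < 0"
proof -
  obtain D where D: "D > 0" and bound: "\<And>L x. positive_on_powers n L \<Longrightarrow> \<bar>L x\<bar> \<le> D * L 1 * p x"
    using positive_on_powers_bound[OF n] by blast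
  obtain \<delta> where \<delta>: "\<delta> > 0"
    "\<And>L a x. positive_on_powers n L \<Longrightarrow> p a \<le> \<delta> \<Longrightarrow> 0 \<le> L ((1 + a) * x ^ n)"
    using positive_on_powers_mult[OF n] by blast
  define S where "S = {l :: 'a \<Rightarrow> real. linear l \<and> l 1 = 1 \<and> (\<forall>x. \<bar>l x\<bar> \<le> D * p x) \<and> (\<forall>x. 0 \<le> l (x ^ n))}"
  have in_S: "(\<lambda>x. l x / l 1) \<in> S" if l: "positive_on_powers n l" "l 1 > 0" for l
    using l bound[OF l(1)] unfolding S_def
    by (auto simp: positive_on_powers_def linear_iff add_divide_distrib pos_divide_le_eq mult_ac)
  have S_pos: "positive_on_powers n l" if "l \<in> S" for l
    using that by (auto simp: S_def positive_on_powers_def)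
  have "closed S"
    unfolding S_def linear_iff
    by (intro closed_Collect_conj closed_Collect_all closed_Collect_eq closed_Collect_le
        continuous_intros continuous_on_product_coordinates)
  then have "compact S"
    by (rule compact_bounded_functions[of _ "\<lambda>x. D * p x"]) (simp add: S_def)
  have "L 1 > 0"
  proof -
    have "0 \<le> L (1 ^ n)" using L unfolding positive_on_powers_def by blast
    moreover have "L 1 \<noteq> 0" using bound[OF L, of f] neg by auto
    ultimately show ?thesis by simp
  qed
  note L_S = in_S[OF L this]
  then obtain e where e: "e \<in> S" "\<And>l. l \<in> S \<Longrightarrow> e f \<le> l f"
    and ext: "\<And>l1 l2 t. l1 \<in> S \<Longrightarrow> l2 \<in> S \<Longrightarrow> 0 < t \<Longrightarrow> t < 1 \<Longrightarrow>
      e = (\<lambda>x. t * l1 x + (1 - t) * l2 x) \<Longrightarrow> l1 = e"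
    using exists_extreme_minimizer[OF \<open>compact S\<close> \<open>closed S\<close>, of f] by blast
  \<comment> \<open>The next claim asks for \<open>p a \<le> 1 / (2 * D)\<close> because this keeps
    \<open>\<bar>e a\<bar>\<close> at most 1/2: then \<open>e (1 + a)\<close> and
    \<open>e (1 - a)\<close> are both positive and can serve as normalizations and, halved, as
    weights.\<close>
  have lin: "linear e" and e1: "e 1 = 1" and e_le: "\<And>x. \<bar>e x\<bar> \<le> D * p x"
    using e(1) by (auto simp: S_def)
  have small: "e (a * x) = e a * e x" if a: "p a \<le> \<delta>" "p a \<le> 1 / (2 * D)" for a x
  proof -
    have ea: "\<bar>e a\<bar> \<le> 1 / 2"
      using e_le[of a] mult_left_mono[OF a(2), of D] D by simp
    define l where "l b x = e ((1 + b) * x)" for b x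
    have l_S: "(\<lambda>x. l b x / l b 1) \<in> S" "l b 1 > 0" if b: "b \<in> {a, - a}" for b
    proof -
      have pb: "p b \<le> \<delta>" using a b by auto
      have "linear (l b)"
        using lin by (simp add: linear_iff l_def ring_distribs)
      moreover have "\<bar>l b x\<bar> \<le> (D * p (1 + b)) * p x" for x
        unfolding l_def mult.assoc
        by (rule order.trans[OF e_le]) (use D in \<open>auto intro: mult_left_mono mult_le\<close>)
      moreover have "0 \<le> l b (x ^ n)" for x
        unfolding l_def by (rule \<delta>(2)[OF S_pos[OF e(1)] pb])
      ultimately have "positive_on_powers n (l b)" by (auto simp: positive_on_powers_def)
      moreover show "l b 1 > 0"
        using b ea e1 lin by (auto simp: l_def linear_add linear_neg)
      ultimately show "(\<lambda>x. l b x / l b 1) \<in> S" by (rule in_S)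
    qed
    have l1: "l a 1 = 1 + e a" "l (- a) 1 = 1 - e a"
      using e1 lin by (simp_all add: l_def linear_add linear_diff)
    have nz: "1 + e a > 0" "1 - e a > 0" using ea by auto
    \<comment> \<open>\<open>e\<close> is the mean of \<open>l a\<close> and \<open>l (- a)\<close>;
      once these are normalized the weights become \<open>(1 + e a) / 2\<close> and
      \<open>(1 - e a) / 2\<close>.\<close>
    have "(\<lambda>x. l a x / l a 1) = e"
    proof (rule ext[OF l_S(1) l_S(1)[of "- a"]])
      show "0 < (1 + e a) / 2" "(1 + e a) / 2 < 1" using nz by auto
      have half: "c / 2 * (u / c) = u / 2" if "c > 0" for c u :: real using that by simp
      have "l a x + l (- a) x = 2 * e x" for x
        using lin by (simp add: l_def ring_distribs linear_add linear_diff)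
      moreover have "1 - (1 + e a) / 2 = (1 - e a) / 2" by (simp add: field_simps)
      ultimately show "e = (\<lambda>x. (1 + e a) / 2 * (l a x / l a 1) + (1 - (1 + e a) / 2) * (l (- a) x / l (- a) 1))"
        unfolding l1 by (simp only: half[OF nz(1)] half[OF nz(2)]) (simp flip: add_divide_distrib)
    qed auto
    then have "l a x / l a 1 = e x" by metis
    then have "l a x = (1 + e a) * e x" using nz unfolding l1 by (auto simp: field_simps)
    then show ?thesis using lin by (simp add: l_def ring_distribs linear_add)
  qed
  have mult: "e (a * x) = e a * e x" for a x
  proof -
    \<comment> \<open>Dividing by \<open>p a + 1\<close> instead of \<open>p a\<close> covers
      \<open>p a = 0\<close> and still makes \<open>c *\<^sub>R a\<close> small enough.\<close>
    define c where "c = min \<delta> (1 / (2 * D)) / (p a + 1)"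
    have pa: "p a + 1 > 0" by (simp add: add_nonneg_pos)
    then have c: "c > 0" using D \<delta>(1) by (simp add: c_def)
    have "p (c *\<^sub>R a) = c * p a" using c by (simp add: scale)
    also have "\<dots> \<le> c * (p a + 1)" using c by simp
    also have "\<dots> = min \<delta> (1 / (2 * D))" using pa by (simp add: c_def)
    finally have "e ((c *\<^sub>R a) * x) = e (c *\<^sub>R a) * e x" by (intro small) auto
    then show ?thesis using c lin by (simp add: linear_cmul)
  qed
  \<comment> \<open>The factor \<open>D\<close> disappears because
    \<open>\<bar>e x\<bar> ^ k \<le> D * p x ^ k\<close> holds for every \<open>k\<close>.\<close>
  have "\<bar>e x\<bar> \<le> p x" for x
  proof (rule ccontr)
    assume gt: "\<not> \<bar>e x\<bar> \<le> p x"
    then have "p x \<noteq> 0" using e_le[of x] by auto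
    then have px: "p x > 0" using nonneg[of x] by linarith
    have pow: "e (x ^ k) = e x ^ k" for k
      by (induction k) (auto simp: e1 mult)
    have "(\<bar>e x\<bar> / p x) ^ k \<le> D" for k
    proof -
      have "\<bar>e x\<bar> ^ k \<le> D * p (x ^ k)" using e_le[of "x ^ k"] by (simp add: pow power_abs)
      also have "\<dots> \<le> D * p x ^ k" using D by (intro mult_left_mono power_le) auto
      finally show ?thesis using px by (simp add: power_divide divide_le_eq)
    qed
    moreover obtain k where "D < (\<bar>e x\<bar> / p x) ^ k"
      using real_arch_pow[of "\<bar>e x\<bar> / p x" D] gt px by auto
    ultimately show False by (meson not_le)
  qed
  moreover have "e f < 0"
    using e(2)[OF L_S] divide_neg_pos[OF neg \<open>L 1 > 0\<close>] by simp
  ultimately show ?thesis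
    using lin e1 mult by (intro exI[of _ e]) (auto simp: real_algebra_hom_def)
qed

end


section \<open>Radon measures with compact support\<close>

text \<open>The ambient space need not be normal, but its compact Hausdorff subspace
  \<open>K\<close> is; this is why \<open>u\<close> is continuous on \<open>K\<close> only.\<close>

lemma Urysohn_compact:
  fixes K :: "'a::t2_space set"
  assumes "compact K" "closed A" "closed B" "A \<inter> B \<inter> K = {}"
  shows "\<exists>u :: 'a \<Rightarrow> real. continuous_on K u \<and>
    (\<forall>x\<in>K. 0 \<le> u x \<and> u x \<le> 1 \<and> (x \<in> A \<longrightarrow> u x = 1) \<and> (x \<in> B \<longrightarrow> u x = 0))"
proof -
  have "compact_space (top_of_set K)"
    using assms(1) by (simp add: compact_space_subtopology)
  moreover have "Hausdorff_space (top_of_set K)"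
    using hausdorff by (intro Hausdorff_space_subtopology) (fastforce simp: Hausdorff_space_def disjnt_def)
  ultimately have "normal_space (top_of_set K)"
    by (simp add: compact_Hausdorff_or_regular_imp_normal_space)
  moreover have "closedin (top_of_set K) (K \<inter> B)" "closedin (top_of_set K) (K \<inter> A)"
    using assms by (auto simp: closedin_closed_Int)
  moreover have "disjnt (K \<inter> B) (K \<inter> A)" using assms(4) by (auto simp: disjnt_def)
  ultimately obtain u where u: "continuous_map (top_of_set K) (top_of_set {0..1::real}) u"
    "u ` (K \<inter> B) \<subseteq> {0}" "u ` (K \<inter> A) \<subseteq> {1}"
    by (metis Urysohn_lemma zero_le_one)
  moreover have "continuous_on K u" using u(1) continuous_map_into_fulltopology by force
  moreover have "0 \<le> u x \<and> u x \<le> 1" if "x \<in> K" for x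
    using continuous_map_image_subset_topspace[OF u(1)] that by auto
  ultimately show ?thesis by (intro exI[of _ u]) auto
qed

text \<open>The measure lives on the whole space, the test functions are continuous on
  \<open>K\<close>. The indicator of \<open>K\<close> makes them measurable everywhere without an
  extension theorem and, for globally continuous functions, leaves the integral unchanged.\<close>

locale compact_radon =
  fixes K :: "'a::t2_space set" and \<mu> :: "'a measure"
  assumes compact_K: "compact K" and radon: "radon_measure \<mu>" and supported: "supported_by \<mu> K"
begin

lemma sets_eq [measurable_cong]: "sets \<mu> = sets borel"
  using radon by (simp add: radon_measure_def)

lemma space_eq [simp]: "space \<mu> = UNIV"
  using sets_eq_imp_space_eq[OF sets_eq] by simp

lemma K_borel: "K \<in> sets borel"
  by (simp add: borel_compact compact_K)

lemma AE_in_K: "AE x in \<mu>. x \<in> K"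
  using supported by (auto simp: supported_by_def intro!: AE_I'[of "UNIV - K"])

lemma inner_regular:
  "B \<in> sets borel \<Longrightarrow> emeasure \<mu> B = (SUP C\<in>{C. compact C \<and> C \<subseteq> B}. emeasure \<mu> C)"
  using radon by (simp add: radon_measure_def)

text \<open>A finite subcover of \<open>K\<close> by open sets of finite measure bounds the measure
  of \<open>K\<close>, which is the total mass.\<close>

sublocale finite_measure \<mu>
proof
  have "\<exists>U. \<forall>x. open (U x) \<and> x \<in> U x \<and> emeasure \<mu> (U x) < \<infinity>"
    using radon unfolding radon_measure_def by (intro choice) iprover
  then obtain U where U: "\<And>x. open (U x)" "\<And>x. x \<in> U x" "\<And>x. emeasure \<mu> (U x) < \<infinity>" by blast
  obtain D where D: "finite D" "K \<subseteq> (\<Union>x\<in>D. U x)"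
    by (rule compactE_image[OF compact_K, of K U]) (use U(1,2) in auto)
  have "emeasure \<mu> (space \<mu>) = emeasure \<mu> K"
    using AE_in_K K_borel by (intro emeasure_eq_AE) (auto simp: sets_eq)
  also have "\<dots> \<le> emeasure \<mu> (\<Union>x\<in>D. U x)"
    using D U(1) by (intro emeasure_mono) (auto simp: sets_eq)
  also have "\<dots> \<le> (\<Sum>x\<in>D. emeasure \<mu> (U x))"
    using D U(1) by (intro emeasure_subadditive_finite) (auto simp: sets_eq)
  also have "\<dots> < \<infinity>" using D(1) U(3) by simp
  finally show "emeasure \<mu> (space \<mu>) \<noteq> \<infinity>" by simp
qed

lemma integrable_indicator_mult:
  fixes f :: "'a \<Rightarrow> real"
  assumes "continuous_on K f"
  shows "integrable \<mu> (\<lambda>x. indicator K x * f x)"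
proof -
  have "compact (f ` K)" by (rule compact_continuous_image[OF assms compact_K])
  then obtain b where b: "\<And>x. x \<in> K \<Longrightarrow> \<bar>f x\<bar> \<le> b"
    using compact_imp_bounded bounded_iff by (metis image_eqI real_norm_def)
  have "(\<lambda>x. indicator K x * f x) \<in> borel_measurable borel"
    using borel_measurable_continuous_on_indicator[OF K_borel assms] by simp
  then have "(\<lambda>x. indicator K x * f x) \<in> borel_measurable \<mu>"
    by (simp add: measurable_cong_sets[OF sets_eq])
  then show ?thesis
    by (intro integrable_const_bound[of _ "\<bar>b\<bar>"])
      (use b in \<open>auto simp: indicator_def intro!: AE_I2 intro: order.trans[OF _ abs_ge_self]\<close>)
qed

lemma measurable_continuous:
  fixes f :: "'a \<Rightarrow> real"
  shows "continuous_on UNIV f \<Longrightarrow> f \<in> borel_measurable \<mu>"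
  using borel_measurable_continuous_onI by (simp add: measurable_cong_sets[OF sets_eq])

lemma integrable_continuous:
  fixes f :: "'a \<Rightarrow> real"
  assumes "continuous_on UNIV f"
  shows "integrable \<mu> f"
proof (rule integrable_cong_AE_imp)
  show "integrable \<mu> (\<lambda>x. indicator K x * f x)"
    using assms by (intro integrable_indicator_mult) (rule continuous_on_subset, auto)
  show "f \<in> borel_measurable \<mu>" by (rule measurable_continuous[OF assms])
  show "AE x in \<mu>. indicator K x * f x = f x" using AE_in_K by eventually_elim simp
qed

lemma integral_indicator_mult:
  fixes f :: "'a \<Rightarrow> real"
  assumes "continuous_on UNIV f"
  shows "(\<integral>x. indicator K x * f x \<partial>\<mu>) = (\<integral>x. f x \<partial>\<mu>)"
proof (rule integral_cong_AE)
  show "(\<lambda>x. indicator K x * f x) \<in> borel_measurable \<mu>"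
    using assms by (intro borel_measurable_integrable integrable_indicator_mult) (rule continuous_on_subset, auto)
  show "f \<in> borel_measurable \<mu>" by (rule measurable_continuous[OF assms])
  show "AE x in \<mu>. indicator K x * f x = f x" using AE_in_K by eventually_elim simp
qed

lemma measure_Int_K: "B \<in> sets borel \<Longrightarrow> measure \<mu> (B \<inter> K) = measure \<mu> B"
  using AE_in_K K_borel by (intro measure_eq_AE) (auto simp: sets_eq elim: eventually_mono)

lemma compact_approx:
  assumes "B \<in> sets borel" "0 < e"
  obtains C where "compact C" "C \<subseteq> B" "measure \<mu> B < measure \<mu> C + e"
\<comment> \<open>The split keeps \<open>measure \<mu> B - e\<close> nonnegative in the second case,
  so that it can be compared as an \<open>ennreal\<close>.\<close>
proof (cases "measure \<mu> B < e")
  case True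
  then show ?thesis using that[of "{}"] by simp
next
  case False
  then have "ennreal (measure \<mu> B - e) < emeasure \<mu> B"
    using assms(2) by (simp add: emeasure_eq_measure ennreal_less_iff)
  then obtain C where C: "C \<in> {C. compact C \<and> C \<subseteq> B}" "ennreal (measure \<mu> B - e) < emeasure \<mu> C"
    unfolding inner_regular[OF assms(1)] less_SUP_iff by (elim bexE)
  then have "measure \<mu> B - e < measure \<mu> C"
    using False by (simp add: emeasure_eq_measure ennreal_less_iff)
  then have "measure \<mu> B < measure \<mu> C + e" by linarith
  then show ?thesis using that[of C] C(1) by blast
qed

end

text \<open>Inner regularity of \<nu> on \<open>K - C\<close> replaces outer regularity at
  \<open>C\<close>: a compact \<open>D\<close> nearly exhausts \<open>K - C\<close>, and a function
  equal to 1 on \<open>C\<close> and 0 on \<open>D\<close> has \<mu>-integral at least the measure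
  of \<open>C\<close> and \<nu>-integral at most that of \<open>K - D\<close>.\<close>

lemma compact_radon_measure_le:
  assumes "compact_radon K \<mu>" "compact_radon K \<nu>"
    and eq: "\<And>u :: 'a::t2_space \<Rightarrow> real. continuous_on K u \<Longrightarrow>
      (\<integral>x. indicator K x * u x \<partial>\<mu>) = (\<integral>x. indicator K x * u x \<partial>\<nu>)"
    and C: "compact C"
  shows "measure \<mu> C \<le> measure \<nu> C"
proof (rule field_le_epsilon)
  fix e :: real assume e: "0 < e"
  interpret \<mu>: compact_radon K \<mu> by fact
  interpret \<nu>: compact_radon K \<nu> by fact
  have CB: "C \<in> sets borel" "K - C \<in> sets borel"
    using C \<mu>.compact_K by (simp_all add: borel_compact sets.Diff)
  obtain D where D: "compact D" "D \<subseteq> K - C" "measure \<nu> (K - C) < measure \<nu> D + e"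
    using \<nu>.compact_approx[OF CB(2) e] .
  have cl: "closed C" "closed D" "C \<inter> D \<inter> K = {}"
    using C D by (auto intro: compact_imp_closed)
  obtain u :: "'a \<Rightarrow> real" where u: "continuous_on K u"
    "\<forall>x\<in>K. 0 \<le> u x \<and> u x \<le> 1 \<and> (x \<in> C \<longrightarrow> u x = 1) \<and> (x \<in> D \<longrightarrow> u x = 0)"
    using Urysohn_compact[OF \<mu>.compact_K cl] by (elim exE conjE)
  have DB: "D \<in> sets borel" using D(1) by (rule borel_compact)
  have "measure \<mu> C = (\<integral>x. indicat_real (C \<inter> K) x \<partial>\<mu>)"
    using \<mu>.measure_Int_K[OF CB(1)] by simp
  also have "\<dots> \<le> (\<integral>x. indicator K x * u x \<partial>\<mu>)"
  proof (rule integral_mono)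
    show "integrable \<mu> (indicat_real (C \<inter> K))"
      using CB(1) \<mu>.K_borel
      by (intro integrable_real_indicator) (auto simp: \<mu>.sets_eq \<mu>.emeasure_finite less_top[symmetric])
    show "integrable \<mu> (\<lambda>x. indicator K x * u x)" by (rule \<mu>.integrable_indicator_mult[OF u(1)])
    show "indicat_real (C \<inter> K) x \<le> indicator K x * u x" for x
      using u(2) by (cases "x \<in> K") (auto simp: indicator_def)
  qed
  also have "\<dots> = (\<integral>x. indicator K x * u x \<partial>\<nu>)" by (rule eq[OF u(1)])
  also have "\<dots> \<le> (\<integral>x. indicat_real (K - D) x \<partial>\<nu>)"
  proof (rule integral_mono)
    show "integrable \<nu> (indicat_real (K - D))"
      using DB \<nu>.K_borel
      by (intro integrable_real_indicator) (auto simp: \<nu>.sets_eq \<nu>.emeasure_finite less_top[symmetric])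
    show "integrable \<nu> (\<lambda>x. indicator K x * u x)" by (rule \<nu>.integrable_indicator_mult[OF u(1)])
    show "indicator K x * u x \<le> indicat_real (K - D) x" for x
      using u(2) by (cases "x \<in> K") (auto simp: indicator_def)
  qed
  also have "\<dots> = measure \<nu> K - measure \<nu> D"
  proof -
    have "measure \<nu> (K - D) = measure \<nu> K - measure \<nu> D"
      using DB D(2) \<nu>.K_borel by (intro \<nu>.finite_measure_Diff) (auto simp: \<nu>.sets_eq)
    then show ?thesis by simp
  qed
  also have "measure \<nu> K = measure \<nu> (C \<inter> K) + measure \<nu> (K - C)"
  proof -
    have "measure \<nu> ((C \<inter> K) \<union> (K - C)) = measure \<nu> (C \<inter> K) + measure \<nu> (K - C)"
      using CB \<nu>.K_borel by (intro \<nu>.finite_measure_Union) (auto simp: \<nu>.sets_eq)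
    moreover have "(C \<inter> K) \<union> (K - C) = K" by auto
    ultimately show ?thesis by simp
  qed
  also have "measure \<nu> (C \<inter> K) = measure \<nu> C" by (rule \<nu>.measure_Int_K[OF CB(1)])
  finally show "measure \<mu> C \<le> measure \<nu> C + e" using D(3) by linarith
qed

lemma compact_radon_eqI:
  assumes "compact_radon K \<mu>" "compact_radon K \<nu>"
    and eq: "\<And>u :: 'a::t2_space \<Rightarrow> real. continuous_on K u \<Longrightarrow>
      (\<integral>x. indicator K x * u x \<partial>\<mu>) = (\<integral>x. indicator K x * u x \<partial>\<nu>)"
  shows "\<mu> = \<nu>"
proof (rule measure_eqI)
  interpret \<mu>: compact_radon K \<mu> by fact
  interpret \<nu>: compact_radon K \<nu> by fact
  show "sets \<mu> = sets \<nu>" by (simp add: \<mu>.sets_eq \<nu>.sets_eq)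
  fix B assume "B \<in> sets \<mu>"
  then have B: "B \<in> sets borel" by (simp add: \<mu>.sets_eq)
  have "measure \<mu> C = measure \<nu> C" if "compact C" for C
    by (intro antisym compact_radon_measure_le[OF assms(1,2)] compact_radon_measure_le[OF assms(2,1)] that)
      (simp_all add: eq)
  then show "emeasure \<mu> B = emeasure \<nu> B"
    unfolding \<mu>.inner_regular[OF B] \<nu>.inner_regular[OF B]
    by (intro SUP_cong) (auto simp: \<mu>.emeasure_eq_measure \<nu>.emeasure_eq_measure)
qed


section \<open>The Riesz representation theorem\<close>

text \<open>The k-th summand is the part of \<open>y\<close> between the heights
  \<open>k / n\<close> and \<open>(k + 1) / n\<close>. This layered decomposition serves to compare
  \<open>I f\<close> with the integral of \<open>f\<close>.\<close>

lemma sum_slices_eq: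
  fixes y :: real
  assumes "0 < n" "0 \<le> y"
  shows "(\<Sum>k<m. min (max (y - real k / real n) 0) (1 / real n)) = min y (real m / real n)"
proof (induction m)
  case 0
  then show ?case using assms by simp
next
  case (Suc m)
  have "real (Suc m) / real n = real m / real n + 1 / real n" by (simp add: add_divide_distrib)
  moreover have "min y a + min (max (y - a) 0) c = min y (a + c)" if "0 < c" for a c
    using that by linarith
  ultimately show ?case using Suc assms by simp
qed

text \<open>At most \<open>n * y + 1\<close> of the levels \<open>k / n\<close> lie below
  \<open>y\<close>; the additional \<open>1 / n\<close> arises since the topmost slice is counted in
  full.\<close>

lemma sum_slices_le:
  fixes y :: real
  assumes "0 < n" "0 \<le> y"
  shows "(\<Sum>k<m. (1 / real n) * of_bool (real k / real n < y)) \<le> y + 1 / real n"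
proof (induction m)
  case 0
  then show ?case using assms by simp
next
  case (Suc m)
  show ?case
  proof (cases "real m / real n < y")
    case True
    have "(\<Sum>k<Suc m. (1 / real n) * of_bool (real k / real n < y)) \<le> (\<Sum>k<Suc m. 1 / real n)"
      by (rule sum_mono) auto
    also have "\<dots> = real m / real n + 1 / real n" by (simp add: add_divide_distrib)
    finally show ?thesis using True by linarith
  qed (use Suc in simp)
qed

text \<open>\<open>I\<close> takes functions on the whole type, but \<open>I_mono\<close>, used in
  both directions, shows that among functions continuous on \<open>K\<close> it sees only the values
  on \<open>K\<close>. This avoids a separate type of functions on \<open>K\<close>.\<close>

locale positive_functional =
  fixes K :: "'a::t2_space set" and I :: "('a \<Rightarrow> real) \<Rightarrow> real"
  assumes compact_K: "compact K"
    and I_add: "continuous_on K f \<Longrightarrow> continuous_on K g \<Longrightarrow> I (\<lambda>x. f x + g x) = I f + I g"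
    and I_cmult: "continuous_on K f \<Longrightarrow> I (\<lambda>x. c * f x) = c * I f"
    and I_nonneg: "continuous_on K f \<Longrightarrow> (\<And>x. x \<in> K \<Longrightarrow> 0 \<le> f x) \<Longrightarrow> 0 \<le> I f"
begin

lemma I_mono:
  assumes "continuous_on K f" "continuous_on K g" "\<And>x. x \<in> K \<Longrightarrow> f x \<le> g x"
  shows "I f \<le> I g"
proof -
  have "I g = I (\<lambda>x. f x + (g x + (- 1) * f x))" by simp
  also have "\<dots> = I f + I (\<lambda>x. g x + (- 1) * f x)"
    using assms by (intro I_add continuous_intros) auto
  finally show ?thesis
    using I_nonneg[of "\<lambda>x. g x + (- 1) * f x"] assms by (auto intro!: continuous_intros)
qed

abbreviation "mass \<equiv> I (\<lambda>_. 1)"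

lemma mass_nonneg [simp]: "0 \<le> mass"
  by (rule I_nonneg) (auto intro: continuous_intros)

lemma small_level:
  assumes "0 < e"
  obtains \<delta> where "0 < \<delta>" "\<delta> * mass \<le> e"
proof
  have "0 < mass + 1" using mass_nonneg by linarith
  then show "0 < e / (mass + 1)" "e / (mass + 1) * mass \<le> e"
    using assms by (auto simp: field_simps)
qed

lemma I_const: "I (\<lambda>_. c) = c * mass"
  using I_cmult[of "\<lambda>_. 1" c] by (simp add: continuous_on_const)

lemma I_sum:
  assumes "finite A" "\<And>i. i \<in> A \<Longrightarrow> continuous_on K (f i)"
  shows "I (\<lambda>x. \<Sum>i\<in>A. f i x) = (\<Sum>i\<in>A. I (f i))"
  using assms
proof (induction A)
  case empty
  then show ?case using I_const[of 0] by simp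
next
  case (insert a A)
  have "I (\<lambda>x. f a x + (\<Sum>i\<in>A. f i x)) = I (f a) + I (\<lambda>x. \<Sum>i\<in>A. f i x)"
    using insert by (intro I_add continuous_on_sum) auto
  then show ?case using insert by simp
qed

text \<open>
  The functions below \<open>U\<close> vanish off \<open>U\<close> but need not have compact support in \<open>U\<close>; cutting them off at
  a small level \<open>e\<close> achieves this and changes \<open>I\<close> by at most \<open>e * mass\<close>.
\<close>

definition below :: "'a set \<Rightarrow> ('a \<Rightarrow> real) \<Rightarrow> bool"
  where "below U f \<longleftrightarrow> continuous_on K f \<and> (\<forall>x\<in>K. 0 \<le> f x \<and> f x \<le> 1 \<and> (x \<notin> U \<longrightarrow> f x = 0))"

definition content :: "'a set \<Rightarrow> real"
  where "content U = Sup {I f | f. below U f}"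

lemma below_zero: "below U (\<lambda>_. 0)"
  by (auto simp: below_def intro: continuous_intros)

lemma below_I_le_mass: "below U f \<Longrightarrow> I f \<le> mass"
  by (rule I_mono) (auto simp: below_def intro: continuous_intros)

lemma I_le_content: "below U f \<Longrightarrow> I f \<le> content U"
  unfolding content_def by (rule cSup_upper) (auto intro!: bdd_aboveI[of _ mass] below_I_le_mass)

lemma content_le:
  assumes "\<And>f. below U f \<Longrightarrow> I f \<le> c"
  shows "content U \<le> c"
  unfolding content_def by (rule cSup_least) (use below_zero assms in auto)

lemma content_nonneg [simp]: "0 \<le> content U"
  using I_le_content[OF below_zero] I_const[of 0] by simp

lemma content_le_mass: "content U \<le> mass"
  by (rule content_le) (rule below_I_le_mass)

lemma content_mono: "U \<inter> K \<subseteq> V \<Longrightarrow> content U \<le> content V"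
  by (intro content_le I_le_content) (fastforce simp: below_def)

lemma content_disjoint: "U \<inter> K = {} \<Longrightarrow> content U = 0"
proof (intro antisym content_nonneg content_le)
  fix f assume "U \<inter> K = {}" "below U f"
  then have "I f \<le> I (\<lambda>_. 0)" by (intro I_mono) (auto simp: below_def intro: continuous_intros)
  then show "I f \<le> 0" using I_const[of 0] by simp
qed

section \<open>Truncation and subadditivity of the content\<close>

definition cut :: "real \<Rightarrow> ('a \<Rightarrow> real) \<Rightarrow> 'a \<Rightarrow> real"
  where "cut e f x = max (f x - e) 0"

lemma below_cut: "0 < e \<Longrightarrow> below U f \<Longrightarrow> below U (cut e f)"
  unfolding below_def cut_def by (auto intro!: continuous_intros)

lemma I_cut:
  assumes "0 < e" "below U f"
  shows "I f \<le> I (cut e f) + e * mass"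
proof -
  have "continuous_on K (cut e f)" using below_cut[OF assms] by (simp add: below_def)
  then have "I f \<le> I (\<lambda>x. cut e f x + e)"
    using assms by (intro I_mono continuous_intros) (auto simp: below_def cut_def)
  also have "\<dots> = I (cut e f) + e * mass"
    using \<open>continuous_on K (cut e f)\<close> by (subst I_add) (auto simp: I_const[of e] continuous_on_const)
  finally show ?thesis .
qed

lemma compact_superlevel:
  assumes "below U f"
  shows "compact {x \<in> K. e \<le> f x}"
proof -
  have "closedin (top_of_set K) {x \<in> K. e \<le> f x}"
    using continuous_closedin_preimage[of K f "{e..}"] assms
    by (simp add: below_def vimage_def Int_def)
  then show ?thesis using compact_K closedin_compact by blast
qed

lemma superlevel_subset: "0 < e \<Longrightarrow> below U f \<Longrightarrow> {x \<in> K. e \<le> f x} \<subseteq> U"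
  by (force simp: below_def)

lemma cut_below:
  assumes "0 < e" "below U f" "{x \<in> K. e \<le> f x} \<subseteq> V"
  shows "below V (cut e f)"
  using below_cut[OF assms(1,2)] assms(3) by (fastforce simp: below_def cut_def)

lemma below_mult:
  assumes "below W g" "continuous_on K u" "\<And>x. x \<in> K \<Longrightarrow> 0 \<le> u x \<and> u x \<le> 1"
    and "\<And>x. x \<in> K \<Longrightarrow> x \<notin> U \<Longrightarrow> g x = 0 \<or> u x = 0"
  shows "below U (\<lambda>x. g x * u x)"
proof -
  have "continuous_on K (\<lambda>x. g x * u x)"
    using assms(1,2) by (auto simp: below_def intro: continuous_on_mult)
  moreover have "0 \<le> g x * u x \<and> g x * u x \<le> 1 \<and> (x \<notin> U \<longrightarrow> g x * u x = 0)" if x: "x \<in> K" for x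
    using assms(1) assms(3,4)[OF x] x by (auto simp: below_def intro: mult_le_one)
  ultimately show ?thesis by (simp add: below_def)
qed

text \<open>After the cut, \<open>f\<close> lives on a compact \<open>C\<close> inside
  \<open>U \<union> V\<close>. The closed sets \<open>C - V\<close> and \<open>C - U\<close> are
  disjoint, so a Urysohn function splits the cut function into a part below \<open>U\<close> and a
  part below \<open>V\<close>.\<close>

lemma content_Un:
  assumes "open U" "open V"
  shows "content (U \<union> V) \<le> content U + content V"
proof (rule content_le)
  fix f assume f: "below (U \<union> V) f"
  show "I f \<le> content U + content V"
  proof (rule field_le_epsilon)
    fix e :: real assume "0 < e"
    obtain \<delta> where \<delta>: "0 < \<delta>" "\<delta> * mass \<le> e"
      using small_level[OF \<open>0 < e\<close>] .
    define C where "C = {x \<in> K. \<delta> \<le> f x}"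
    have C: "closed C" "C \<subseteq> K" "C \<subseteq> U \<union> V"
      using compact_superlevel[OF f, of \<delta>] superlevel_subset[OF \<delta>(1) f]
      by (auto simp: C_def compact_imp_closed)
    have CUV: "closed (C - V)" "closed (C - U)" "(C - V) \<inter> (C - U) \<inter> K = {}"
      using C assms by auto
    obtain u :: "'a \<Rightarrow> real" where u: "continuous_on K u" "\<And>x. x \<in> K \<Longrightarrow> 0 \<le> u x \<and> u x \<le> 1"
      "\<And>x. x \<in> K \<Longrightarrow> x \<in> C - V \<Longrightarrow> u x = 1" "\<And>x. x \<in> K \<Longrightarrow> x \<in> C - U \<Longrightarrow> u x = 0"
      using Urysohn_compact[OF compact_K CUV] by blast
    let ?g = "cut \<delta> f"
    have g: "below (U \<union> V) ?g" by (rule below_cut[OF \<delta>(1) f])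
    have g0: "?g x = 0" if "x \<in> K" "x \<notin> C" for x
      using that by (auto simp: cut_def C_def)
    have gu: "below U (\<lambda>x. ?g x * u x)"
    proof (rule below_mult[OF g u(1,2)])
      show "?g x = 0 \<or> u x = 0" if "x \<in> K" "x \<notin> U" for x
        using g0[OF that(1)] u(4)[OF that(1)] that(2) by blast
    qed
    have gv: "below V (\<lambda>x. ?g x * (1 - u x))"
    proof (rule below_mult[OF g])
      show "continuous_on K (\<lambda>x. 1 - u x)" using u(1) by (intro continuous_intros)
      show "0 \<le> 1 - u x \<and> 1 - u x \<le> 1" if "x \<in> K" for x using u(2)[OF that] by simp
      show "?g x = 0 \<or> 1 - u x = 0" if "x \<in> K" "x \<notin> V" for x
        using g0[OF that(1)] u(3)[OF that(1)] that(2) by auto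
    qed
    have le: "I (\<lambda>x. ?g x * u x) \<le> content U" "I (\<lambda>x. ?g x * (1 - u x)) \<le> content V"
      using gu gv by (auto intro: I_le_content)
    have "continuous_on K (\<lambda>x. ?g x * u x)" "continuous_on K (\<lambda>x. ?g x * (1 - u x))"
      using gu gv unfolding below_def by blast+
    then have "I (\<lambda>x. ?g x * u x + ?g x * (1 - u x)) = I (\<lambda>x. ?g x * u x) + I (\<lambda>x. ?g x * (1 - u x))"
      by (intro I_add)
    moreover have "(\<lambda>x. ?g x * u x + ?g x * (1 - u x)) = ?g" by (auto simp: algebra_simps)
    ultimately show "I f \<le> content U + content V + e"
      using le I_cut[OF \<delta>(1) f] \<delta>(2) by simp
  qed
qed

lemma content_UN_le:
  assumes "\<And>i. open (U i)"
  shows "content (\<Union>i<n::nat. U i) \<le> (\<Sum>i<n. content (U i))"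
proof (induction n)
  case 0
  then show ?case by (simp add: content_disjoint)
next
  case (Suc n)
  have "(\<Union>i<Suc n. U i) = (\<Union>i<n. U i) \<union> U n" by (auto simp: less_Suc_eq)
  then show ?case using Suc content_Un[of "\<Union>i<n. U i" "U n"] assms by (simp add: open_UN)
qed

text \<open>The superlevel set of \<open>f\<close> is compact, so finitely many \<open>U i\<close>
  suffice for the cut function and finite subadditivity applies.\<close>

lemma content_UN_le_suminf:
  assumes U: "\<And>i::nat. open (U i)"
  shows "ennreal (content (\<Union>i. U i)) \<le> (suminf (\<lambda>i. ennreal (content (U i))))"
proof (rule ennreal_le_epsilon)
  fix e :: real assume "0 < e" and fin: "(suminf (\<lambda>i. ennreal (content (U i)))) < top"
  define s where "s = enn2real (suminf (\<lambda>i. ennreal (content (U i))))"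
  have s: "suminf (\<lambda>i. ennreal (content (U i))) = ennreal s" "0 \<le> s"
    using fin by (simp_all add: s_def)
  have "content (\<Union>i. U i) \<le> s + e"
  proof (rule content_le)
    fix f assume f: "below (\<Union>i. U i) f"
    obtain \<delta> where \<delta>: "0 < \<delta>" "\<delta> * mass \<le> e"
      using small_level[OF \<open>0 < e\<close>] .
    obtain D where D: "finite D" "{x \<in> K. \<delta> \<le> f x} \<subseteq> (\<Union>i\<in>D. U i)"
      using compactE_image[OF compact_superlevel[OF f, of \<delta>], of UNIV U] U superlevel_subset[OF \<delta>(1) f]
      by auto
    then obtain n where "D \<subseteq> {..<n}" by (meson finite_nat_iff_bounded)
    then have "{x \<in> K. \<delta> \<le> f x} \<subseteq> (\<Union>i<n. U i)" using D(2) by blast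
    then have "I (cut \<delta> f) \<le> content (\<Union>i<n. U i)"
      by (intro I_le_content cut_below[OF \<delta>(1) f])
    also have "\<dots> \<le> (\<Sum>i<n. content (U i))" by (rule content_UN_le[OF U])
    also have "\<dots> \<le> s"
    proof -
      have "ennreal (\<Sum>i<n. content (U i)) = (\<Sum>i<n. ennreal (content (U i)))"
        by (simp add: sum_ennreal)
      also have "\<dots> \<le> (suminf (\<lambda>i. ennreal (content (U i))))" by (rule sum_le_suminf) auto
      finally show ?thesis using s by simp
    qed
    finally show "I f \<le> s + e" using I_cut[OF \<delta>(1) f] \<delta>(2) by linarith
  qed
  then show "ennreal (content (\<Union>i. U i)) \<le> (suminf (\<lambda>i. ennreal (content (U i)))) + ennreal e"
    using s \<open>0 < e\<close> by (simp flip: ennreal_plus)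
qed

section \<open>The outer measure\<close>

definition outer :: "'a set \<Rightarrow> real"
  where "outer A = Inf {content U | U. open U \<and> A \<subseteq> U}"

lemma outer_le: "open U \<Longrightarrow> A \<subseteq> U \<Longrightarrow> outer A \<le> content U"
  unfolding outer_def by (rule cInf_lower) (auto intro!: bdd_belowI[of _ 0])

lemma le_outer:
  assumes "\<And>U. open U \<Longrightarrow> A \<subseteq> U \<Longrightarrow> c \<le> content U"
  shows "c \<le> outer A"
  unfolding outer_def by (rule cInf_greatest) (use assms in auto)

lemma outer_open: "open U \<Longrightarrow> outer U = content U"
  by (intro antisym outer_le le_outer content_mono) auto

lemma outer_nonneg [simp]: "0 \<le> outer A"
  by (rule le_outer) simp

lemma outer_mono: "A \<subseteq> B \<Longrightarrow> outer A \<le> outer B"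
  by (rule le_outer) (auto intro: outer_le)

lemma outer_approx:
  assumes "0 < e"
  obtains U where "open U" "A \<subseteq> U" "content U < outer A + e"
proof -
  have "\<not> (\<forall>U. open U \<longrightarrow> A \<subseteq> U \<longrightarrow> outer A + e \<le> content U)"
    using le_outer[of A "outer A + e"] assms by auto
  then show ?thesis using that by (meson not_le)
qed

lemma outer_measure_space_outer: "outer_measure_space (Pow UNIV) (\<lambda>A. ennreal (outer A))"
proof -
  have "outer {} = 0" by (simp add: outer_open content_disjoint)
  then have "positive (Pow UNIV) (\<lambda>A. ennreal (outer A))" by (simp add: positive_def)
  moreover have "increasing (Pow UNIV) (\<lambda>A. ennreal (outer A))"
    by (auto simp: increasing_def intro!: ennreal_leI outer_mono)
  moreover have "ennreal (outer (\<Union>i. A i)) \<le> (suminf (\<lambda>i. ennreal (outer (A i))))" for A :: "nat \<Rightarrow> 'a set"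
  proof (rule ennreal_le_epsilon)
    fix e :: real assume e: "0 < e"
    have "\<exists>U. open U \<and> A i \<subseteq> U \<and> content U < outer (A i) + e * (1 / 2) ^ Suc i" for i
    proof -
      have "0 < e * (1 / 2) ^ Suc i" using e by simp
      then show ?thesis by (rule outer_approx[of _ "A i"]) blast
    qed
    then have "\<exists>U. \<forall>i. open (U i) \<and> A i \<subseteq> U i \<and> content (U i) < outer (A i) + e * (1 / 2) ^ Suc i"
      by (intro choice allI)
    then obtain U where U: "\<And>i. open (U i)" "\<And>i. A i \<subseteq> U i"
      "\<And>i. content (U i) < outer (A i) + e * (1 / 2) ^ Suc i" by blast
    have "ennreal (outer (\<Union>i. A i)) \<le> ennreal (content (\<Union>i. U i))"
      by (intro ennreal_leI outer_le open_UN ballI U UN_mono) auto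
    also have "\<dots> \<le> (suminf (\<lambda>i. ennreal (content (U i))))" by (rule content_UN_le_suminf[OF U(1)])
    also have "\<dots> \<le> (suminf (\<lambda>i. ennreal (outer (A i)) + ennreal (e * (1 / 2) ^ Suc i)))"
      by (intro suminf_le) (use U(3) e in \<open>auto intro!: ennreal_leI less_imp_le simp flip: ennreal_plus\<close>)
    also have "\<dots> = (suminf (\<lambda>i. ennreal (outer (A i)))) + (suminf (\<lambda>i. ennreal (e * (1 / 2) ^ Suc i)))"
      by (rule suminf_add[symmetric]) auto
    also have "(suminf (\<lambda>i. ennreal (e * (1 / 2) ^ Suc i))) = ennreal e"
      using e sums_mult[OF power_half_series, of e] by (intro suminf_ennreal_eq) auto
    finally show "ennreal (outer (\<Union>i. A i)) \<le> (suminf (\<lambda>i. ennreal (outer (A i)))) + ennreal e" .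
  qed
  ultimately show ?thesis unfolding outer_measure_space_def countably_subadditive_def by iprover
qed

lemma outer_Un: "outer (A \<union> B) \<le> outer A + outer B"
proof (rule field_le_epsilon)
  fix e :: real assume "0 < e"
  then have e2: "0 < e / 2" by simp
  obtain U where U: "open U" "A \<subseteq> U" "content U < outer A + e / 2"
    by (rule outer_approx[OF e2])
  obtain V where V: "open V" "B \<subseteq> V" "content V < outer B + e / 2"
    by (rule outer_approx[OF e2])
  have "outer (A \<union> B) \<le> content (U \<union> V)" using U V by (intro outer_le) auto
  then show "outer (A \<union> B) \<le> outer A + outer B + e"
    using content_Un[OF U(1) V(1)] U(3) V(3) by linarith
qed

text \<open>Caratheodory's condition for open sets. For a superlevel set \<open>C\<close> of a
  function below \<open>W \<inter> U\<close>, the cut function vanishes off \<open>C\<close> and any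
  \<open>g\<close> below \<open>W - C\<close> vanishes on \<open>C\<close>. Their sum therefore
  stays below \<open>W\<close>, and the two values of \<open>I\<close> add up to at most
  \<open>content W\<close>.\<close>

lemma outer_split_open:
  assumes "open U"
  shows "outer (A \<inter> U) + outer (A - U) = outer A"
proof (rule antisym)
  show "outer (A \<inter> U) + outer (A - U) \<le> outer A"
  proof (rule le_outer)
    fix W assume W: "open W" "A \<subseteq> W"
    have "content (W \<inter> U) \<le> content W - outer (A - U)"
    proof (rule content_le)
      fix f assume f: "below (W \<inter> U) f"
      show "I f \<le> content W - outer (A - U)"
      proof (rule field_le_epsilon)
        fix e :: real assume "0 < e"
        obtain \<delta> where \<delta>: "0 < \<delta>" "\<delta> * mass \<le> e"
          using small_level[OF \<open>0 < e\<close>] .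
        define C where "C = {x \<in> K. \<delta> \<le> f x}"
        have C: "closed C" "C \<subseteq> W \<inter> U"
          using compact_superlevel[OF f, of \<delta>] superlevel_subset[OF \<delta>(1) f]
          by (auto simp: C_def compact_imp_closed)
        have "content (W - C) \<le> content W - I (cut \<delta> f)"
        proof (rule content_le)
          fix g assume g: "below (W - C) g"
          have cf: "below (W \<inter> U) (cut \<delta> f)" by (rule below_cut[OF \<delta>(1) f])
          have "0 \<le> cut \<delta> f x + g x \<and> cut \<delta> f x + g x \<le> 1 \<and> (x \<notin> W \<longrightarrow> cut \<delta> f x + g x = 0)"
            if x: "x \<in> K" for x
          proof (cases "x \<in> C")
            case True
            then have "g x = 0" using g x by (simp add: below_def)
            then show ?thesis using cf x by (simp add: below_def)
          next
            case False
            then have "cut \<delta> f x = 0" using x by (simp add: cut_def C_def)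
            then show ?thesis using g x by (simp add: below_def)
          qed
          moreover have "continuous_on K (\<lambda>x. cut \<delta> f x + g x)"
            using cf g by (auto simp: below_def intro: continuous_on_add)
          ultimately have "below W (\<lambda>x. cut \<delta> f x + g x)" by (simp add: below_def)
          then have "I (\<lambda>x. cut \<delta> f x + g x) \<le> content W" by (rule I_le_content)
          moreover have "I (\<lambda>x. cut \<delta> f x + g x) = I (cut \<delta> f) + I g"
            using cf g by (intro I_add) (auto simp: below_def)
          ultimately show "I g \<le> content W - I (cut \<delta> f)" by simp
        qed
        moreover have "outer (A - U) \<le> content (W - C)"
          using W C by (intro outer_le) auto
        ultimately show "I f \<le> content W - outer (A - U) + e"
          using I_cut[OF \<delta>(1) f] \<delta>(2) by linarith
      qed
    qed
    moreover have "outer (A \<inter> U) \<le> content (W \<inter> U)" using W assms by (intro outer_le) auto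
    ultimately show "outer (A \<inter> U) + outer (A - U) \<le> content W" by simp
  qed
  show "outer A \<le> outer (A \<inter> U) + outer (A - U)"
    using outer_Un[of "A \<inter> U" "A - U"] by (simp add: Int_Diff_Un)
qed

section \<open>The Riesz measure and its regularity\<close>

definition riesz_measure :: "'a measure"
  where "riesz_measure = measure_of UNIV (sets borel) (\<lambda>A. ennreal (outer A))"

lemma space_riesz_measure [simp]: "space riesz_measure = UNIV"
  and sets_riesz_measure [simp]: "sets riesz_measure = sets borel"
  using sets.sigma_sets_eq[of "borel :: 'a measure"] by (simp_all add: riesz_measure_def)

text \<open>By Caratheodory's theorem the sets that split every set additively form a sigma-algebra
  on which \<open>outer\<close> is a measure; it contains the open sets by
  \<open>outer_split_open\<close>, hence all Borel sets.\<close>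

lemma emeasure_riesz_measure:
  assumes "A \<in> sets borel"
  shows "emeasure riesz_measure A = ennreal (outer A)"
proof -
  let ?L = "lambda_system UNIV (Pow UNIV) (\<lambda>A. ennreal (outer A))"
  interpret P: sigma_algebra UNIV "Pow UNIV :: 'a set set" by (rule sigma_algebra_Pow)
  have L: "measure_space UNIV ?L (\<lambda>A. ennreal (outer A))"
    by (rule P.caratheodory_lemma[OF outer_measure_space_outer])
  have "sets (borel :: 'a measure) \<subseteq> ?L"
    unfolding sets_borel
  proof (rule sigma_algebra.sigma_sets_subset)
    show "sigma_algebra UNIV ?L" using L by (simp add: measure_space_def)
    show "{S :: 'a set. open S} \<subseteq> ?L"
    proof
      fix S :: "'a set" assume "S \<in> {S. open S}"
      then show "S \<in> ?L"
        unfolding P.lambda_system_eq by (simp add: outer_split_open flip: ennreal_plus)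
    qed
  qed
  then have "measure_space UNIV (sets (borel :: 'a measure)) (\<lambda>A. ennreal (outer A))"
    using measure_down[OF L] sets.sigma_algebra_axioms[of "borel :: 'a measure"] by simp
  then show ?thesis
    using assms unfolding riesz_measure_def measure_space_def by (simp add: emeasure_measure_of_sigma)
qed

lemma measure_riesz_measure: "A \<in> sets borel \<Longrightarrow> measure riesz_measure A = outer A"
  by (simp add: measure_def emeasure_riesz_measure)

lemma finite_measure_riesz_measure: "finite_measure riesz_measure"
  by (rule finite_measureI) (simp add: emeasure_riesz_measure)

lemma K_borel: "K \<in> sets borel"
  by (simp add: borel_compact compact_K)

lemma outer_compl_K: "outer (- K) = 0"
  using compact_K by (simp add: outer_open content_disjoint compact_imp_closed open_Compl)

lemma outer_Int_K: "outer (A \<inter> K) = outer A"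
proof (rule antisym[OF outer_mono])
  have "outer A \<le> outer ((A \<inter> K) \<union> - K)" by (rule outer_mono) auto
  also have "\<dots> \<le> outer (A \<inter> K)" using outer_Un[of "A \<inter> K" "- K"] outer_compl_K by simp
  finally show "outer A \<le> outer (A \<inter> K)" .
qed auto

lemma outer_K: "outer K = mass"
proof -
  have "below UNIV (\<lambda>_. 1)" by (auto simp: below_def intro: continuous_intros)
  then have "content UNIV = mass" using I_le_content content_le_mass by (metis antisym)
  then show ?thesis using outer_Int_K[of UNIV] by (simp add: outer_open)
qed

lemma supported_by_riesz_measure: "supported_by riesz_measure K"
  using outer_compl_K K_borel
  by (auto simp: supported_by_def null_sets_def emeasure_riesz_measure Compl_eq_Diff_UNIV)

text \<open>Outer regularity is built into \<open>outer\<close>, and complements turn it into inner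
  regularity: if an open \<open>U\<close> containing \<open>- B\<close> exceeds it by little, then
  \<open>K - U\<close> is a compact subset of \<open>B\<close> that misses little of it.\<close>

lemma radon_measure_riesz_measure: "radon_measure riesz_measure"
  unfolding radon_measure_def
proof (intro conjI allI ballI)
  show "\<exists>U. open U \<and> x \<in> U \<and> emeasure riesz_measure U < \<infinity>" for x
    by (rule exI[of _ UNIV]) (simp add: emeasure_riesz_measure)
next
  interpret finite_measure riesz_measure by (rule finite_measure_riesz_measure)
  fix B :: "'a set" assume B: "B \<in> sets borel"
  show "emeasure riesz_measure B = (SUP C\<in>{C. compact C \<and> C \<subseteq> B}. emeasure riesz_measure C)"
  proof (rule antisym[OF ennreal_le_epsilon SUP_least])
    fix e :: real assume e: "0 < e"
    obtain U where U: "open U" "- B \<subseteq> U" "content U < outer (- B) + e"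
      using outer_approx[OF e] .
    have "outer U = outer (- B) + outer (U \<inter> B)"
    proof -
      have "measure riesz_measure (- B \<union> U \<inter> B) = measure riesz_measure (- B) + measure riesz_measure (U \<inter> B)"
        using B U(1) by (intro finite_measure_Union) auto
      moreover have "- B \<union> U \<inter> B = U" using U(2) by auto
      ultimately show ?thesis using B U(1) by (simp add: measure_riesz_measure)
    qed
    then have small: "outer (U \<inter> B) < e" using U by (simp add: outer_open)
    have C: "compact (K - U)" "K - U \<subseteq> B" using U compact_K by (auto intro: compact_diff)
    have "outer B = outer (B \<inter> K)" by (simp add: outer_Int_K)
    also have "\<dots> \<le> outer ((K - U) \<union> (U \<inter> B))" by (rule outer_mono) auto
    also have "\<dots> \<le> outer (K - U) + e" using outer_Un[of "K - U" "U \<inter> B"] small by linarith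
    finally have "ennreal (outer B) \<le> ennreal (outer (K - U)) + ennreal e"
      using e by (simp flip: ennreal_plus)
    moreover have "ennreal (outer (K - U)) \<le> (SUP C\<in>{C. compact C \<and> C \<subseteq> B}. emeasure riesz_measure C)"
      by (rule SUP_upper2[of "K - U"]) (use C in \<open>auto simp: emeasure_riesz_measure borel_compact\<close>)
    ultimately show "emeasure riesz_measure B \<le> (SUP C\<in>{C. compact C \<and> C \<subseteq> B}. emeasure riesz_measure C) + ennreal e"
      using B by (auto simp: emeasure_riesz_measure intro: order.trans add_right_mono)
  next
    fix C assume "C \<in> {C. compact C \<and> C \<subseteq> B}"
    then show "emeasure riesz_measure C \<le> emeasure riesz_measure B"
      using B by (intro emeasure_mono) auto
  qed
qed simp

section \<open>Integration recovers the functional\<close>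

sublocale riesz: compact_radon K riesz_measure
  by unfold_locales (rule compact_K radon_measure_riesz_measure supported_by_riesz_measure)+

text \<open>For the slices \<open>g k\<close> of \<open>f\<close>, the function
  \<open>n * g k\<close> competes in the content of \<open>U k\<close>, which bounds
  \<open>I (g k)\<close> by \<open>1 / n\<close> times the measure of \<open>A k\<close>. The step
  function built from the sets \<open>A k\<close> exceeds \<open>f\<close> by at most
  \<open>1 / n\<close> on \<open>K\<close>. A one-sided estimate is enough, since it is later
  applied to \<open>- f\<close>.\<close>

lemma I_le_integral_unit:
  assumes f: "continuous_on K f" and unit: "\<And>x. x \<in> K \<Longrightarrow> 0 \<le> f x \<and> f x \<le> 1"
  shows "I f \<le> (\<integral>x. indicator K x * f x \<partial>riesz_measure)"
proof (rule field_le_epsilon)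
  fix e :: real assume e: "0 < e"
  obtain n :: nat where n: "0 < n" "mass / n \<le> e"
  proof -
    obtain n :: nat where "mass / e < n" using reals_Archimedean2 by blast
    then have "mass / Suc n \<le> e" using e by (simp add: field_simps)
    then show ?thesis using that by blast
  qed
  define A where "A k = {x \<in> K. real k / real n < f x}" for k
  define g where "g k x = min (max (f x - real k / real n) 0) (1 / real n)" for k x
  have g: "continuous_on K (g k)" for k
    unfolding g_def by (intro continuous_intros f)
  \<comment> \<open>\<open>A k\<close> is open only relative to \<open>K\<close>; \<open>U k\<close>
    is an open set of the whole space with the same trace, hence with the same outer
    measure.\<close>
  have "\<exists>U. open U \<and> U \<inter> K = A k" for k
    using f[unfolded continuous_on_open_invariant, rule_format, of "{real k / real n<..}"]
    by (auto simp: A_def vimage_def Int_def conj_commute)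
  then obtain U where U: "\<And>k. open (U k)" "\<And>k. U k \<inter> K = A k" by metis
  have A: "A k \<in> sets borel" for k
    using U[of k] K_borel by (metis borel_open sets.Int)
  have "I (g k) \<le> (1 / real n) * measure riesz_measure (A k)" for k
  proof -
    have "below (U k) (\<lambda>x. real n * g k x)"
      unfolding below_def
    proof (intro conjI ballI impI continuous_on_mult continuous_on_const g)
      fix x assume x: "x \<in> K"
      have "g k x \<le> 1 / real n" by (simp add: g_def)
      then show "real n * g k x \<le> 1" using n by (simp add: field_simps)
      show "0 \<le> real n * g k x" using n by (simp add: g_def)
      assume "x \<notin> U k"
      then have "x \<notin> A k" using U(2)[of k] by auto
      then show "real n * g k x = 0" using x by (simp add: A_def g_def)
    qed
    then have "I (\<lambda>x. real n * g k x) \<le> content (U k)" by (rule I_le_content)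
    also have "\<dots> = measure riesz_measure (A k)"
      using U[of k] A by (metis outer_open outer_Int_K measure_riesz_measure)
    finally show ?thesis using I_cmult[OF g, of "real n" k] n by (simp add: field_simps)
  qed
  then have "(\<Sum>k<n. I (g k)) \<le> (\<Sum>k<n. (1 / real n) * measure riesz_measure (A k))"
    by (rule sum_mono)
  moreover have "I f \<le> I (\<lambda>x. \<Sum>k<n. g k x)"
  proof (rule I_mono[OF f])
    show "continuous_on K (\<lambda>x. \<Sum>k<n. g k x)" by (intro continuous_on_sum g)
    show "f x \<le> (\<Sum>k<n. g k x)" if "x \<in> K" for x
      using sum_slices_eq[OF n(1), of "f x" n] unit[OF that] n by (simp add: g_def)
  qed
  moreover have "I (\<lambda>x. \<Sum>k<n. g k x) = (\<Sum>k<n. I (g k))" by (rule I_sum) (auto intro: g)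
  moreover have "(\<Sum>k<n. (1 / real n) * measure riesz_measure (A k)) \<le>
      (\<integral>x. indicator K x * f x \<partial>riesz_measure) + mass / n"
  proof -
    have int: "integrable riesz_measure (\<lambda>x. (1 / real n) * indicat_real (A k) x)" for k
      using A by (intro integrable_mult_right integrable_real_indicator) (auto simp: emeasure_riesz_measure)
    have "(\<Sum>k<n. (1 / real n) * measure riesz_measure (A k)) =
        (\<integral>x. (\<Sum>k<n. (1 / real n) * indicat_real (A k) x) \<partial>riesz_measure)"
      using int A by (subst Bochner_Integration.integral_sum) auto
    also have "\<dots> \<le> (\<integral>x. indicator K x * f x + (1 / real n) * indicat_real K x \<partial>riesz_measure)"
    proof (rule integral_mono)
      show "integrable riesz_measure (\<lambda>x. \<Sum>k<n. (1 / real n) * indicat_real (A k) x)"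
        by (intro Bochner_Integration.integrable_sum int)
      show "integrable riesz_measure (\<lambda>x. indicator K x * f x + (1 / real n) * indicat_real K x)"
        using K_borel riesz.integrable_indicator_mult[OF f]
        by (intro Bochner_Integration.integrable_add integrable_mult_right integrable_real_indicator)
          (auto simp: emeasure_riesz_measure)
      show "(\<Sum>k<n. (1 / real n) * indicat_real (A k) x) \<le> indicator K x * f x + (1 / real n) * indicat_real K x"
        for x
      proof (cases "x \<in> K")
        case True
        then have "indicat_real (A k) x = of_bool (real k / real n < f x)" for k
          by (simp add: A_def indicator_def)
        then show ?thesis using sum_slices_le[OF n(1), of "f x" n] unit[OF True] True by simp
      next
        case False
        then have "indicat_real (A k) x = 0" for k by (simp add: A_def)
        then show ?thesis using False by simp
      qed
    qed
    also have "\<dots> = (\<integral>x. indicator K x * f x \<partial>riesz_measure) + (1 / real n) * mass"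
      using riesz.integrable_indicator_mult[OF f] K_borel
      by (subst Bochner_Integration.integral_add)
        (auto simp: emeasure_riesz_measure measure_riesz_measure outer_K)
    finally show ?thesis by simp
  qed
  ultimately show "I f \<le> (\<integral>x. indicator K x * f x \<partial>riesz_measure) + e"
    using n(2) by linarith
qed

text \<open>An affine change of values moves \<open>f\<close> into the unit interval. Both sides
  react alike to the added constant because \<open>outer_K\<close> equates the measure of
  \<open>K\<close> with \<open>mass\<close>.\<close>

lemma I_le_integral:
  assumes f: "continuous_on K f"
  shows "I f \<le> (\<integral>x. indicator K x * f x \<partial>riesz_measure)"
proof -
  have "compact (f ` K)" by (rule compact_continuous_image[OF f compact_K])
  then obtain b where b: "\<And>x. x \<in> K \<Longrightarrow> \<bar>f x\<bar> \<le> b" "b > 0"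
    using compact_imp_bounded bounded_pos by (metis image_eqI real_norm_def)
  define g where "g x = (1 / (2 * b)) * (f x + b)" for x
  have fb: "continuous_on K (\<lambda>x. f x + b)" by (intro continuous_intros f)
  have "I g \<le> (\<integral>x. indicator K x * g x \<partial>riesz_measure)"
  proof (rule I_le_integral_unit)
    show "continuous_on K g" unfolding g_def by (intro continuous_on_mult continuous_on_const fb)
    show "0 \<le> g x \<and> g x \<le> 1" if "x \<in> K" for x
      using b(1)[OF that] b(2) by (auto simp: g_def field_simps)
  qed
  moreover have "I g = (1 / (2 * b)) * (I f + b * mass)"
    using I_cmult[OF fb, of "1 / (2 * b)"] I_add[OF f continuous_on_const, of b] I_const[of b]
    by (simp add: g_def[abs_def])
  moreover have "(\<integral>x. indicator K x * g x \<partial>riesz_measure) =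
      (1 / (2 * b)) * ((\<integral>x. indicator K x * f x \<partial>riesz_measure) + b * mass)"
  proof -
    have "(\<integral>x. indicator K x * g x \<partial>riesz_measure) =
        (\<integral>x. (1 / (2 * b)) * (indicator K x * f x + b * indicat_real K x) \<partial>riesz_measure)"
      by (rule Bochner_Integration.integral_cong) (auto simp: g_def indicator_def)
    also have "\<dots> = (1 / (2 * b)) * (\<integral>x. indicator K x * f x + b * indicat_real K x \<partial>riesz_measure)"
      by (rule integral_mult_right_zero)
    also have "(\<integral>x. indicator K x * f x + b * indicat_real K x \<partial>riesz_measure) =
        (\<integral>x. indicator K x * f x \<partial>riesz_measure) + b * mass"
      using riesz.integrable_indicator_mult[OF f] K_borel
      by (subst Bochner_Integration.integral_add)
        (auto simp: emeasure_riesz_measure measure_riesz_measure outer_K)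
    finally show ?thesis .
  qed
  ultimately show ?thesis using b(2) by (simp add: divide_le_cancel)
qed

lemma integral_riesz_measure:
  assumes f: "continuous_on K f"
  shows "(\<integral>x. indicator K x * f x \<partial>riesz_measure) = I f"
proof (rule antisym)
  have "I (\<lambda>x. (- 1) * f x) \<le> (\<integral>x. indicator K x * ((- 1) * f x) \<partial>riesz_measure)"
    by (rule I_le_integral) (intro continuous_intros f)
  then show "(\<integral>x. indicator K x * f x \<partial>riesz_measure) \<le> I f"
    using I_cmult[OF f, of "- 1"] by simp
qed (rule I_le_integral[OF f])

end


section \<open>The dual of a vector space and its unit ball\<close>

lemma open_dual_eval: "open T \<Longrightarrow> open {\<phi>. dual_apply \<phi> v \<in> T}"
  unfolding open_dual_def by (rule generate_topology.Basis) blast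

lemma continuous_on_dual_apply: "continuous_on A (\<lambda>\<phi>. dual_apply \<phi> v)"
proof -
  have "continuous_on UNIV (\<lambda>\<phi>. dual_apply \<phi> v)"
    using open_dual_eval[of _ v] by (simp add: continuous_on_open_vimage vimage_def)
  then show ?thesis using continuous_on_subset by blast
qed

lemma dual_eqI: "(\<And>v. dual_apply \<phi> v = dual_apply \<psi> v) \<Longrightarrow> \<phi> = \<psi>"
  by (metis dual_apply_inject ext)

instance dual :: (real_vector) t2_space
proof
  fix \<phi> \<psi> :: "'a dual"
  assume "\<phi> \<noteq> \<psi>"
  then obtain v where "dual_apply \<phi> v \<noteq> dual_apply \<psi> v" using dual_eqI by blast
  from hausdorff[OF this]
  obtain S T where "open S" "open T" "dual_apply \<phi> v \<in> S" "dual_apply \<psi> v \<in> T" "S \<inter> T = {}"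
    by (elim exE conjE)
  then show "\<exists>U V. open U \<and> open V \<and> \<phi> \<in> U \<and> \<psi> \<in> V \<and> U \<inter> V = {}"
    by (intro exI[of _ "{\<phi>. dual_apply \<phi> v \<in> S}"] exI[of _ "{\<phi>. dual_apply \<phi> v \<in> T}"])
      (auto simp: open_dual_eval)
qed

lemma linear_dual_apply: "linear (dual_apply \<phi>)"
  using dual_apply[of \<phi>] by simp

lemma dual_ext_hom: "real_algebra_hom (dual_ext \<phi>)"
  and dual_ext_embed: "dual_ext \<phi> (sym_embed v) = dual_apply \<phi> v"
  using theI'[OF symalg_universal[OF linear_dual_apply[of \<phi>]]] unfolding dual_ext_def by blast+

lemma dual_ext_eq:
  assumes "real_algebra_hom h" "\<And>v. h (sym_embed v) = dual_apply \<phi> v"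
  shows "dual_ext \<phi> = h"
  using symalg_universal[OF linear_dual_apply[of \<phi>]] assms dual_ext_hom dual_ext_embed by metis

section \<open>Elements of the symmetric algebra as functions on the dual\<close>

lemma sym_hat_add: "sym_hat (f + g) \<phi> = sym_hat f \<phi> + sym_hat g \<phi>"
  and sym_hat_diff: "sym_hat (f - g) \<phi> = sym_hat f \<phi> - sym_hat g \<phi>"
  and sym_hat_scaleR: "sym_hat (c *\<^sub>R f) \<phi> = c * sym_hat f \<phi>"
  and sym_hat_mult: "sym_hat (f * g) \<phi> = sym_hat f \<phi> * sym_hat g \<phi>"
  and sym_hat_zero: "sym_hat 0 \<phi> = 0"
  and sym_hat_one: "sym_hat 1 \<phi> = 1"
  using dual_ext_hom[of \<phi>]
  by (simp_all add: sym_hat_def real_algebra_hom_def linear_add linear_diff linear_cmul linear_0)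

lemma sym_hat_embed: "sym_hat (sym_embed v) \<phi> = dual_apply \<phi> v"
  by (simp add: sym_hat_def dual_ext_embed)

lemma sym_hat_power: "sym_hat (f ^ n) \<phi> = sym_hat f \<phi> ^ n"
  by (induction n) (simp_all add: sym_hat_one sym_hat_mult)

lemma sym_hat_sum: "sym_hat (\<Sum>i\<in>A. f i) \<phi> = (\<Sum>i\<in>A. sym_hat (f i) \<phi>)"
  by (induction A rule: infinite_finite_induct) (simp_all add: sym_hat_zero sym_hat_add)

lemma sym_hat_prod: "sym_hat (\<Prod>i\<in>A. f i) \<phi> = (\<Prod>i\<in>A. sym_hat (f i) \<phi>)"
  by (induction A rule: infinite_finite_induct) (simp_all add: sym_hat_one sym_hat_mult)

lemma sym_hat_of_real: "sym_hat (of_real r) \<phi> = r"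
  by (simp add: of_real_def sym_hat_scaleR sym_hat_one)

lemma continuous_on_sym_hat: "continuous_on A (sym_hat f)"
proof (induction f rule: symalg_induct)
  case zero
  then show ?case by (simp add: sym_hat_zero[abs_def] continuous_on_const)
next
  case (add m c f)
  have "continuous_on A (sym_hat (\<Prod>v\<in>#m. sym_embed v))"
  proof (induction m)
    case empty
    then show ?case by (simp add: sym_hat_one[abs_def] continuous_on_const)
  next
    case (add v m)
    then show ?case
      by (simp add: sym_hat_mult[abs_def] sym_hat_embed continuous_on_mult continuous_on_dual_apply)
  qed
  then have "continuous_on A (\<lambda>\<phi>. c * sym_hat (\<Prod>v\<in>#m. sym_embed v) \<phi> + sym_hat f \<phi>)"
    using add by (intro continuous_intros)
  then show ?case by (simp add: sym_hat_add[abs_def] sym_hat_scaleR)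
qed

text \<open>The infimum in \<open>dual_seminorm\<close> provides only constants
  \<open>C < 1 + \<delta>\<close>, so the bound by \<open>\<rho> w\<close> is reached by letting the
  error tend to 0 for each fixed \<open>w\<close>.\<close>

lemma dual_unit_ball_iff:
  assumes "seminorm \<rho>"
  shows "\<phi> \<in> dual_unit_ball \<rho> \<longleftrightarrow> (\<forall>w. \<bar>dual_apply \<phi> w\<bar> \<le> \<rho> w)"
proof
  assume \<phi>: "\<phi> \<in> dual_unit_ball \<rho>"
  show "\<forall>w. \<bar>dual_apply \<phi> w\<bar> \<le> \<rho> w"
  proof (rule allI, rule field_le_epsilon)
    fix w and e :: real assume e: "0 < e"
    have \<rho>: "0 \<le> \<rho> w" using assms by (simp add: seminorm_def)
    define \<delta> where "\<delta> = e / (\<rho> w + 1)"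
    have \<delta>: "0 < \<delta>" "\<delta> * \<rho> w \<le> e" using e \<rho> by (simp_all add: \<delta>_def field_simps)
    have "dual_seminorm \<rho> \<phi> \<le> 1" using \<phi> by (simp add: dual_unit_ball_def)
    also have "(1 :: ennreal) < ennreal (1 + \<delta>)" using ennreal_lessI[of "1 + \<delta>" 1] \<delta>(1) by simp
    finally obtain c where c: "c \<in> {ennreal C | C. 0 \<le> C \<and> (\<forall>w. \<bar>dual_apply \<phi> w\<bar> \<le> C * \<rho> w)}"
      "c < ennreal (1 + \<delta>)"
      unfolding dual_seminorm_def Inf_less_iff by (elim bexE)
    from c(1) obtain C where C: "c = ennreal C" "0 \<le> C" "\<forall>w. \<bar>dual_apply \<phi> w\<bar> \<le> C * \<rho> w"
      by (elim CollectE exE conjE)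
    have C1: "C < 1 + \<delta>" using c(2) C(1,2) by (simp add: ennreal_less_iff)
    have "\<bar>dual_apply \<phi> w\<bar> \<le> C * \<rho> w" using C(3) by (rule spec)
    also have "\<dots> \<le> (1 + \<delta>) * \<rho> w" using C1 \<rho> by (intro mult_right_mono) simp_all
    also have "\<dots> \<le> \<rho> w + e" using \<delta>(2) by (simp add: algebra_simps)
    finally show "\<bar>dual_apply \<phi> w\<bar> \<le> \<rho> w + e" .
  qed
next
  assume "\<forall>w. \<bar>dual_apply \<phi> w\<bar> \<le> \<rho> w"
  then have "dual_seminorm \<rho> \<phi> \<le> ennreal 1"
    unfolding dual_seminorm_def by (intro Inf_lower CollectI exI[of _ 1]) simp
  then show "\<phi> \<in> dual_unit_ball \<rho>" by (simp add: dual_unit_ball_def)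
qed

text \<open>Carries compactness from the product topology on functions, where Tychonoff's theorem is
  available, to the type \<open>dual\<close>.\<close>

lemma continuous_on_Abs_dual: "continuous_on {l. linear l} Abs_dual"
proof (rule continuous_on_generate_topology[OF open_dual_def])
  fix B :: "'a dual set"
  assume "B \<in> {{\<phi>. dual_apply \<phi> v \<in> T} | v T. open T}"
  then obtain v T where B: "B = {\<phi>. dual_apply \<phi> v \<in> T}" "open T" by blast
  have "open {l :: 'a \<Rightarrow> real. l v \<in> T}"
    using open_vimage[OF B(2) continuous_on_product_coordinates] by (simp add: vimage_def)
  then show "\<exists>C. open C \<and> C \<inter> {l. linear l} = Abs_dual -` B \<inter> {l. linear l}"
    by (intro exI[of _ "{l. l v \<in> T}"] conjI) (auto simp: B Abs_dual_inverse)
qed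

text \<open>The Banach-Alaoglu theorem for a seminorm: the ball is a continuous image of a closed,
  pointwise bounded set of functions.\<close>

lemma compact_dual_unit_ball:
  assumes "seminorm \<rho>"
  shows "compact (dual_unit_ball \<rho>)"
proof -
  let ?S = "{l. linear l \<and> (\<forall>w. \<bar>l w\<bar> \<le> \<rho> w)}"
  have "closed ?S"
    unfolding linear_iff
    by (intro closed_Collect_conj closed_Collect_all closed_Collect_eq closed_Collect_le
        continuous_intros continuous_on_product_coordinates)
  then have "compact ?S" by (rule compact_bounded_functions) blast
  then have "compact (Abs_dual ` ?S)"
    by (intro compact_continuous_image continuous_on_subset[OF continuous_on_Abs_dual]) auto
  moreover have "Abs_dual ` ?S = dual_unit_ball \<rho>"
  proof (intro antisym subsetI)
    fix \<phi> assume "\<phi> \<in> dual_unit_ball \<rho>"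
    then have "dual_apply \<phi> \<in> ?S" by (simp add: dual_unit_ball_iff[OF assms] linear_dual_apply)
    then show "\<phi> \<in> Abs_dual ` ?S" by (rule image_eqI[rotated]) (simp add: dual_apply_inverse)
  qed (auto simp: dual_unit_ball_iff[OF assms] Abs_dual_inverse)
  ultimately show ?thesis by simp
qed


section \<open>The projective extension\<close>

text \<open>
  The infimum over all representations is visibly submultiplicative, which spares the corresponding
  argument for \<open>proj_ext\<close>; continuity of \<open>L\<close> only enters through its values on monomials.
\<close>

inductive tensor_cost :: "('v::real_vector \<Rightarrow> real) \<Rightarrow> 'v symalg \<Rightarrow> real \<Rightarrow> bool" for \<rho>
  where
    zero: "tensor_cost \<rho> 0 0"
  | add: "tensor_cost \<rho> f r \<Longrightarrow>
      tensor_cost \<rho> (c *\<^sub>R (\<Prod>v\<in>#m. sym_embed v) + f) (\<bar>c\<bar> * (\<Prod>v\<in>#m. \<rho> v) + r)"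

definition tensor_norm :: "('v::real_vector \<Rightarrow> real) \<Rightarrow> 'v symalg \<Rightarrow> real"
  where "tensor_norm \<rho> f = Inf {r. tensor_cost \<rho> f r}"

lemma tensor_cost_exists: "\<exists>r. tensor_cost \<rho> f r"
proof (induction f rule: symalg_induct)
  case zero
  then show ?case using tensor_cost.zero by blast
next
  case (add m c f)
  then show ?case using tensor_cost.add by blast
qed

lemma tensor_cost_monom: "tensor_cost \<rho> (c *\<^sub>R (\<Prod>v\<in>#m. sym_embed v)) (\<bar>c\<bar> * (\<Prod>v\<in>#m. \<rho> v))"
  using tensor_cost.add[OF tensor_cost.zero, of \<rho> c m] by simp

lemma tensor_cost_add:
  assumes "tensor_cost \<rho> f r" "tensor_cost \<rho> g s"
  shows "tensor_cost \<rho> (f + g) (r + s)"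
  using assms(1)
proof induction
  case zero
  then show ?case using assms(2) by simp
next
  case (add f r c m)
  then show ?case using tensor_cost.add[OF add.IH, of c m] by (simp add: add.assoc)
qed

lemma tensor_cost_monom_mult:
  assumes "tensor_cost \<rho> f r"
  shows "tensor_cost \<rho> (c *\<^sub>R (\<Prod>v\<in>#m. sym_embed v) * f) (\<bar>c\<bar> * (\<Prod>v\<in>#m. \<rho> v) * r)"
  using assms
proof induction
  case zero
  then show ?case by (simp add: tensor_cost.zero)
next
  case (add f r d n)
  have "tensor_cost \<rho> ((c * d) *\<^sub>R (\<Prod>v\<in>#m + n. sym_embed v) + c *\<^sub>R (\<Prod>v\<in>#m. sym_embed v) * f)
      (\<bar>c * d\<bar> * (\<Prod>v\<in>#m + n. \<rho> v) + \<bar>c\<bar> * (\<Prod>v\<in>#m. \<rho> v) * r)"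
    by (rule tensor_cost.add[OF add.IH])
  then show ?case by (simp add: abs_mult distrib_left mult_ac)
qed

lemma tensor_cost_mult:
  assumes "tensor_cost \<rho> f r" "tensor_cost \<rho> g s"
  shows "tensor_cost \<rho> (f * g) (r * s)"
  using assms(1)
proof induction
  case zero
  then show ?case by (simp add: tensor_cost.zero)
next
  case (add f r c m)
  then show ?case
    using tensor_cost_add[OF tensor_cost_monom_mult[OF assms(2), of c m] add.IH]
    by (simp add: distrib_right)
qed

lemma tensor_cost_scale:
  assumes "tensor_cost \<rho> f r"
  shows "tensor_cost \<rho> (c *\<^sub>R f) (\<bar>c\<bar> * r)"
  using tensor_cost_monom_mult[OF assms, of c "{#}"] by simp

text \<open>A bound on monomials passes to every expression of \<open>f\<close> as a sum of
  monomials, and thereby to \<open>tensor_norm\<close>. Its one-sided form serves for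
  \<open>L\<close> and for \<open>- L\<close>.\<close>

lemma tensor_cost_linear_bound:
  assumes "linear L" "\<And>c m. L (c *\<^sub>R (\<Prod>v\<in>#m. sym_embed v)) \<le> C * (\<bar>c\<bar> * (\<Prod>v\<in>#m. \<rho> v))"
    and "tensor_cost \<rho> f r"
  shows "L f \<le> C * r"
  using assms(3)
proof induction
  case zero
  then show ?case using assms(1) by (simp add: linear_0)
next
  case (add f r c m)
  then show ?case using assms(2)[of c m] by (simp add: linear_add[OF assms(1)] distrib_left)
qed

lemma seminorm_nonneg: "seminorm \<rho> \<Longrightarrow> 0 \<le> \<rho> x"
  and seminorm_scale: "seminorm \<rho> \<Longrightarrow> \<rho> (c *\<^sub>R x) = \<bar>c\<bar> * \<rho> x"
  by (auto simp: seminorm_def)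

lemma prod_mset_nonneg:
  fixes \<rho> :: "'v \<Rightarrow> real"
  assumes "\<And>v. 0 \<le> \<rho> v"
  shows "0 \<le> (\<Prod>v\<in>#m. \<rho> v)"
  by (induction m) (simp_all add: assms)

lemma tensor_cost_nonneg:
  assumes "seminorm \<rho>" "tensor_cost \<rho> f r"
  shows "0 \<le> r"
  using assms(2)
  by induction (simp_all add: prod_mset_nonneg seminorm_nonneg[OF assms(1)])

lemma tensor_norm_le:
  assumes "seminorm \<rho>" "tensor_cost \<rho> f r"
  shows "tensor_norm \<rho> f \<le> r"
  unfolding tensor_norm_def
  by (rule cInf_lower) (use assms tensor_cost_nonneg in \<open>auto intro!: bdd_belowI[of _ 0]\<close>)

lemma le_tensor_norm:
  assumes "\<And>r. tensor_cost \<rho> f r \<Longrightarrow> c \<le> r"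
  shows "c \<le> tensor_norm \<rho> f"
  unfolding tensor_norm_def
  by (rule cInf_greatest) (use assms tensor_cost_exists in auto)

lemma tensor_norm_approx:
  assumes "0 < e"
  obtains r where "tensor_cost \<rho> f r" "r < tensor_norm \<rho> f + e"
proof -
  have "\<not> (\<forall>r. tensor_cost \<rho> f r \<longrightarrow> tensor_norm \<rho> f + e \<le> r)"
    using le_tensor_norm[of \<rho> f "tensor_norm \<rho> f + e"] assms by auto
  then show ?thesis using that by (meson not_le)
qed

lemma tensor_norm_nonneg: "seminorm \<rho> \<Longrightarrow> 0 \<le> tensor_norm \<rho> f"
  by (rule le_tensor_norm) (rule tensor_cost_nonneg)

lemma tensor_norm_scale_le:
  assumes "seminorm \<rho>"
  shows "tensor_norm \<rho> (c *\<^sub>R f) \<le> \<bar>c\<bar> * tensor_norm \<rho> f"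
proof (cases "c = 0")
  case True
  then show ?thesis using tensor_norm_le[OF assms tensor_cost.zero] by simp
next
  case False
  have "tensor_norm \<rho> (c *\<^sub>R f) / \<bar>c\<bar> \<le> tensor_norm \<rho> f"
  proof (rule le_tensor_norm)
    fix r assume "tensor_cost \<rho> f r"
    then have "tensor_norm \<rho> (c *\<^sub>R f) \<le> \<bar>c\<bar> * r"
      by (intro tensor_norm_le[OF assms] tensor_cost_scale)
    then show "tensor_norm \<rho> (c *\<^sub>R f) / \<bar>c\<bar> \<le> r" using False by (simp add: field_simps)
  qed
  then show ?thesis using False by (simp add: field_simps)
qed

lemma submult_seminorm_tensor_norm:
  assumes "seminorm \<rho>"
  shows "submult_seminorm (tensor_norm \<rho>)"
proof
  show "seminorm (tensor_norm \<rho>)"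
    unfolding seminorm_def
  proof (intro conjI allI)
    fix f g :: "'a symalg" and c :: real
    show "0 \<le> tensor_norm \<rho> f" by (rule tensor_norm_nonneg[OF assms])
    show "tensor_norm \<rho> (f + g) \<le> tensor_norm \<rho> f + tensor_norm \<rho> g"
    proof (rule field_le_epsilon)
      fix e :: real assume "0 < e"
      then have e: "0 < e / 2" by simp
      obtain r where r: "tensor_cost \<rho> f r" "r < tensor_norm \<rho> f + e / 2"
        by (rule tensor_norm_approx[OF e])
      obtain s where s: "tensor_cost \<rho> g s" "s < tensor_norm \<rho> g + e / 2"
        by (rule tensor_norm_approx[OF e])
      show "tensor_norm \<rho> (f + g) \<le> tensor_norm \<rho> f + tensor_norm \<rho> g + e"
        using tensor_norm_le[OF assms tensor_cost_add[OF r(1) s(1)]] r(2) s(2) by linarith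
    qed
    show "tensor_norm \<rho> (c *\<^sub>R f) = \<bar>c\<bar> * tensor_norm \<rho> f"
    proof (cases "c = 0")
      case True
      then show ?thesis
        using tensor_norm_le[OF assms tensor_cost.zero] tensor_norm_nonneg[OF assms, of 0] by simp
    next
      case False
      then have "tensor_norm \<rho> f \<le> \<bar>inverse c\<bar> * tensor_norm \<rho> (c *\<^sub>R f)"
        using tensor_norm_scale_le[OF assms, of "inverse c" "c *\<^sub>R f"] by simp
      then have "\<bar>c\<bar> * tensor_norm \<rho> f \<le> tensor_norm \<rho> (c *\<^sub>R f)"
        using False by (simp add: field_simps)
      then show ?thesis using tensor_norm_scale_le[OF assms, of c f] by simp
    qed
  qed
next
  fix f g :: "'a symalg"
  show "tensor_norm \<rho> (f * g) \<le> tensor_norm \<rho> f * tensor_norm \<rho> g"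
  proof -
    \<comment> \<open>The infimum is taken over the costs of \<open>g\<close> first and over those
      of \<open>f\<close> afterwards; each time a vanishing factor is treated apart, because the
      argument divides by it.\<close>
    have 1: "tensor_norm \<rho> (f * g) \<le> r * s" if "tensor_cost \<rho> f r" "tensor_cost \<rho> g s" for r s
      by (rule tensor_norm_le[OF assms tensor_cost_mult[OF that]])
    have 2: "tensor_norm \<rho> (f * g) \<le> r * tensor_norm \<rho> g" if r: "tensor_cost \<rho> f r" for r
    proof (cases "r = 0")
      case True
      then show ?thesis using 1[OF r] tensor_cost_exists[of \<rho> g] by auto
    next
      case False
      then have pos: "0 < r" using tensor_cost_nonneg[OF assms r] by simp
      then have "tensor_norm \<rho> (f * g) / r \<le> tensor_norm \<rho> g"
        using 1[OF r] by (intro le_tensor_norm) (simp add: field_simps)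
      then show ?thesis using pos by (simp add: field_simps)
    qed
    show ?thesis
    proof (cases "tensor_norm \<rho> g = 0")
      case True
      then show ?thesis using 2 tensor_cost_exists[of \<rho> f] by auto
    next
      case False
      then have pos: "0 < tensor_norm \<rho> g" using tensor_norm_nonneg[OF assms, of g] by simp
      then have "tensor_norm \<rho> (f * g) / tensor_norm \<rho> g \<le> tensor_norm \<rho> f"
        using 2 by (intro le_tensor_norm) (simp add: field_simps)
      then show ?thesis using pos by (simp add: field_simps)
    qed
  qed
next
  show "tensor_norm \<rho> (1 :: 'a symalg) \<le> 1"
    using tensor_norm_le[OF assms tensor_cost_monom[of \<rho> 1 "{#}"]] by simp
qed

section \<open>Estimates for \<open>proj_ext\<close>\<close>

definition decomp_cost :: "('v::real_vector \<Rightarrow> real) \<Rightarrow> nat \<Rightarrow> 'v symalg \<Rightarrow> real \<Rightarrow> bool"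
  where "decomp_cost \<rho> k f r \<longleftrightarrow> (\<exists>(n::nat) F. 1 \<le> n \<and>
    f = (\<Sum>i<n. \<Prod>j<k. sym_embed (F i j)) \<and> r = (\<Sum>i<n. \<Prod>j<k. \<rho> (F i j)))"

lemma proj_ext_part_eq_Inf: "0 < k \<Longrightarrow> proj_ext_part \<rho> k f = Inf {r. decomp_cost \<rho> k f r}"
  unfolding proj_ext_part_def decomp_cost_def by (auto intro!: arg_cong[of _ _ Inf])

lemma proj_ext_part_0: "proj_ext_part \<rho> 0 (of_real r) = \<bar>r\<bar>"
  by (simp add: proj_ext_part_def)

lemma sum_lessThan_add:
  fixes f :: "nat \<Rightarrow> 'b::comm_monoid_add"
  shows "sum f {..<n + m} = sum f {..<n} + (\<Sum>i<m. f (n + i))"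
  by (induction m) (simp_all add: add.assoc)

lemma decomp_cost_add:
  assumes "decomp_cost \<rho> k f r" "decomp_cost \<rho> k g s"
  shows "decomp_cost \<rho> k (f + g) (r + s)"
proof -
  obtain n :: nat and F :: "nat \<Rightarrow> nat \<Rightarrow> 'a" where F: "1 \<le> n" "f = (\<Sum>i<n. \<Prod>j<k. sym_embed (F i j))" "r = (\<Sum>i<n. \<Prod>j<k. \<rho> (F i j))"
    using assms(1) unfolding decomp_cost_def by blast
  obtain m :: nat and G :: "nat \<Rightarrow> nat \<Rightarrow> 'a" where G: "g = (\<Sum>i<m. \<Prod>j<k. sym_embed (G i j))" "s = (\<Sum>i<m. \<Prod>j<k. \<rho> (G i j))"
    using assms(2) unfolding decomp_cost_def by blast
  define H where "H i = (if i < n then F i else G (i - n))" for i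
  have "f + g = (\<Sum>i<n + m. \<Prod>j<k. sym_embed (H i j))" "r + s = (\<Sum>i<n + m. \<Prod>j<k. \<rho> (H i j))"
    unfolding sum_lessThan_add F G by (simp_all add: H_def)
  then show ?thesis
    using F(1) unfolding decomp_cost_def by (intro exI[of _ "n + m"] exI[of _ H]) simp
qed

lemma decomp_cost_single:
  assumes "seminorm \<rho>" "0 < k"
  shows "decomp_cost \<rho> k (c *\<^sub>R (\<Prod>j<k. sym_embed (v j))) (\<bar>c\<bar> * (\<Prod>j<k. \<rho> (v j)))"
proof -
  \<comment> \<open>\<open>decomp_cost\<close> allows no scalar coefficients, so \<open>c\<close> is
    absorbed in the first factor; this is where \<open>0 < k\<close> enters.\<close>
  define w where "w j = (if j = 0 then c *\<^sub>R v j else v j)" for j :: nat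
  obtain k' where k: "k = Suc k'" using assms(2) gr0_conv_Suc by blast
  have "c *\<^sub>R (\<Prod>j<k. sym_embed (v j)) = (\<Prod>j<k. sym_embed (w j))"
    unfolding k prod.lessThan_Suc_shift by (simp add: w_def linear_cmul[OF linear_sym_embed])
  moreover have "\<bar>c\<bar> * (\<Prod>j<k. \<rho> (v j)) = (\<Prod>j<k. \<rho> (w j))"
    unfolding k prod.lessThan_Suc_shift by (simp add: w_def seminorm_scale[OF assms(1)])
  ultimately show ?thesis
    unfolding decomp_cost_def by (intro exI[of _ 1] exI[of _ "\<lambda>_. w"]) simp
qed

lemma decomp_cost_exists:
  assumes "seminorm \<rho>" "0 < k" "f \<in> sym_homogeneous k"
  shows "\<exists>r. decomp_cost \<rho> k f r"
  using assms(3) unfolding sym_homogeneous_def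
proof (induction rule: span_induct_alt)
  case base
  \<comment> \<open>The empty sum is excluded by \<open>1 \<le> n\<close>, so 0 is represented by a
    product with coefficient 0.\<close>
  then show ?case using decomp_cost_single[OF assms(1,2), of 0] by (intro exI[of _ 0]) simp
next
  case (step c x y)
  then show ?case using decomp_cost_add decomp_cost_single[OF assms(1,2)] by blast
qed

lemma decomp_cost_nonneg:
  assumes "seminorm \<rho>" "decomp_cost \<rho> k f r"
  shows "0 \<le> r"
  using assms(2) unfolding decomp_cost_def
  by (auto intro!: sum_nonneg prod_nonneg seminorm_nonneg[OF assms(1)])

lemma proj_ext_part_le:
  assumes "seminorm \<rho>" "0 < k" "decomp_cost \<rho> k f r"
  shows "proj_ext_part \<rho> k f \<le> r"
  unfolding proj_ext_part_eq_Inf[OF assms(2)]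
  by (rule cInf_lower) (use assms decomp_cost_nonneg in \<open>auto intro!: bdd_belowI[of _ 0]\<close>)

lemma le_proj_ext_part:
  assumes "seminorm \<rho>" "0 < k" "f \<in> sym_homogeneous k" "\<And>r. decomp_cost \<rho> k f r \<Longrightarrow> c \<le> r"
  shows "c \<le> proj_ext_part \<rho> k f"
  unfolding proj_ext_part_eq_Inf[OF assms(2)]
  by (rule cInf_greatest) (use assms decomp_cost_exists[OF assms(1-3)] in auto)

lemma proj_ext_part_triangle:
  assumes \<rho>: "seminorm \<rho>" and f: "f \<in> sym_homogeneous k" and g: "g \<in> sym_homogeneous k"
  shows "proj_ext_part \<rho> k (f + g) \<le> proj_ext_part \<rho> k f + proj_ext_part \<rho> k g"
proof (cases "k = 0")
  case True
  then obtain r s where "f = of_real r" "g = of_real s" using f g by (auto simp: sym_homogeneous_0)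
  then show ?thesis
    using True proj_ext_part_0[of \<rho> "r + s"] abs_triangle_ineq[of r s] by (simp add: proj_ext_part_0)
next
  case False
  then have k: "0 < k" by simp
  have 1: "proj_ext_part \<rho> k (f + g) \<le> r + s" if "decomp_cost \<rho> k f r" "decomp_cost \<rho> k g s" for r s
    by (rule proj_ext_part_le[OF \<rho> k decomp_cost_add[OF that]])
  have 2: "proj_ext_part \<rho> k (f + g) - r \<le> proj_ext_part \<rho> k g" if "decomp_cost \<rho> k f r" for r
    by (rule le_proj_ext_part[OF \<rho> k g]) (use 1[OF that] in \<open>simp add: algebra_simps\<close>)
  have "proj_ext_part \<rho> k (f + g) - proj_ext_part \<rho> k g \<le> proj_ext_part \<rho> k f"
    by (rule le_proj_ext_part[OF \<rho> k f]) (use 2 in \<open>simp add: algebra_simps\<close>)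
  then show ?thesis by simp
qed

lemma proj_ext_part_zero:
  assumes "seminorm \<rho>"
  shows "proj_ext_part \<rho> k 0 = 0"
proof (cases "k = 0")
  case True
  then show ?thesis using proj_ext_part_0[of \<rho> 0] by simp
next
  case False
  then have k: "0 < k" by simp
  have "proj_ext_part \<rho> k 0 \<le> 0"
    using proj_ext_part_le[OF assms k decomp_cost_single[OF assms k, of 0]] by simp
  moreover have "0 \<le> proj_ext_part \<rho> k 0"
    by (rule le_proj_ext_part[OF assms k])
      (use decomp_cost_nonneg[OF assms] in \<open>auto simp: sym_homogeneous_def span_zero\<close>)
  ultimately show ?thesis by simp
qed

text \<open>The index set in \<open>proj_ext\<close> depends on \<open>f\<close>; a common finite
  index set lets the values for different elements be compared term by term.\<close>

lemma proj_ext_superset: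
  assumes "seminorm \<rho>" "finite A" "{k. sym_part k f \<noteq> 0} \<subseteq> A"
  shows "proj_ext \<rho> f = (\<Sum>k\<in>A. proj_ext_part \<rho> k (sym_part k f))"
  unfolding proj_ext_def
  by (rule sum.mono_neutral_left) (use assms proj_ext_part_zero[OF assms(1)] in auto)

lemma proj_ext_zero: "proj_ext \<rho> 0 = 0"
  by (simp add: proj_ext_def linear_0[OF linear_sym_part])

lemma proj_ext_triangle:
  assumes "seminorm \<rho>"
  shows "proj_ext \<rho> (f + g) \<le> proj_ext \<rho> f + proj_ext \<rho> g"
proof -
  define A where "A = {k. sym_part k f \<noteq> 0} \<union> {k. sym_part k g \<noteq> 0}"
  have A: "finite A" by (simp add: A_def finite_sym_part)
  have "proj_ext \<rho> (f + g) = (\<Sum>k\<in>A. proj_ext_part \<rho> k (sym_part k (f + g)))"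
    by (rule proj_ext_superset[OF assms A]) (auto simp: A_def linear_add[OF linear_sym_part])
  also have "\<dots> \<le> (\<Sum>k\<in>A. proj_ext_part \<rho> k (sym_part k f) + proj_ext_part \<rho> k (sym_part k g))"
    by (rule sum_mono) (simp add: linear_add[OF linear_sym_part] proj_ext_part_triangle[OF assms]
        sym_part_in_homogeneous)
  also have "\<dots> = proj_ext \<rho> f + proj_ext \<rho> g"
    using proj_ext_superset[OF assms A, of f] proj_ext_superset[OF assms A, of g]
    by (simp add: A_def sum.distrib)
  finally show ?thesis .
qed

lemma proj_ext_monom_le:
  assumes "seminorm \<rho>"
  shows "proj_ext \<rho> (c *\<^sub>R (\<Prod>v\<in>#m. sym_embed v)) \<le> \<bar>c\<bar> * (\<Prod>v\<in>#m. \<rho> v)"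
proof -
  obtain xs where xs: "m = mset xs" by (metis ex_mset)
  have conv: "(\<Prod>v\<in>#m. h v) = (\<Prod>j<size m. h (xs ! j))" for h :: "'a \<Rightarrow> 'b::comm_monoid_mult"
    unfolding xs by (induction xs) (simp_all add: prod.lessThan_Suc_shift del: prod.lessThan_Suc)
  let ?f = "c *\<^sub>R (\<Prod>v\<in>#m. sym_embed v)"
  have "proj_ext \<rho> ?f = (\<Sum>k\<in>{size m}. proj_ext_part \<rho> k (sym_part k ?f))"
    by (rule proj_ext_superset[OF assms]) (auto simp: sym_part_monom)
  also have "\<dots> = proj_ext_part \<rho> (size m) ?f" by (simp add: sym_part_monom)
  also have "\<dots> \<le> \<bar>c\<bar> * (\<Prod>v\<in>#m. \<rho> v)"
  proof (cases "size m = 0")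
    case True
    then show ?thesis using proj_ext_part_0[of \<rho> c] by (simp add: of_real_def)
  next
    case False
    then have "0 < size m" by linarith
    then show ?thesis
      unfolding conv by (intro proj_ext_part_le[OF assms] decomp_cost_single[OF assms])
  qed
  finally show ?thesis .
qed

text \<open>This makes integration over the unit ball continuous for \<open>proj_ext\<close>: in
  every decomposition of every component, each factor \<open>v\<close> has
  \<open>\<bar>dual_apply \<phi> v\<bar> \<le> \<rho> v\<close>.\<close>

lemma abs_sym_hat_le_proj_ext:
  assumes \<rho>: "seminorm \<rho>" and \<phi>: "\<phi> \<in> dual_unit_ball \<rho>"
  shows "\<bar>sym_hat f \<phi>\<bar> \<le> proj_ext \<rho> f"
proof -
  have part: "\<bar>sym_hat f \<phi>\<bar> \<le> proj_ext_part \<rho> k f" if f: "f \<in> sym_homogeneous k" for k f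
  proof (cases "k = 0")
    case True
    then obtain r where "f = of_real r" using f by (auto simp: sym_homogeneous_0)
    then show ?thesis using True by (simp add: proj_ext_part_0 sym_hat_of_real)
  next
    case False
    then have k: "0 < k" by simp
    show ?thesis
    proof (rule le_proj_ext_part[OF \<rho> k f])
      fix r assume "decomp_cost \<rho> k f r"
      then obtain n :: nat and F :: "nat \<Rightarrow> nat \<Rightarrow> 'a" where F: "f = (\<Sum>i<n. \<Prod>j<k. sym_embed (F i j))" "r = (\<Sum>i<n. \<Prod>j<k. \<rho> (F i j))"
        unfolding decomp_cost_def by blast
      have "\<bar>sym_hat f \<phi>\<bar> \<le> (\<Sum>i<n. \<bar>\<Prod>j<k. dual_apply \<phi> (F i j)\<bar>)"
        unfolding F(1) sym_hat_sum sym_hat_prod sym_hat_embed by (rule sum_abs)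
      also have "\<dots> \<le> r"
        unfolding F(2) abs_prod
        using \<phi> by (intro sum_mono prod_mono) (simp add: dual_unit_ball_iff[OF \<rho>])
      finally show "\<bar>sym_hat f \<phi>\<bar> \<le> r" .
    qed
  qed
  have "sym_hat f \<phi> = (\<Sum>k | sym_part k f \<noteq> 0. sym_hat (sym_part k f) \<phi>)"
    using arg_cong[OF sum_sym_part[of f], of "\<lambda>g. sym_hat g \<phi>"] by (simp add: sym_hat_sum)
  also have "\<bar>\<dots>\<bar> \<le> (\<Sum>k | sym_part k f \<noteq> 0. \<bar>sym_hat (sym_part k f) \<phi>\<bar>)" by (rule sum_abs)
  also have "\<dots> \<le> proj_ext \<rho> f"
    unfolding proj_ext_def by (intro sum_mono part sym_part_in_homogeneous)
  finally show ?thesis .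
qed

text \<open>Balls with arbitrary centres are given only as a subbasis of
  \<open>seminorm_topology\<close>; the triangle inequality places a ball about \<open>x\<close>
  inside any ball containing \<open>x\<close>, and the rest is induction on how \<open>U\<close> is
  generated.\<close>

lemma open_seminorm_topology_ball:
  assumes tri: "\<And>x y. p (x + y) \<le> p x + p y"
    and "openin (seminorm_topology p) U" "x \<in> U"
  shows "\<exists>r>0. {y. p (y - x) < r} \<subseteq> U"
proof -
  have "generate_topology_on {{y. p (y - x) < r} | x r. True} U"
    using assms(2) by (simp add: seminorm_topology_def openin_topology_generated_by_iff)
  then show ?thesis using assms(3)
  proof (induction arbitrary: x)
    case Empty
    then show ?case by simp
  next
    case (Int a b)
    have "x \<in> a" "x \<in> b" using Int.prems by simp_all
    from Int.IH(1)[OF this(1)] Int.IH(2)[OF this(2)]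
    obtain r s where "r > 0" "{y. p (y - x) < r} \<subseteq> a" "s > 0" "{y. p (y - x) < s} \<subseteq> b"
      by (elim exE conjE)
    then show ?case by (intro exI[of _ "min r s"]) auto
  next
    case (UN C)
    then obtain k where k: "k \<in> C" "x \<in> k" by blast
    then obtain r where "r > 0" "{y. p (y - x) < r} \<subseteq> k" using UN.IH by blast
    then show ?case using k(1) by (intro exI[of _ r]) auto
  next
    case (Basis s)
    then obtain z r where s: "s = {y. p (y - z) < r}" by blast
    have "p (y - z) < r" if "p (y - x) < r - p (x - z)" for y
      using tri[of "y - x" "x - z"] that by simp
    then show ?case using Basis(2) by (intro exI[of _ "r - p (x - z)"]) (auto simp: s)
  qed
qed

lemma continuous_map_seminorm_topology:
  fixes L :: "'a::real_vector \<Rightarrow> real"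
  assumes lin: "linear L" and bound: "\<And>x. \<bar>L x\<bar> \<le> C * p x" and C: "0 \<le> C" and p0: "p 0 = 0"
  shows "continuous_map (seminorm_topology p) euclidean L"
proof -
  have top: "topspace (seminorm_topology p) = UNIV"
  proof -
    have "x \<in> {y. p (y - x) < 1}" for x using p0 by simp
    then show ?thesis unfolding seminorm_topology_def topology_generated_by_topspace by blast
  qed
  show ?thesis
    unfolding continuous_map_def top
  proof (intro conjI allI impI)
    fix T :: "real set" assume T: "openin euclidean T"
    have "\<exists>B. openin (seminorm_topology p) B \<and> x \<in> B \<and> B \<subseteq> {x \<in> UNIV. L x \<in> T}"
      if x: "L x \<in> T" for x
    proof -
      obtain e where e: "e > 0" "ball (L x) e \<subseteq> T" using T x by (auto simp: open_contains_ball)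
      define r where "r = e / (C + 1)"
      have r: "0 < r" using e(1) C by (simp add: r_def)
      have "L y \<in> T" if y: "p (y - x) < r" for y
      proof -
        have "\<bar>L y - L x\<bar> \<le> C * p (y - x)" using bound[of "y - x"] lin by (simp add: linear_diff)
        also have "\<dots> \<le> C * r" using y C by (intro mult_left_mono) auto
        also have "\<dots> < e" using e(1) C by (simp add: r_def field_simps)
        finally have "dist (L x) (L y) < e" by (simp add: dist_real_def abs_minus_commute)
        then show ?thesis using e(2) by auto
      qed
      moreover have "openin (seminorm_topology p) {y. p (y - x) < r}"
        unfolding seminorm_topology_def by (rule topology_generated_by_Basis) blast
      ultimately show ?thesis using p0 r by (intro exI[of _ "{y. p (y - x) < r}"]) auto
    qed
    then show "openin (seminorm_topology p) {x \<in> UNIV. L x \<in> T}"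
      by (subst openin_subopen) blast
  qed simp
qed


section \<open>Representing measures on the dual unit ball\<close>

lemma sym_hat_dense:
  assumes "compact K" "continuous_on K f" "0 < e"
  shows "\<exists>g. \<forall>\<phi>\<in>K. \<bar>f \<phi> - sym_hat g \<phi>\<bar> < e"
proof -
  have "\<exists>h. (\<exists>g. h = sym_hat g) \<and> (\<forall>\<phi>\<in>K. \<bar>f \<phi> - h \<phi>\<bar> < e)"
  proof (rule Stone_Weierstrass_HOL[OF assms(1) _ _ _ _ _ assms(2,3)])
    show "\<exists>g. (\<lambda>_. c) = sym_hat g" for c
      by (rule exI[of _ "of_real c"]) (simp add: sym_hat_of_real[abs_def])
    show "continuous_on K h" if "\<exists>g. h = sym_hat g" for h
      using that continuous_on_sym_hat by auto
    show "\<exists>g. (\<lambda>x. h x + k x) = sym_hat g" if "(\<exists>g. h = sym_hat g) \<and> (\<exists>g. k = sym_hat g)" for h k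
    proof -
      from that obtain f g where "h = sym_hat f" "k = sym_hat g" by blast
      then show ?thesis by (intro exI[of _ "f + g"]) (simp add: sym_hat_add[abs_def])
    qed
    show "\<exists>g. (\<lambda>x. h x * k x) = sym_hat g" if "(\<exists>g. h = sym_hat g) \<and> (\<exists>g. k = sym_hat g)" for h k
    proof -
      from that obtain f g where "h = sym_hat f" "k = sym_hat g" by blast
      then show ?thesis by (intro exI[of _ "f * g"]) (simp add: sym_hat_mult[abs_def])
    qed
    show "\<exists>h. (\<exists>g. h = sym_hat g) \<and> h \<phi> \<noteq> h \<psi>" if "\<phi> \<in> K \<and> \<psi> \<in> K \<and> \<phi> \<noteq> \<psi>" for \<phi> \<psi>
    proof -
      from that obtain v where "dual_apply \<phi> v \<noteq> dual_apply \<psi> v" using dual_eqI by blast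
      then show ?thesis by (intro exI[of _ "sym_hat (sym_embed v)"]) (auto simp: sym_hat_embed)
    qed
  qed
  then show ?thesis by blast
qed

lemma eq_if_abs_diff_le:
  fixes a b c :: real
  assumes "\<And>e. 0 < e \<Longrightarrow> \<bar>a - b\<bar> \<le> e * c"
  shows "a = b"
proof (rule ccontr)
  assume "a \<noteq> b"
  define m where "m = \<bar>c\<bar> + 1"
  have m: "0 < m" "c \<le> m" by (auto simp: m_def)
  have e: "0 < \<bar>a - b\<bar> / (2 * m)" using \<open>a \<noteq> b\<close> m by simp
  then have "\<bar>a - b\<bar> \<le> \<bar>a - b\<bar> / (2 * m) * c" by (rule assms)
  also have "\<dots> \<le> \<bar>a - b\<bar> / (2 * m) * m" using e m by (intro mult_left_mono) auto
  also have "\<dots> = \<bar>a - b\<bar> / 2" using m by simp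
  finally show False using \<open>a \<noteq> b\<close> by simp
qed

text \<open>The extension of \<open>L\<close> is written down as an upper envelope \<open>I\<close>,
  without a choice of approximations. By \<open>approx\<close>, a uniform error \<open>e\<close>
  between \<open>f\<close> and \<open>sym_hat g\<close> costs at most \<open>e * L 1\<close>;
  additivity, homogeneity and positivity of \<open>I\<close> follow by density.\<close>

lemma exists_representing_measure:
  assumes lin: "linear L" and K: "compact K"
    and pos: "\<And>f. (\<And>\<phi>. \<phi> \<in> K \<Longrightarrow> 0 \<le> sym_hat f \<phi>) \<Longrightarrow> 0 \<le> L f"
  shows "\<exists>\<mu>. radon_measure \<mu> \<and> supported_by \<mu> K \<and> represents \<mu> L"
proof -
  define I where "I f = Inf {L g | g. \<forall>\<phi>\<in>K. f \<phi> \<le> sym_hat g \<phi>}" for f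
  have mono: "L f \<le> L g" if "\<And>\<phi>. \<phi> \<in> K \<Longrightarrow> sym_hat f \<phi> \<le> sym_hat g \<phi>" for f g
    using pos[of "g - f"] that lin by (simp add: sym_hat_diff linear_diff)
  have L1: "0 \<le> L 1" by (rule pos) (simp add: sym_hat_one)
  have approx: "\<bar>I f - L g\<bar> \<le> e * L 1" if e: "\<And>\<phi>. \<phi> \<in> K \<Longrightarrow> \<bar>f \<phi> - sym_hat g \<phi>\<bar> \<le> e" for f g e
  proof -
    have shift: "L (g + c *\<^sub>R 1) = L g + c * L 1" for c
      using lin by (simp add: linear_add linear_cmul)
    have mem: "L (g + e *\<^sub>R 1) \<in> {L g | g. \<forall>\<phi>\<in>K. f \<phi> \<le> sym_hat g \<phi>}"
    proof -
      have "f \<phi> \<le> sym_hat (g + e *\<^sub>R 1) \<phi>" if "\<phi> \<in> K" for \<phi>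
        using e[OF that] by (simp add: sym_hat_add sym_hat_scaleR sym_hat_one)
      then show ?thesis by blast
    qed
    have low: "L (g + (- e) *\<^sub>R 1) \<le> r" if "r \<in> {L g | g. \<forall>\<phi>\<in>K. f \<phi> \<le> sym_hat g \<phi>}" for r
    proof -
      from that obtain h where h: "r = L h" "\<forall>\<phi>\<in>K. f \<phi> \<le> sym_hat h \<phi>" by blast
      have "sym_hat (g + (- e) *\<^sub>R 1) \<phi> \<le> sym_hat h \<phi>" if "\<phi> \<in> K" for \<phi>
        unfolding sym_hat_add sym_hat_scaleR sym_hat_one
        using e[OF that] bspec[OF h(2) that] by (simp add: abs_le_iff)
      then show ?thesis unfolding h(1) by (rule mono)
    qed
    have "I f \<le> L (g + e *\<^sub>R 1)"
      unfolding I_def by (rule cInf_lower[OF mem]) (rule bdd_belowI[OF low])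
    moreover have "L (g + (- e) *\<^sub>R 1) \<le> I f"
      unfolding I_def by (rule cInf_greatest[OF _ low]) (use mem in blast)+
    ultimately show ?thesis unfolding shift by (simp add: abs_le_iff)
  qed
  have dense: "\<exists>g. \<forall>\<phi>\<in>K. \<bar>f \<phi> - sym_hat g \<phi>\<bar> \<le> e" if "continuous_on K f" "0 < e" for f e
    using sym_hat_dense[OF K that] less_imp_le by blast
  interpret positive_functional K I
  proof
    show "compact K" by (rule K)
  next
    fix f g :: "'a dual \<Rightarrow> real" assume fg: "continuous_on K f" "continuous_on K g"
    show "I (\<lambda>x. f x + g x) = I f + I g"
    proof (rule eq_if_abs_diff_le[of _ _ "4 * L 1"])
      fix e :: real assume e: "0 < e"
      obtain a where a: "\<forall>\<phi>\<in>K. \<bar>f \<phi> - sym_hat a \<phi>\<bar> \<le> e" using dense[OF fg(1) e] by blast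
      obtain b where b: "\<forall>\<phi>\<in>K. \<bar>g \<phi> - sym_hat b \<phi>\<bar> \<le> e" using dense[OF fg(2) e] by blast
      have "\<bar>(f \<phi> + g \<phi>) - sym_hat (a + b) \<phi>\<bar> \<le> 2 * e" if "\<phi> \<in> K" for \<phi>
        using bspec[OF a that] bspec[OF b that] by (simp add: sym_hat_add)
      then have "\<bar>I (\<lambda>x. f x + g x) - L (a + b)\<bar> \<le> 2 * e * L 1" by (rule approx)
      moreover have "\<bar>I f - L a\<bar> \<le> e * L 1" "\<bar>I g - L b\<bar> \<le> e * L 1"
        using a b by (auto intro!: approx)
      ultimately show "\<bar>I (\<lambda>x. f x + g x) - (I f + I g)\<bar> \<le> e * (4 * L 1)"
        by (simp add: linear_add[OF lin] abs_le_iff)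
    qed
  next
    fix f :: "'a dual \<Rightarrow> real" and c :: real assume f: "continuous_on K f"
    show "I (\<lambda>x. c * f x) = c * I f"
    proof (rule eq_if_abs_diff_le[of _ _ "2 * \<bar>c\<bar> * L 1"])
      fix e :: real assume e: "0 < e"
      obtain a where a: "\<forall>\<phi>\<in>K. \<bar>f \<phi> - sym_hat a \<phi>\<bar> \<le> e" using dense[OF f e] by blast
      have "\<bar>c * f \<phi> - sym_hat (c *\<^sub>R a) \<phi>\<bar> \<le> \<bar>c\<bar> * e" if "\<phi> \<in> K" for \<phi>
        using mult_left_mono[OF bspec[OF a that], of "\<bar>c\<bar>"]
        by (simp add: sym_hat_scaleR right_diff_distrib flip: abs_mult)
      then have "\<bar>I (\<lambda>x. c * f x) - L (c *\<^sub>R a)\<bar> \<le> \<bar>c\<bar> * e * L 1" by (rule approx)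
      moreover have "\<bar>I f - L a\<bar> \<le> e * L 1" using a by (auto intro!: approx)
      then have "\<bar>c * I f - L (c *\<^sub>R a)\<bar> \<le> \<bar>c\<bar> * (e * L 1)"
        using mult_left_mono[of "\<bar>I f - L a\<bar>" "e * L 1" "\<bar>c\<bar>"]
        by (simp add: linear_cmul[OF lin] right_diff_distrib flip: abs_mult)
      ultimately show "\<bar>I (\<lambda>x. c * f x) - c * I f\<bar> \<le> e * (2 * \<bar>c\<bar> * L 1)"
        by (simp add: abs_le_iff mult_ac)
    qed
  next
    fix f :: "'a dual \<Rightarrow> real" assume f: "continuous_on K f" "\<And>x. x \<in> K \<Longrightarrow> 0 \<le> f x"
    show "0 \<le> I f"
    proof (rule ccontr)
      assume neg: "\<not> 0 \<le> I f"
      \<comment> \<open>Adding 1 keeps \<open>k\<close> positive even if \<open>L 1 = 0\<close>;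
        \<open>e\<close> is chosen with \<open>2 * e * k = - I f\<close>, which contradicts the
        bound of \<open>- I f\<close> by \<open>2 * e * L 1\<close>.\<close>
      define k where "k = L 1 + 1"
      have k: "0 < k" "L 1 < k" using L1 by (auto simp: k_def)
      define e where "e = - I f / (2 * k)"
      have e: "0 < e" unfolding e_def using neg k by (intro divide_pos_pos) auto
      obtain a where a: "\<forall>\<phi>\<in>K. \<bar>f \<phi> - sym_hat a \<phi>\<bar> \<le> e" using dense[OF f(1) e] by blast
      have "0 \<le> L (a + e *\<^sub>R 1)"
      proof (rule pos)
        show "0 \<le> sym_hat (a + e *\<^sub>R 1) \<phi>" if "\<phi> \<in> K" for \<phi>
          using bspec[OF a that] f(2)[OF that]
          by (simp add: sym_hat_add sym_hat_scaleR sym_hat_one abs_le_iff)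
      qed
      then have "0 \<le> L a + e * L 1" using lin by (simp add: linear_add linear_cmul)
      moreover have "\<bar>I f - L a\<bar> \<le> e * L 1" using a by (auto intro!: approx)
      ultimately have "- I f \<le> 2 * e * L 1" by (simp add: abs_le_iff)
      also have "\<dots> < 2 * e * k" using e k by simp
      also have "\<dots> = - I f" using k by (simp add: e_def)
      finally show False by simp
    qed
  qed
  have "represents riesz_measure L"
    unfolding represents_def
  proof (intro allI conjI)
    fix f
    show "integrable riesz_measure (sym_hat f)"
      by (rule riesz.integrable_continuous[OF continuous_on_sym_hat])
    \<comment> \<open>Error 0 is allowed in \<open>approx\<close>, so \<open>I\<close> extends
      \<open>L\<close>.\<close>
    have "I (sym_hat f) = L f" using approx[of "sym_hat f" f 0] by simp
    then show "L f = (\<integral>\<phi>. sym_hat f \<phi> \<partial>riesz_measure)"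
      using riesz.integral_indicator_mult[OF continuous_on_sym_hat, of f]
        integral_riesz_measure[OF continuous_on_sym_hat, of f] by simp
  qed
  then show ?thesis using riesz.radon riesz.supported by blast
qed

lemma compact_radon_sym_hat_eqI:
  assumes \<mu>: "compact_radon K \<mu>" and \<nu>: "compact_radon K \<nu>"
    and eq: "\<And>f. (\<integral>\<phi>. sym_hat f \<phi> \<partial>\<mu>) = (\<integral>\<phi>. sym_hat f \<phi> \<partial>\<nu>)"
  shows "\<mu> = \<nu>"
proof (rule compact_radon_eqI[OF \<mu> \<nu>])
  fix u :: "'a dual \<Rightarrow> real" assume u: "continuous_on K u"
  have close: "\<bar>(\<integral>\<phi>. indicator K \<phi> * u \<phi> \<partial>M) - (\<integral>\<phi>. sym_hat g \<phi> \<partial>M)\<bar> \<le> e * measure M K"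
    if M: "compact_radon K M" and g: "\<forall>\<phi>\<in>K. \<bar>u \<phi> - sym_hat g \<phi>\<bar> < e" for M g e
  proof -
    interpret M: compact_radon K M by fact
    have ug: "continuous_on K (\<lambda>\<phi>. u \<phi> - sym_hat g \<phi>)"
      by (intro continuous_intros u continuous_on_sym_hat)
    have "(\<integral>\<phi>. indicator K \<phi> * u \<phi> \<partial>M) - (\<integral>\<phi>. sym_hat g \<phi> \<partial>M) =
        (\<integral>\<phi>. indicator K \<phi> * u \<phi> \<partial>M) - (\<integral>\<phi>. indicator K \<phi> * sym_hat g \<phi> \<partial>M)"
      by (simp add: M.integral_indicator_mult[OF continuous_on_sym_hat])
    also have "\<dots> = (\<integral>\<phi>. indicator K \<phi> * (u \<phi> - sym_hat g \<phi>) \<partial>M)"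
      using M.integrable_indicator_mult[OF u] M.integrable_indicator_mult[OF continuous_on_sym_hat, of g]
      by (simp add: right_diff_distrib)
    also have "\<bar>\<dots>\<bar> \<le> (\<integral>\<phi>. \<bar>indicator K \<phi> * (u \<phi> - sym_hat g \<phi>)\<bar> \<partial>M)"
      by (rule integral_abs_bound)
    also have "\<dots> \<le> (\<integral>\<phi>. e * indicat_real K \<phi> \<partial>M)"
    proof (rule integral_mono)
      show "integrable M (\<lambda>\<phi>. \<bar>indicator K \<phi> * (u \<phi> - sym_hat g \<phi>)\<bar>)"
        by (intro integrable_abs M.integrable_indicator_mult ug)
      show "integrable M (\<lambda>\<phi>. e * indicat_real K \<phi>)"
        using M.K_borel by (intro integrable_mult_right integrable_real_indicator)
          (auto simp: M.sets_eq M.emeasure_finite less_top[symmetric])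
      show "\<bar>indicator K \<phi> * (u \<phi> - sym_hat g \<phi>)\<bar> \<le> e * indicat_real K \<phi>" for \<phi>
        using g by (cases "\<phi> \<in> K") (auto simp: less_imp_le)
    qed
    also have "\<dots> = e * measure M K" by simp
    finally show ?thesis .
  qed
  show "(\<integral>x. indicator K x * u x \<partial>\<mu>) = (\<integral>x. indicator K x * u x \<partial>\<nu>)"
  proof (rule eq_if_abs_diff_le[of _ _ "measure \<mu> K + measure \<nu> K"])
    fix e :: real assume e: "0 < e"
    obtain g where g: "\<forall>\<phi>\<in>K. \<bar>u \<phi> - sym_hat g \<phi>\<bar> < e"
      using sym_hat_dense[OF compact_radon.compact_K[OF \<mu>] u e] by blast
    show "\<bar>(\<integral>x. indicator K x * u x \<partial>\<mu>) - (\<integral>x. indicator K x * u x \<partial>\<nu>)\<bar> \<le> e * (measure \<mu> K + measure \<nu> K)"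
      using close[OF \<mu> g] close[OF \<nu> g] eq[of g] by (simp add: abs_le_iff distrib_left)
  qed
qed

text \<open>Continuity makes \<open>L\<close> small on a \<open>proj_ext\<close> ball. Scaling turns
  this into a bound on monomials, where \<open>proj_ext\<close> is at most the cost, and such a
  bound spreads to all elements by way of \<open>tensor_norm\<close>.\<close>

lemma nonneg_functional_bound:
  assumes \<rho>: "seminorm \<rho>" and L: "L \<in> nonneg_functionals \<rho> d"
  shows "\<exists>C. \<forall>f. \<bar>L f\<bar> \<le> C * tensor_norm \<rho> f"
proof -
  have lin: "linear L" and cont: "continuous_map (seminorm_topology (proj_ext \<rho>)) euclidean L"
    using L by (auto simp: nonneg_functionals_def)
  define U where "U = {f \<in> topspace (seminorm_topology (proj_ext \<rho>)). L f \<in> {-1<..<1}}"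
  have U: "openin (seminorm_topology (proj_ext \<rho>)) U"
    unfolding U_def by (rule openin_continuous_map_preimage[OF cont]) simp
  have "openin (seminorm_topology (proj_ext \<rho>)) {y. proj_ext \<rho> (y - 0) < 1}"
    unfolding seminorm_topology_def by (rule topology_generated_by_Basis) blast
  then have "0 \<in> U"
    using openin_subset by (fastforce simp: U_def linear_0[OF lin] proj_ext_zero)
  then obtain r where r: "r > 0" "{f. proj_ext \<rho> (f - 0) < r} \<subseteq> U"
    using open_seminorm_topology_ball[OF proj_ext_triangle[OF \<rho>] U] by blast
  have small: "\<bar>L f\<bar> < 1" if "proj_ext \<rho> f < r" for f
  proof -
    have "f \<in> U" using that r(2) by auto
    then show ?thesis by (auto simp: U_def)
  qed
  have monom: "\<bar>L (c *\<^sub>R (\<Prod>v\<in>#m. sym_embed v))\<bar> \<le> (2 / r) * (\<bar>c\<bar> * (\<Prod>v\<in>#m. \<rho> v))" for c m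
  proof -
    define w where "w = c *\<^sub>R (\<Prod>v\<in>#m. sym_embed v)"
    define a where "a = \<bar>c\<bar> * (\<Prod>v\<in>#m. \<rho> v)"
    have a: "0 \<le> a" unfolding a_def by (intro mult_nonneg_nonneg prod_mset_nonneg seminorm_nonneg[OF \<rho>]) simp
    have tw: "\<bar>t\<bar> * \<bar>L w\<bar> < 1" if "\<bar>t\<bar> * a < r" for t
    proof -
      have "proj_ext \<rho> (t *\<^sub>R w) \<le> \<bar>t\<bar> * a"
        using proj_ext_monom_le[OF \<rho>, of "t * c" m] by (simp add: w_def a_def abs_mult mult.assoc)
      then have "\<bar>L (t *\<^sub>R w)\<bar> < 1" using that by (intro small) linarith
      then show ?thesis using lin by (simp add: linear_cmul abs_mult)
    qed
    \<comment> \<open>Cost 0 puts every multiple of \<open>w\<close> into the ball, which forces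
      \<open>L w = 0\<close>; otherwise the multiple of cost \<open>r / 2\<close> is used, whence
      the factor 2.\<close>
    have "\<bar>L w\<bar> \<le> (2 / r) * a"
    proof (cases "a = 0")
      case True
      have "L w = 0"
      proof (rule ccontr)
        assume "L w \<noteq> 0"
        then show False using tw[of "1 / \<bar>L w\<bar>"] True r(1) by simp
      qed
      then show ?thesis using True by simp
    next
      case False
      then have pos: "0 < a" using a by simp
      have "\<bar>r / (2 * a)\<bar> * \<bar>L w\<bar> < 1" using pos r(1) by (intro tw) simp
      then show ?thesis using pos r(1) by (simp add: field_simps)
    qed
    then show ?thesis by (simp only: w_def a_def)
  qed
  have up: "L f \<le> (2 / r) * tensor_norm \<rho> f" if lin: "linear L"
    and monom: "\<And>c m. L (c *\<^sub>R (\<Prod>v\<in>#m. sym_embed v)) \<le> (2 / r) * (\<bar>c\<bar> * (\<Prod>v\<in>#m. \<rho> v))" for L f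
  proof -
    have "L f / (2 / r) \<le> tensor_norm \<rho> f"
    proof (rule le_tensor_norm)
      fix s assume "tensor_cost \<rho> f s"
      then have "L f \<le> (2 / r) * s" by (rule tensor_cost_linear_bound[OF lin monom])
      then show "L f / (2 / r) \<le> s" using r(1) by (simp add: field_simps)
    qed
    then show ?thesis using r(1) by (simp add: field_simps)
  qed
  have "\<bar>L f\<bar> \<le> (2 / r) * tensor_norm \<rho> f" for f
  proof -
    have "L f \<le> (2 / r) * tensor_norm \<rho> f"
      using monom by (intro up lin) (auto simp: abs_le_iff)
    moreover have "- L f \<le> (2 / r) * tensor_norm \<rho> f"
      using monom linear_compose_neg[OF lin] by (intro up[of "\<lambda>f. - L f"]) (auto simp: abs_le_iff)
    ultimately show ?thesis by (simp add: abs_le_iff)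
  qed
  then show ?thesis by blast
qed

text \<open>A character negative at \<open>f\<close> restricts to a functional \<phi> on
  \<open>V\<close>, and \<open>tensor_norm \<rho> (sym_embed v) \<le> \<rho> v\<close> puts \<phi>
  into the unit ball. By the universal property \<open>sym_hat f \<phi>\<close> is the value of the
  character at \<open>f\<close>, against the assumption.\<close>

lemma nonneg_functional_nonneg:
  assumes \<rho>: "seminorm \<rho>" and d: "1 \<le> d" and L: "L \<in> nonneg_functionals \<rho> d"
    and f: "\<And>\<phi>. \<phi> \<in> dual_unit_ball \<rho> \<Longrightarrow> 0 \<le> sym_hat f \<phi>"
  shows "0 \<le> L f"
proof (rule ccontr)
  assume neg: "\<not> 0 \<le> L f"
  interpret submult_seminorm "tensor_norm \<rho>" by (rule submult_seminorm_tensor_norm[OF \<rho>])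
  have "0 \<le> L (x ^ (2 * d))" for x
  proof -
    have "x ^ (2 * d) \<in> sums_of_powers (2 * d)"
      unfolding sums_of_powers_def by (intro CollectI exI[of _ 1] exI[of _ "\<lambda>_. x"]) simp
    then show ?thesis using L by (auto simp: nonneg_functionals_def)
  qed
  then have pos: "positive_on_powers (2 * d) L"
    using nonneg_functional_bound[OF \<rho> L] L by (simp add: positive_on_powers_def nonneg_functionals_def)
  obtain \<alpha> where \<alpha>: "real_algebra_hom \<alpha>" "\<forall>x. \<bar>\<alpha> x\<bar> \<le> tensor_norm \<rho> x" "\<alpha> f < 0"
    using exists_negative_character[OF _ pos, of f] d neg by auto
  define \<phi> where "\<phi> = Abs_dual (\<lambda>v. \<alpha> (sym_embed v))"
  have "linear (\<lambda>v. \<alpha> (sym_embed v))"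
    using linear_compose[OF linear_sym_embed, of \<alpha>] \<alpha>(1) by (simp add: real_algebra_hom_def o_def)
  then have app: "dual_apply \<phi> v = \<alpha> (sym_embed v)" for v
    by (simp add: \<phi>_def Abs_dual_inverse)
  have "\<bar>dual_apply \<phi> v\<bar> \<le> \<rho> v" for v
  proof -
    have "tensor_norm \<rho> (sym_embed v) \<le> \<rho> v"
      using tensor_norm_le[OF \<rho> tensor_cost_monom[of \<rho> 1 "{#v#}"]] by simp
    then show ?thesis using \<alpha>(2) unfolding app by (meson order.trans)
  qed
  then have "\<phi> \<in> dual_unit_ball \<rho>" by (simp add: dual_unit_ball_iff[OF \<rho>])
  moreover have "sym_hat f \<phi> = \<alpha> f"
    using dual_ext_eq[OF \<alpha>(1)] app by (simp add: sym_hat_def)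
  ultimately show False using f \<alpha>(3) by fastforce
qed

lemma compact_radon_ball_measure:
  assumes "seminorm \<rho>" "\<mu> \<in> ball_measures \<rho>"
  shows "compact_radon (dual_unit_ball \<rho>) \<mu>"
  using assms compact_dual_unit_ball by unfold_locales (auto simp: ball_measures_def)

lemma nonneg_functional_integral:
  assumes \<rho>: "seminorm \<rho>" and \<mu>: "\<mu> \<in> ball_measures \<rho>"
  shows "(\<lambda>f. \<integral>\<phi>. sym_hat f \<phi> \<partial>\<mu>) \<in> nonneg_functionals \<rho> d"
proof -
  interpret compact_radon "dual_unit_ball \<rho>" \<mu> by (rule compact_radon_ball_measure[OF assms])
  let ?L = "\<lambda>f. \<integral>\<phi>. sym_hat f \<phi> \<partial>\<mu>"
  have int: "integrable \<mu> (sym_hat f)" for f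
    by (rule integrable_continuous[OF continuous_on_sym_hat])
  have lin: "linear ?L"
    by (rule linearI) (simp_all add: sym_hat_add sym_hat_scaleR int)
  moreover have "continuous_map (seminorm_topology (proj_ext \<rho>)) euclidean ?L"
  proof (rule continuous_map_seminorm_topology[OF lin])
    fix f
    have "\<bar>?L f\<bar> \<le> (\<integral>\<phi>. \<bar>sym_hat f \<phi>\<bar> \<partial>\<mu>)" by (rule integral_abs_bound)
    also have "\<dots> \<le> (\<integral>\<phi>. proj_ext \<rho> f \<partial>\<mu>)"
    proof (rule integral_mono_AE)
      show "AE \<phi> in \<mu>. \<bar>sym_hat f \<phi>\<bar> \<le> proj_ext \<rho> f"
        using AE_in_K by eventually_elim (rule abs_sym_hat_le_proj_ext[OF \<rho>])
    qed (simp_all add: int)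
    finally show "\<bar>?L f\<bar> \<le> measure \<mu> (space \<mu>) * proj_ext \<rho> f" by simp
  qed (simp_all add: proj_ext_zero)
  moreover have "0 \<le> ?L f" if "f \<in> sums_of_powers (2 * d)" for f
  proof -
    from that obtain k :: nat and a where f: "f = (\<Sum>i<k. a i ^ (2 * d))"
      unfolding sums_of_powers_def by blast
    have "0 \<le> sym_hat f \<phi>" for \<phi>
      unfolding f sym_hat_sum sym_hat_power by (intro sum_nonneg) simp
    then show ?thesis by (simp add: integral_nonneg_AE)
  qed
  ultimately show ?thesis by (simp add: nonneg_functionals_def)
qed

section \<open>Power modules and supports\<close>

lemma closed_nonneg_set: "closed (nonneg_set M)"
proof -
  have "nonneg_set M = (\<Inter>g\<in>M. {\<phi>. 0 \<le> sym_hat g \<phi>})" by (auto simp: nonneg_set_def)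
  then show ?thesis
    by (auto intro!: closed_INT closed_Collect_le continuous_on_const continuous_on_sym_hat)
qed

text \<open>
  Approximating the negative part \<open>h\<close> of \<open>sym_hat g\<close> by elements \<open>a\<close> of \<open>S(V)\<close> turns
  \<open>L (a ^ (2 * d) * g) \<ge> 0\<close> into the nonnegativity of the integral of \<open>- h ^ (2 * d + 1)\<close>.
\<close>

lemma AE_sym_hat_nonneg:
  assumes \<mu>: "compact_radon K \<mu>" and d: "1 \<le> d"
    and nonneg: "\<And>a. 0 \<le> (\<integral>\<phi>. sym_hat (a ^ (2 * d) * g) \<phi> \<partial>\<mu>)"
  shows "AE \<phi> in \<mu>. 0 \<le> sym_hat g \<phi>"
proof -
  interpret compact_radon K \<mu> by fact
  define h where "h \<phi> = max (- sym_hat g \<phi>) 0" for \<phi>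
  have h: "continuous_on A h" for A
    unfolding h_def by (intro continuous_intros continuous_on_sym_hat)
  have "\<exists>a. \<forall>n. \<forall>\<phi>\<in>K. \<bar>h \<phi> - sym_hat (a n) \<phi>\<bar> < 1 / real (Suc n)"
    by (intro choice allI sym_hat_dense compact_K h) simp
  then obtain a where a: "\<And>n \<phi>. \<phi> \<in> K \<Longrightarrow> \<bar>h \<phi> - sym_hat (a n) \<phi>\<bar> < 1 / real (Suc n)" by blast
  have "compact (h ` K)" by (rule compact_continuous_image[OF h compact_K])
  then obtain b where b: "\<And>\<phi>. \<phi> \<in> K \<Longrightarrow> \<bar>h \<phi>\<bar> \<le> b"
    using compact_imp_bounded bounded_iff by (metis image_eqI real_norm_def)
  have lim: "(\<lambda>n. sym_hat (a n) \<phi>) \<longlonglongrightarrow> h \<phi>" if \<phi>: "\<phi> \<in> K" for \<phi>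
  proof (rule LIM_zero_cancel, rule Lim_null_comparison)
    show "(\<lambda>n. 1 / real (Suc n)) \<longlonglongrightarrow> 0" by (rule LIMSEQ_Suc[OF lim_1_over_n])
    show "\<forall>\<^sub>F n in sequentially. norm (sym_hat (a n) \<phi> - h \<phi>) \<le> 1 / real (Suc n)"
      using a[OF \<phi>] by (intro always_eventually allI) (simp add: abs_minus_commute less_imp_le)
  qed
  \<comment> \<open>\<open>b\<close> bounds \<open>h\<close> and the approximations differ from
    \<open>h\<close> by at most 1, which yields the dominating function below.\<close>
  have a_le: "\<bar>sym_hat (a n) \<phi>\<bar> \<le> b + 1" if \<phi>: "\<phi> \<in> K" for n \<phi>
  proof -
    have "1 / real (Suc n) \<le> 1" by simp
    then show ?thesis using a[OF \<phi>, of n] b[OF \<phi>] by linarith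
  qed
  have "(\<lambda>n. \<integral>\<phi>. sym_hat (a n ^ (2 * d) * g) \<phi> \<partial>\<mu>) \<longlonglongrightarrow> (\<integral>\<phi>. h \<phi> ^ (2 * d) * sym_hat g \<phi> \<partial>\<mu>)"
  proof (rule integral_dominated_convergence[where w = "\<lambda>\<phi>. (b + 1) ^ (2 * d) * \<bar>sym_hat g \<phi>\<bar>"])
    show "(\<lambda>\<phi>. h \<phi> ^ (2 * d) * sym_hat g \<phi>) \<in> borel_measurable \<mu>"
      by (intro measurable_continuous continuous_intros h continuous_on_sym_hat)
    show "sym_hat (a n ^ (2 * d) * g) \<in> borel_measurable \<mu>" for n
      by (intro measurable_continuous continuous_on_sym_hat)
    show "integrable \<mu> (\<lambda>\<phi>. (b + 1) ^ (2 * d) * \<bar>sym_hat g \<phi>\<bar>)"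
      by (intro integrable_continuous continuous_intros continuous_on_sym_hat)
    show "AE \<phi> in \<mu>. (\<lambda>n. sym_hat (a n ^ (2 * d) * g) \<phi>) \<longlonglongrightarrow> h \<phi> ^ (2 * d) * sym_hat g \<phi>"
      using AE_in_K
    proof eventually_elim
      case (elim \<phi>)
      then show ?case
        unfolding sym_hat_mult sym_hat_power by (intro tendsto_intros lim)
    qed
    show "AE \<phi> in \<mu>. norm (sym_hat (a n ^ (2 * d) * g) \<phi>) \<le> (b + 1) ^ (2 * d) * \<bar>sym_hat g \<phi>\<bar>" for n
      using AE_in_K
    proof eventually_elim
      case (elim \<phi>)
      have "\<bar>sym_hat (a n) \<phi>\<bar> ^ (2 * d) \<le> (b + 1) ^ (2 * d)"
        by (rule power_mono[OF a_le[OF elim]]) simp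
      then show ?case
        unfolding sym_hat_mult sym_hat_power real_norm_def abs_mult power_abs
        by (rule mult_right_mono) simp
    qed
  qed
  then have "0 \<le> (\<integral>\<phi>. h \<phi> ^ (2 * d) * sym_hat g \<phi> \<partial>\<mu>)"
    by (rule LIMSEQ_le_const) (use nonneg in blast)
  \<comment> \<open>Where \<open>sym_hat g\<close> is nonnegative, \<open>h\<close> vanishes and so
    does its power because \<open>1 \<le> d\<close>; elsewhere \<open>h\<close> is
    \<open>- sym_hat g\<close>.\<close>
  moreover have "h \<phi> ^ (2 * d) * sym_hat g \<phi> = - (h \<phi> ^ Suc (2 * d))" for \<phi>
    using d by (cases "sym_hat g \<phi> \<le> 0") (simp_all add: h_def)
  ultimately have "(\<integral>\<phi>. h \<phi> ^ Suc (2 * d) \<partial>\<mu>) \<le> 0" by simp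
  moreover have hn: "0 \<le> h \<phi> ^ Suc (2 * d)" for \<phi> by (simp add: h_def)
  ultimately have zero: "(\<integral>\<phi>. h \<phi> ^ Suc (2 * d) \<partial>\<mu>) = 0"
    by (intro antisym integral_nonneg_AE) auto
  have int: "integrable \<mu> (\<lambda>\<phi>. h \<phi> ^ Suc (2 * d))"
    by (intro integrable_continuous continuous_on_power h)
  have "AE \<phi> in \<mu>. h \<phi> ^ Suc (2 * d) = 0"
    using integral_nonneg_eq_0_iff_AE[OF int AE_I2[OF hn]] zero by (rule iffD1)
  then show ?thesis by eventually_elim (auto simp: h_def max_def split: if_splits)
qed

text \<open>\<open>M\<close> may be uncountable, so the null sets where some
  \<open>sym_hat g\<close> is negative cannot simply be united. They are open, so finitely many of
  them cover any compact subset of the union, and inner regularity makes the union null.\<close>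

lemma supported_by_nonneg_set_iff:
  assumes \<mu>: "compact_radon K \<mu>" and d: "1 \<le> d" and M: "power_module (2 * d) M"
  shows "(\<forall>f\<in>M. 0 \<le> (\<integral>\<phi>. sym_hat f \<phi> \<partial>\<mu>)) \<longleftrightarrow> supported_by \<mu> (nonneg_set M \<inter> K)"
proof
  interpret compact_radon K \<mu> by fact
  let ?X = "nonneg_set M \<inter> K"
  have X: "?X \<in> sets borel" using closed_nonneg_set K_borel by (auto intro: borel_closed)
  {
    assume pos: "\<forall>f\<in>M. 0 \<le> (\<integral>\<phi>. sym_hat f \<phi> \<partial>\<mu>)"
    \<comment> \<open>Closure of \<open>M\<close> under multiplication by \<open>2 * d\<close>-th
      powers supplies the hypothesis of \<open>AE_sym_hat_nonneg\<close>.\<close>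
    have AE: "AE \<phi> in \<mu>. 0 \<le> sym_hat g \<phi>" if "g \<in> M" for g
      using pos M that by (intro AE_sym_hat_nonneg[OF \<mu> d]) (simp add: power_module_def)
    have "emeasure \<mu> C = 0" if C: "compact C" "C \<subseteq> - nonneg_set M" for C
    proof -
      have cover: "C \<subseteq> (\<Union>g\<in>M. {\<phi>. sym_hat g \<phi> < 0})" using C(2) by (fastforce simp: nonneg_set_def)
      have opn: "open {\<phi>. sym_hat g \<phi> < 0}" for g :: "'a symalg"
        by (intro open_Collect_less continuous_on_const continuous_on_sym_hat)
      obtain D where D: "D \<subseteq> M" "finite D" "C \<subseteq> (\<Union>g\<in>D. {\<phi>. sym_hat g \<phi> < 0})"
        by (rule compactE_image[OF C(1) opn cover])
      have "AE \<phi> in \<mu>. \<forall>g\<in>D. 0 \<le> sym_hat g \<phi>"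
        using AE D(1,2) by (intro AE_finite_allI) auto
      then have "AE \<phi> in \<mu>. \<phi> \<notin> C"
        by eventually_elim (use D(3) in fastforce)
      then have "emeasure \<mu> C = emeasure \<mu> {}"
        using borel_compact[OF C(1)] by (intro emeasure_eq_AE) (auto simp: sets_eq)
      then show ?thesis by simp
    qed
    then have "emeasure \<mu> (- nonneg_set M) = 0"
      using closed_nonneg_set by (subst inner_regular) (auto intro!: antisym SUP_least borel_open simp: open_Compl)
    then have "AE \<phi> in \<mu>. \<phi> \<in> nonneg_set M"
      using closed_nonneg_set[of M]
      by (intro AE_I'[of "- nonneg_set M"]) (auto simp: null_sets_def sets_eq borel_open open_Compl)
    then have "AE \<phi> in \<mu>. \<phi> \<in> ?X" using AE_in_K by eventually_elim simp
    moreover have "space \<mu> - ?X = {\<phi> \<in> space \<mu>. \<phi> \<notin> ?X}" by auto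
    moreover have "space \<mu> - ?X \<in> sets \<mu>" using X by (auto simp: sets_eq)
    ultimately show "supported_by \<mu> ?X"
      unfolding supported_by_def by (simp only: AE_iff_null)
  }
  assume "supported_by \<mu> ?X"
  then have "AE \<phi> in \<mu>. \<phi> \<in> ?X"
    unfolding supported_by_def by (rule AE_I') auto
  then have "AE \<phi> in \<mu>. 0 \<le> sym_hat f \<phi>" if "f \<in> M" for f
    by eventually_elim (use that in \<open>auto simp: nonneg_set_def\<close>)
  then show "\<forall>f\<in>M. 0 \<le> (\<integral>\<phi>. sym_hat f \<phi> \<partial>\<mu>)" by (auto intro: integral_nonneg_AE)
qed

theorem corollary3p8:
  fixes \<rho> :: "'v::real_vector \<Rightarrow> real" and d :: nat
  assumes "seminorm \<rho>" and "1 \<le> d"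
  shows "(\<forall>L\<in>nonneg_functionals \<rho> d. \<exists>!\<mu>. \<mu> \<in> ball_measures \<rho> \<and> represents \<mu> L) \<and>
    (\<forall>\<mu>\<in>ball_measures \<rho>. \<exists>!L. L \<in> nonneg_functionals \<rho> d \<and> represents \<mu> L) \<and>
    (\<forall>M L \<mu>. power_module (2 * d) M \<longrightarrow> L \<in> nonneg_functionals \<rho> d \<longrightarrow> \<mu> \<in> ball_measures \<rho> \<longrightarrow>
      represents \<mu> L \<longrightarrow>
      ((\<forall>f\<in>M. 0 \<le> L f) \<longleftrightarrow> supported_by \<mu> (nonneg_set M \<inter> dual_unit_ball \<rho>)))"
proof (intro conjI ballI allI impI)
  fix L assume L: "L \<in> nonneg_functionals \<rho> d"
  have "linear L" using L by (simp add: nonneg_functionals_def)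
  then have "\<exists>\<mu>. radon_measure \<mu> \<and> supported_by \<mu> (dual_unit_ball \<rho>) \<and> represents \<mu> L"
    using compact_dual_unit_ball[OF assms(1)] nonneg_functional_nonneg[OF assms L]
    by (rule exists_representing_measure)
  moreover have "\<mu> = \<nu>" if "\<mu> \<in> ball_measures \<rho> \<and> represents \<mu> L" "\<nu> \<in> ball_measures \<rho> \<and> represents \<nu> L"
    for \<mu> \<nu>
  proof (rule compact_radon_sym_hat_eqI)
    show "compact_radon (dual_unit_ball \<rho>) \<mu>" "compact_radon (dual_unit_ball \<rho>) \<nu>"
      using that compact_radon_ball_measure[OF assms(1)] by blast+
    show "(\<integral>\<phi>. sym_hat f \<phi> \<partial>\<mu>) = (\<integral>\<phi>. sym_hat f \<phi> \<partial>\<nu>)" for f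
      using that unfolding represents_def by metis
  qed
  ultimately show "\<exists>!\<mu>. \<mu> \<in> ball_measures \<rho> \<and> represents \<mu> L"
    by (intro ex_ex1I) (auto simp: ball_measures_def)
next
  fix \<mu> assume \<mu>: "\<mu> \<in> ball_measures \<rho>"
  interpret compact_radon "dual_unit_ball \<rho>" \<mu> by (rule compact_radon_ball_measure[OF assms(1) \<mu>])
  show "\<exists>!L. L \<in> nonneg_functionals \<rho> d \<and> represents \<mu> L"
  proof (rule ex1I)
    show "(\<lambda>f. \<integral>\<phi>. sym_hat f \<phi> \<partial>\<mu>) \<in> nonneg_functionals \<rho> d \<and>
        represents \<mu> (\<lambda>f. \<integral>\<phi>. sym_hat f \<phi> \<partial>\<mu>)"
      using nonneg_functional_integral[OF assms(1) \<mu>] integrable_continuous[OF continuous_on_sym_hat]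
      by (simp add: represents_def)
  qed (auto simp: represents_def)
next
  fix M :: "'v symalg set" and L \<mu>
  assume M: "power_module (2 * d) M" and \<mu>: "\<mu> \<in> ball_measures \<rho>" and rep: "represents \<mu> L"
  have "L = (\<lambda>f. \<integral>\<phi>. sym_hat f \<phi> \<partial>\<mu>)" using rep by (auto simp: represents_def)
  then show "(\<forall>f\<in>M. 0 \<le> L f) \<longleftrightarrow> supported_by \<mu> (nonneg_set M \<inter> dual_unit_ball \<rho>)"
    using supported_by_nonneg_set_iff[OF compact_radon_ball_measure[OF assms(1) \<mu>] assms(2) M] by simp
qed

end
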